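(* Let $u_0\in C(\overline D)$ be of the form $u_0(x)=s_0(|x|)x^\perp$. For $\nu>0$ let $u^\nu$ be the solution of the Navier–Stokes problem $$\partial_tu^\nu+\nabla_{u^\nu}u^\nu+\nabla p^\nu=\nu\Delta u^\nu,\quad\operatorname{div}u^\nu=0\ \text{ on } D,\qquad u^\nu(t,x)=0\ (|x|=1,\ t>0),\qquad u^\nu(0)=u_0.$$ Given $T_0\in(0,\infty)$, we have, uniformly in $t\in[0,T_0]$, as $\nu\to0$, $$u^\nu(t,\cdot)\longrightarrow u_0\quad\text{locally uniformly on the interior of } D,$$ and $$\|u^\nu(t,\cdot)\|_{L^\infty(D)}\le\|u_0\|_{L^\infty(D)}.$$
   Context: $D=\{x\in\mathbb R^2:|x|<1\}$, $x^\perp=(-x_2,x_1)$, $\nabla_uv=(u\cdot\nabla)v$. For such circularly symmetric initial data (no compatibility with the boundary condition is required) the Navier–Stokes solution is of the form $u^\nu(t,x)=s^\nu(t,|x|)x^\perp$ and coincides with the solution of the linear heat equation $\partial_tu^\nu=\nu\Delta u^\nu$ with the same initial and boundary data, i.e. $u^\nu(t)=e^{\nu tA}u_0$, where $A$ is the Dirichlet Laplacian ($\mathcal D(A)=H^2(D)\cap H^1_0(D)$, $Au=\Delta u$ on $L^2(D)$) and $e^{tA}$ its semigroup. *)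

theory Defs
  imports "HOL-Analysis.Analysis" "HOL-Probability.Essential_Supremum"
begin

abbreviation disc :: "(real ^ 2) set" where
  "disc \<equiv> ball 0 1"

abbreviation closed_disc :: "(real ^ 2) set" where
  "closed_disc \<equiv> cball 0 1"

definition perp :: "real ^ 2 \<Rightarrow> real ^ 2" where
  "perp x = vector [- (x $ 2), x $ 1]"

definition circularly_symmetric :: "(real ^ 2 \<Rightarrow> real ^ 2) \<Rightarrow> bool" where
  "circularly_symmetric v \<longleftrightarrow>
     (\<exists>s :: real \<Rightarrow> real. \<forall>x\<in>closed_disc. v x = s (norm x) *\<^sub>R perp x)"

definition Linf_norm :: "(real ^ 2 \<Rightarrow> real ^ 2) \<Rightarrow> ereal" where
  "Linf_norm v = esssup (lebesgue_on disc) (\<lambda>x. ereal (norm (v x)))"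

definition partial :: "2 \<Rightarrow> (real ^ 2 \<Rightarrow> 'a::real_normed_vector) \<Rightarrow> real ^ 2 \<Rightarrow> 'a" where
  "partial i f x = frechet_derivative f (at x) (axis i 1)"

definition grad :: "(real ^ 2 \<Rightarrow> real) \<Rightarrow> real ^ 2 \<Rightarrow> real ^ 2" where
  "grad q x = (\<chi> i. partial i q x)"

definition divergence :: "(real ^ 2 \<Rightarrow> real ^ 2) \<Rightarrow> real ^ 2 \<Rightarrow> real" where
  "divergence v x = (\<Sum>i\<in>UNIV. partial i v x $ i)"

definition laplacian :: "(real ^ 2 \<Rightarrow> 'a::real_normed_vector) \<Rightarrow> real ^ 2 \<Rightarrow> 'a" where
  "laplacian f x = (\<Sum>i\<in>UNIV. partial i (partial i f) x)"

text \<open>The covariant derivative: \<open>advect u v\<close> is \<open>(u \<cdot> \<nabla>) v\<close>.\<close>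

definition advect :: "(real ^ 2 \<Rightarrow> real ^ 2) \<Rightarrow> (real ^ 2 \<Rightarrow> real ^ 2) \<Rightarrow> real ^ 2 \<Rightarrow> real ^ 2" where
  "advect u v x = (\<Sum>i\<in>UNIV. u x $ i *\<^sub>R partial i v x)"

definition time_deriv :: "(real \<Rightarrow> real ^ 2 \<Rightarrow> 'a::real_normed_vector) \<Rightarrow> real \<Rightarrow> real ^ 2 \<Rightarrow> 'a" where
  "time_deriv u t x = vector_derivative (\<lambda>\<tau>. u \<tau> x) (at t)"

text \<open>Derivatives are only taken at interior points, so continuity of a derivative up to
  the boundary is expressed by the existence of a continuous extension from
  \<open>(0,\<infinity>) \<times> D\<close> to \<open>(0,\<infinity>) \<times> closure D\<close>. Nothing is required as \<open>t \<rightarrow> 0\<close>.\<close>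

definition continuous_up_to_boundary ::
    "(real \<Rightarrow> real ^ 2 \<Rightarrow> 'a::topological_space) \<Rightarrow> bool" where
  "continuous_up_to_boundary f \<longleftrightarrow>
     (\<exists>g :: real \<times> (real ^ 2) \<Rightarrow> 'a. continuous_on ({0<..} \<times> closed_disc) g \<and>
        (\<forall>t>0. \<forall>x\<in>disc. g (t, x) = f t x))"

definition regular_velocity :: "(real \<Rightarrow> real ^ 2 \<Rightarrow> real ^ 2) \<Rightarrow> bool" where
  "regular_velocity u \<longleftrightarrow>
     continuous_on ({0<..} \<times> closed_disc) (\<lambda>(t, x). u t x) \<and>
     (\<forall>t>0. \<forall>x\<in>disc. (\<lambda>\<tau>. u \<tau> x) differentiable (at t) \<and> u t differentiable (at x) \<and>
        (\<forall>i. partial i (u t) differentiable (at x))) \<and>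
     continuous_up_to_boundary (time_deriv u) \<and>
     (\<forall>i. continuous_up_to_boundary (\<lambda>t. partial i (u t))) \<and>
     (\<forall>i j. continuous_up_to_boundary (\<lambda>t. partial j (partial i (u t))))"

definition regular_pressure :: "(real \<Rightarrow> real ^ 2 \<Rightarrow> real) \<Rightarrow> bool" where
  "regular_pressure p \<longleftrightarrow>
     (\<forall>t>0. \<forall>x\<in>disc. p t differentiable (at x)) \<and>
     (\<forall>i. continuous_up_to_boundary (\<lambda>t. partial i (p t)))"

text \<open>The initial datum need not vanish on the boundary, so the velocity need not be
  continuous at \<open>t = 0\<close> up to the boundary. As for the heat semigroup on \<open>L\<^sup>2(D)\<close>, the
  initial value is attained continuously in the norm of \<open>L\<^sup>2(D)\<close>.\<close>

definition navier_stokes_solution ::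
    "real \<Rightarrow> (real ^ 2 \<Rightarrow> real ^ 2) \<Rightarrow> (real \<Rightarrow> real ^ 2 \<Rightarrow> real ^ 2) \<Rightarrow>
      (real \<Rightarrow> real ^ 2 \<Rightarrow> real) \<Rightarrow> bool" where
  "navier_stokes_solution \<nu> u0 u p \<longleftrightarrow>
     regular_velocity u \<and> regular_pressure p \<and>
     (\<forall>t>0. \<forall>x\<in>disc.
        time_deriv u t x + advect (u t) (u t) x + grad (p t) x = \<nu> *\<^sub>R laplacian (u t) x \<and>
        divergence (u t) x = 0) \<and>
     (\<forall>t>0. \<forall>x. norm x = 1 \<longrightarrow> u t x = 0) \<and>
     (\<forall>x\<in>closed_disc. u 0 x = u0 x) \<and>
     ((\<lambda>t. integral\<^sup>L (lebesgue_on disc) (\<lambda>x. (norm (u t x - u0 x))\<^sup>2)) \<longlongrightarrow> 0) (at_right 0)"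

end

theory Submission
  imports Defs
begin

text \<open>
  Rotational symmetry makes the problem linear. If \<open>u\<close> solves the Navier--Stokes problem with a
  circularly symmetric datum, so does every conjugate \<open>R\<^sup>-\<^sup>1 \<circ> u(t) \<circ> R\<close> by a rotation \<open>R\<close>
  (\<open>ns_rotate\<close>), so uniqueness (\<open>ns_unique\<close>) makes \<open>u(t)\<close> commute with all rotations. For such a
  field \<open>div u = 0\<close> says that \<open>u \<bullet> x\<close> is constant along rays, hence zero; then \<open>(u \<bullet> \<nabla>) u\<close> is radial,
  and \<open>\<nabla>p\<close> cannot have an angular component because \<open>p\<close> is periodic in the angle. The angular part
  of the momentum equation, which is all of \<open>\<partial>\<^sub>tu - \<nu> \<Delta>u\<close>, is therefore the heat equation
  (\<open>ns_heat_equation\<close>).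

  Uniqueness is the two-dimensional energy argument. With \<open>w = u - v\<close>, \<open>Y = \<parallel>w\<parallel>\<^sup>2\<close> and \<open>E = \<parallel>\<nabla>v\<parallel>\<^sup>2\<close>
  (norms in \<open>L\<^sup>2\<close> of the disc), the Ladyzhenskaya inequality gives \<open>Y' \<le> 2 Y E / \<nu>\<close>. Since
  \<open>e = \<parallel>v\<parallel>\<^sup>2\<close> satisfies \<open>e' = -2 \<nu> E\<close>, the product \<open>Y exp(e / \<nu>\<^sup>2)\<close> is nonincreasing; it tends to
  \<open>0\<close> as \<open>t \<rightarrow> 0\<close> because both solutions attain the datum in \<open>L\<^sup>2\<close>, hence \<open>Y = 0\<close>. Every integration by
  parts used here has the form \<open>\<integral> \<partial>\<^sub>iF = 0\<close> for an \<open>F\<close> that vanishes on the circle, and this is the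
  fundamental theorem of calculus on chords together with Fubini's theorem.

  For the heat equation both assertions follow from one comparison principle (\<open>ns_comparison\<close>).
  The function \<open>a + b (|x - x\<^sub>0|\<^sup>2 + 4 \<nu> t)\<close> solves the heat equation in the plane; if it
  dominates \<open>u\<^sub>0 \<bullet> e\<close> at time \<open>0\<close> and is nonnegative on the circle, it dominates \<open>u \<bullet> e\<close> at all
  times. As the datum is attained only in \<open>L\<^sup>2\<close> and may be incompatible with the boundary condition,
  this is proved by showing that the integral of a convex penalty of the excess is nonincreasing.
  The choice \<open>b = 0\<close> and \<open>a = sup |u\<^sub>0|\<close> is the maximum principle. If \<open>u\<^sub>0\<close> oscillates by at most \<open>\<epsilon>\<close>
  within distance \<open>\<delta>\<close> of \<open>x\<^sub>0\<close> and the circle is at least \<open>\<delta>\<close> away, then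
  \<open>a = u\<^sub>0(x\<^sub>0) \<bullet> e + \<epsilon>\<close> and \<open>b = 2 M / \<delta>\<^sup>2\<close> with \<open>M = sup |u\<^sub>0|\<close> are admissible, whence
  \<open>|u(t, x\<^sub>0) - u\<^sub>0(x\<^sub>0)| \<le> \<epsilon> + 8 M \<nu> t / \<delta>\<^sup>2\<close>, which is uniform over compact subsets of the disc and
  over \<open>t \<le> T\<^sub>0\<close>.
\<close>

section \<open>Integration over the disc\<close>
text \<open>
  Solutions and their derivatives are continuous on the open disc with continuous extensions
  to the closed disc. Continuity and boundedness on the open disc is the part of this that
  integration needs, and it is stable under all the algebra below.
\<close>
definition tame :: "(real ^ 2 \<Rightarrow> 'a::real_normed_vector) \<Rightarrow> bool" where
  "tame f \<longleftrightarrow> continuous_on disc f \<and> bounded (f ` disc)"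

abbreviation disc_integral :: "(real ^ 2 \<Rightarrow> real) \<Rightarrow> real" where
  "disc_integral f \<equiv> set_lebesgue_integral lborel disc f"

lemma tame_boundE:
  assumes "tame f"
  obtains B where "B > 0" "\<And>x. x \<in> disc \<Longrightarrow> norm (f x) \<le> B"
  using assms unfolding tame_def bounded_pos by auto

lemma tameI:
  assumes "continuous_on disc f" "\<And>x. x \<in> disc \<Longrightarrow> norm (f x) \<le> B"
  shows "tame f"
  using assms unfolding tame_def bounded_iff by fast

lemma tame_cong:
  assumes "tame f" "\<And>x. x \<in> disc \<Longrightarrow> f x = g x"
  shows "tame g"
  using assms unfolding tame_def by (metis (no_types, lifting) continuous_on_cong image_cong)

lemma tame_const: "tame (\<lambda>x. c)"
  by (rule tameI[of _ "norm c"]) auto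

lemma tame_bounded_linear:
  assumes "bounded_linear h" "tame f" shows "tame (\<lambda>x. h (f x))"
  using bounded_linear_image[OF _ assms(1), of "f ` disc"] assms(2)
  unfolding tame_def by (auto intro: bounded_linear.continuous_on[OF assms(1)] simp: image_image)

lemma tame_bounded_bilinear:
  assumes h: "bounded_bilinear h" and "tame f" "tame g"
  shows "tame (\<lambda>x. h (f x) (g x))"
proof -
  obtain K where K: "K > 0" "\<And>a b. norm (h a b) \<le> norm a * norm b * K"
    using bounded_bilinear.pos_bounded[OF h] by blast
  obtain B C where B: "B > 0" "\<And>x. x \<in> disc \<Longrightarrow> norm (f x) \<le> B"
    and C: "C > 0" "\<And>x. x \<in> disc \<Longrightarrow> norm (g x) \<le> C"
    using assms tame_boundE by metis
  show ?thesis
  proof (rule tameI)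
    show "continuous_on disc (\<lambda>x. h (f x) (g x))"
      using assms unfolding tame_def by (auto intro: bounded_bilinear.continuous_on[OF h])
    show "norm (h (f x) (g x)) \<le> B * C * K" if "x \<in> disc" for x
      using K(2)[of "f x" "g x"] B(2)[OF that] C(2)[OF that] \<open>K > 0\<close> \<open>B > 0\<close>
      by (smt (verit) mult_mono norm_ge_zero mult_right_mono)
  qed
qed

lemmas tame_mult = tame_bounded_bilinear[OF bounded_bilinear_mult]
  and tame_inner = tame_bounded_bilinear[OF bounded_bilinear_inner]
  and tame_scaleR = tame_bounded_bilinear[OF bounded_bilinear_scaleR]
  and tame_nth = tame_bounded_linear[OF bounded_linear_vec_nth]

lemma tame_add: "tame f \<Longrightarrow> tame g \<Longrightarrow> tame (\<lambda>x. f x + g x)"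
  unfolding tame_def by (auto intro: continuous_on_add bounded_plus_comp)

lemma tame_diff: "tame f \<Longrightarrow> tame g \<Longrightarrow> tame (\<lambda>x. f x - g x)"
  unfolding tame_def by (auto intro: continuous_on_diff bounded_minus_comp)

lemma tame_norm: "tame f \<Longrightarrow> tame (\<lambda>x. norm (f x))"
  unfolding tame_def bounded_iff by (auto intro: continuous_on_norm)

lemma tame_sum: "finite A \<Longrightarrow> (\<And>i. i \<in> A \<Longrightarrow> tame (f i)) \<Longrightarrow> tame (\<lambda>x. \<Sum>i\<in>A. f i x)"
  by (induction A rule: finite_induct) (auto intro!: tame_add tame_const)

lemma tame_power: "tame f \<Longrightarrow> tame (\<lambda>x. (f x :: real) ^ n)"
  by (induction n) (auto intro!: tame_mult tame_const)

lemmas tame_intros = tame_const tame_mult tame_inner tame_scaleR tame_nth tame_add tame_diff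
  tame_norm tame_sum tame_power

lemma tame_continuous:
  assumes "continuous_on closed_disc f" shows "tame f"
  unfolding tame_def
  by (metis assms ball_subset_cball bounded_subset compact_cball compact_continuous_image
      compact_imp_bounded continuous_on_subset image_mono)

lemma measurable_disc_indicator:
  fixes f :: "real ^ 2 \<Rightarrow> real"
  assumes "continuous_on disc f"
  shows "(\<lambda>x. indicator disc x * f x) \<in> borel_measurable borel"
  using borel_measurable_continuous_on_indicator[OF _ assms] by simp

lemma tame_set_integrable:
  fixes f :: "real ^ 2 \<Rightarrow> real"
  assumes "tame f" shows "set_integrable lborel disc f"
proof -
  obtain B where B: "B > 0" "\<And>x. x \<in> disc \<Longrightarrow> norm (f x) \<le> B"
    using assms tame_boundE by blast
  show ?thesis
    unfolding set_integrable_def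
  proof (rule Bochner_Integration.integrable_bound)
    show "integrable lborel (\<lambda>x. indicator disc x *\<^sub>R B)"
      by (intro integrable_scaleR_left integrable_real_indicator) (use emeasure_bounded_finite[OF bounded_ball] in auto)
    show "(\<lambda>x. indicator disc x *\<^sub>R f x) \<in> borel_measurable lborel"
      using measurable_disc_indicator assms by (simp add: tame_def)
    show "AE x in lborel. norm (indicator disc x *\<^sub>R f x) \<le> norm (indicator disc x *\<^sub>R B)"
      using B by (intro AE_I2) (auto simp: indicator_def)
  qed
qed

lemma disc_integral_cong:
  "(\<And>x. x \<in> disc \<Longrightarrow> f x = g x) \<Longrightarrow> disc_integral f = disc_integral g"
  by (rule set_lebesgue_integral_cong) auto

lemma disc_integral_add:
  "tame f \<Longrightarrow> tame g \<Longrightarrow> disc_integral (\<lambda>x. f x + g x) = disc_integral f + disc_integral g"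
  by (intro set_integral_add tame_set_integrable)

lemma disc_integral_diff:
  "tame f \<Longrightarrow> tame g \<Longrightarrow> disc_integral (\<lambda>x. f x - g x) = disc_integral f - disc_integral g"
  by (intro set_integral_diff tame_set_integrable)

lemma disc_integral_sum:
  "finite A \<Longrightarrow> (\<And>i. i \<in> A \<Longrightarrow> tame (f i)) \<Longrightarrow>
    disc_integral (\<lambda>x. \<Sum>i\<in>A. f i x) = (\<Sum>i\<in>A. disc_integral (f i))"
proof (induction A rule: finite_induct)
  case (insert i A)
  then show ?case by (simp add: disc_integral_add tame_sum)
qed (simp add: set_lebesgue_integral_def)

lemma disc_integral_mono:
  "tame f \<Longrightarrow> tame g \<Longrightarrow> (\<And>x. x \<in> disc \<Longrightarrow> f x \<le> g x) \<Longrightarrow> disc_integral f \<le> disc_integral g"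
  by (intro set_integral_mono tame_set_integrable)

lemma disc_integral_nonneg:
  "(\<And>x. x \<in> disc \<Longrightarrow> 0 \<le> f x) \<Longrightarrow> 0 \<le> disc_integral f"
  unfolding set_lebesgue_integral_def
  by (intro Bochner_Integration.integral_nonneg) (auto simp: indicator_def)

text \<open>
  A nonnegative continuous function with integral zero vanishes everywhere, not just almost
  everywhere: the set where it is positive is open and negligible.
\<close>
lemma disc_integral_eq_0D:
  assumes f: "tame f" "\<And>x. x \<in> disc \<Longrightarrow> 0 \<le> f x" and "disc_integral f \<le> 0" and x: "x \<in> disc"
  shows "f x = 0"
proof -
  have "disc_integral f = 0" using assms disc_integral_nonneg[of f] by force
  then have "AE x in lborel. indicator disc x *\<^sub>R f x = 0"
    using tame_set_integrable[OF f(1)] f(2)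
    unfolding set_lebesgue_integral_def set_integrable_def
    by (subst (asm) integral_nonneg_eq_0_iff_AE) (auto simp: indicator_def)
  then have ae: "AE x in lborel. x \<in> disc \<longrightarrow> f x = 0"
    by eventually_elim (auto simp: indicator_def)
  show ?thesis
  proof (rule ccontr)
    assume ne: "f x \<noteq> 0"
    have op: "open {y \<in> disc. f y \<noteq> 0}"
    proof -
      have "open (disc \<inter> f -` (- {0}))"
        using f(1) by (intro continuous_open_preimage) (auto simp: tame_def)
      also have "disc \<inter> f -` (- {0}) = {y \<in> disc. f y \<noteq> 0}" by auto
      finally show ?thesis .
    qed
    have "{y \<in> space lborel. \<not> (y \<in> disc \<longrightarrow> f y = 0)} = {y \<in> disc. f y \<noteq> 0}"
      by auto
    then have "{y \<in> disc. f y \<noteq> 0} \<in> null_sets lborel"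
      using ae op AE_iff_null[of lborel "\<lambda>y. y \<in> disc \<longrightarrow> f y = 0"] borel_open[OF op] by simp
    then have "negligible {y \<in> disc. f y \<noteq> 0}"
      by (simp add: negligible_iff_null_sets null_sets_completionI)
    then have "{y \<in> disc. f y \<noteq> 0} = {}"
      using open_not_negligible[OF op] by argo
    then show False using ne x by blast
  qed
qed

lemma disc_integral_eq_lebesgue:
  assumes "tame f"
  shows "integral\<^sup>L (lebesgue_on disc) f = disc_integral f"
proof -
  have "integral\<^sup>L (lebesgue_on disc) f = integral\<^sup>L lebesgue (\<lambda>x. indicator disc x *\<^sub>R f x)"
    by (subst integral_restrict_space) auto
  also have "\<dots> = disc_integral f"
    unfolding set_lebesgue_integral_def
    by (rule integral_completion) (use assms measurable_disc_indicator in \<open>auto simp: tame_def\<close>)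
  finally show ?thesis .
qed

text \<open>
  The discriminant of the nonnegative quadratic form \<open>(s, t) \<mapsto> \<integral> (s f - t g)\<^sup>2\<close>.
\<close>
lemma disc_integral_Cauchy_Schwarz:
  assumes f: "tame f" and g: "tame g"
  shows "(disc_integral (\<lambda>x. f x * g x))\<^sup>2 \<le> disc_integral (\<lambda>x. (f x)\<^sup>2) * disc_integral (\<lambda>x. (g x)\<^sup>2)"
proof -
  let ?a = "disc_integral (\<lambda>x. (f x)\<^sup>2)" and ?b = "disc_integral (\<lambda>x. f x * g x)"
    and ?c = "disc_integral (\<lambda>x. (g x)\<^sup>2)"
  have q: "0 \<le> s\<^sup>2 * ?a - 2 * s * t * ?b + t\<^sup>2 * ?c" for s t
  proof -
    have "0 \<le> disc_integral (\<lambda>x. (s * f x - t * g x)\<^sup>2)"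
      by (rule disc_integral_nonneg) auto
    also have "\<dots> = disc_integral (\<lambda>x. s\<^sup>2 * (f x)\<^sup>2 - 2 * s * t * (f x * g x) + t\<^sup>2 * (g x)\<^sup>2)"
      by (rule disc_integral_cong) (simp add: power2_eq_square algebra_simps)
    also have "\<dots> = s\<^sup>2 * ?a - 2 * s * t * ?b + t\<^sup>2 * ?c"
      using f g by (simp add: disc_integral_add disc_integral_diff tame_intros)
    finally show ?thesis .
  qed
  have a: "0 \<le> ?a" and c: "0 \<le> ?c" by (auto intro!: disc_integral_nonneg)
  show ?thesis
  proof (cases "?a = 0")
    case True
    have "?b = 0"
    proof (rule ccontr)
      assume b: "?b \<noteq> 0"
      \<comment> \<open>the form is affine in \<open>s\<close>, and this \<open>s\<close> makes it equal to \<open>-1\<close>\<close>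
      have "0 \<le> - 2 * ((?c + 1) / (2 * ?b)) * ?b + ?c"
        using q[of "(?c + 1) / (2 * ?b)" 1] unfolding True mult_zero_right by (simp only: mult_1_right power_one mult_1_left diff_0 mult_minus_left)
      moreover have "2 * ((?c + 1) / (2 * ?b)) * ?b = ?c + 1"
        using b by simp
      ultimately show False by linarith
    qed
    then show ?thesis using a c by simp
  next
    case False
    then have "?a > 0" using a by simp
    \<comment> \<open>the minimum of the form over \<open>s\<close> for fixed \<open>t\<close> is at \<open>s / t = b / a\<close>\<close>
    have "0 \<le> ?b\<^sup>2 * ?a - 2 * ?b * ?a * ?b + ?a\<^sup>2 * ?c" using q[of "?b" "?a"] .
    then have "0 \<le> ?a * (?a * ?c - ?b\<^sup>2)" by (simp add: power2_eq_square algebra_simps)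
    then show ?thesis using \<open>?a > 0\<close> by (simp add: zero_le_mult_iff)
  qed
qed

section \<open>Chords and Fubini\<close>
text \<open>
  The line in direction \<open>i\<close> at height \<open>y\<close>. In the index type \<open>2\<close> addition is modulo two, so
  \<open>i + 1\<close> is the other index and both orders of iterated integration are instances of the
  same statements.
\<close>
definition chord :: "2 \<Rightarrow> real \<Rightarrow> real \<Rightarrow> real ^ 2" where
  "chord i y s = s *\<^sub>R axis i 1 + y *\<^sub>R axis (i + 1) 1"

lemma index_2_succ: "(i::2) + 1 \<noteq> i" "(i::2) + 1 + 1 = i" "UNIV = {i, i + 1}" 
  using exhaust_2[of i] by (auto simp: UNIV_2)

lemma chord_nth: "chord i y s $ i = s" "chord i y s $ (i + 1) = y"
  using index_2_succ[of i] by (auto simp: chord_def axis_def)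

lemma norm_chord: "(norm (chord i y s))\<^sup>2 = s\<^sup>2 + y\<^sup>2"
  unfolding power2_norm_eq_inner inner_vec_def index_2_succ(3)[of i]
  using index_2_succ(1)[of i] by (simp add: chord_nth power2_eq_square)

lemma chord_in_disc: "chord i y s \<in> disc \<longleftrightarrow> s\<^sup>2 + y\<^sup>2 < 1"
  using norm_chord[of i y s] by (simp add: abs_square_less_1[symmetric] del: abs_square_less_1)
    (metis abs_norm_cancel abs_square_less_1)

lemma continuous_on_chord [continuous_intros]:
  "continuous_on A f \<Longrightarrow> continuous_on A g \<Longrightarrow> continuous_on A (\<lambda>z. chord i (f z) (g z))"
  unfolding chord_def by (intro continuous_intros)

lemma measurable_chord: "(\<lambda>(y, s). chord i y s) \<in> borel \<Otimes>\<^sub>M borel \<rightarrow>\<^sub>M borel"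
proof -
  have "continuous_on UNIV (\<lambda>p. chord i (fst p) (snd p))" by (intro continuous_intros)
  then show ?thesis
    by (simp add: borel_prod case_prod_beta borel_measurable_continuous_onI)
qed

text \<open>
  The coordinates \<open>(y, s)\<close> are measure preserving because preimages of boxes are rectangles
  with the same side lengths.
\<close>
lemma distr_chord:
  "distr (lborel \<Otimes>\<^sub>M lborel) borel (\<lambda>(y, s). chord i y s) = lborel"
proof (rule lborel_eqI[symmetric])
  fix l u :: "real ^ 2" assume "\<And>b. b \<in> Basis \<Longrightarrow> l \<bullet> b \<le> u \<bullet> b"
  then have le: "l $ j \<le> u $ j" for j
    by (metis axis_in_Basis_iff cart_eq_inner_axis Basis_real_def insertI1)
  have pre: "(\<lambda>(y, s). chord i y s) -` box l u = {l$(i+1)<..<u$(i+1)} \<times> {l$i<..<u$i}"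
  proof -
    have "(\<forall>j. P j) \<longleftrightarrow> P i \<and> P (i + 1)" for P :: "2 \<Rightarrow> bool"
      using ball_UNIV[of P] unfolding index_2_succ(3)[of i] by simp
    note all = this[of "\<lambda>j. l $ j < chord i y s $ j \<and> chord i y s $ j < u $ j" for y s]
    show ?thesis
      by (auto simp only: vimage_def mem_box_cart all chord_nth split: prod.splits) auto
  qed
  have "emeasure (distr (lborel \<Otimes>\<^sub>M lborel) borel (\<lambda>(y, s). chord i y s)) (box l u)
      = emeasure (lborel \<Otimes>\<^sub>M lborel) ({l$(i+1)<..<u$(i+1)} \<times> {l$i<..<u$i})"
    by (subst emeasure_distr) (use measurable_chord[of i] in \<open>auto simp: pre space_pair_measure cong: measurable_cong_sets\<close>)
  also have "\<dots> = ennreal (u$(i+1) - l$(i+1)) * ennreal (u$i - l$i)"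
    by (subst lborel.emeasure_pair_measure_Times) (auto simp: le)
  also have "\<dots> = (\<Prod>b\<in>Basis. (u - l) \<bullet> b)"
  proof -
    have "(\<Prod>b\<in>Basis. (u - l) \<bullet> b) = (\<Prod>j\<in>UNIV. (u - l) $ j)"
      by (simp add: Basis_vec_def cart_eq_inner_axis axis_eq_axis prod.UNION_disjoint)
    also have "\<dots> = (u$(i+1) - l$(i+1)) * (u$i - l$i)"
      unfolding index_2_succ(3)[of i] using index_2_succ(1)[of i] by simp
    finally show ?thesis by (simp add: ennreal_mult[symmetric] le)
  qed
  finally show "emeasure (distr (lborel \<Otimes>\<^sub>M lborel) borel (\<lambda>(y, s). chord i y s)) (box l u)
      = (\<Prod>b\<in>Basis. (u - l) \<bullet> b)" .
qed simp

definition section_integral :: "2 \<Rightarrow> (real ^ 2 \<Rightarrow> real) \<Rightarrow> real \<Rightarrow> real" where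
  "section_integral i f y = (\<integral>s. indicator disc (chord i y s) * f (chord i y s) \<partial>lborel)"

lemma chord_integrable:
  fixes f :: "real ^ 2 \<Rightarrow> real"
  assumes "tame f"
  shows "integrable (lborel \<Otimes>\<^sub>M lborel) (\<lambda>(y, s). indicator disc (chord i y s) * f (chord i y s))"
proof -
  have "integrable (distr (lborel \<Otimes>\<^sub>M lborel) borel (\<lambda>(y, s). chord i y s)) (\<lambda>x. indicator disc x * f x)"
    unfolding distr_chord using tame_set_integrable[OF assms] by (simp add: set_integrable_def)
  then show ?thesis
    by (subst (asm) integrable_distr_eq)
      (use measurable_chord[of i] measurable_disc_indicator assms in
        \<open>simp_all add: tame_def case_prod_unfold cong: measurable_cong_sets\<close>)
qed

lemma integrable_section_integral: "tame f \<Longrightarrow> integrable lborel (section_integral i f)"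
  unfolding section_integral_def using lborel_pair.integrable_fst[OF chord_integrable[of f i]] by simp

lemma disc_integral_eq_section:
  assumes "tame f" shows "disc_integral f = (\<integral>y. section_integral i f y \<partial>lborel)"
proof -
  have "disc_integral f = (\<integral>x. indicator disc x * f x \<partial>distr (lborel \<Otimes>\<^sub>M lborel) borel (\<lambda>(y, s). chord i y s))"
    unfolding distr_chord by (simp add: set_lebesgue_integral_def)
  also have "\<dots> = (\<integral>p. (case p of (y, s) \<Rightarrow> indicator disc (chord i y s) * f (chord i y s)) \<partial>(lborel \<Otimes>\<^sub>M lborel))"
    by (subst integral_distr)
      (use measurable_chord[of i] measurable_disc_indicator assms in
        \<open>simp_all add: tame_def case_prod_unfold cong: measurable_cong_sets\<close>)
  also have "\<dots> = (\<integral>y. section_integral i f y \<partial>lborel)"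
    unfolding section_integral_def using lborel_pair.integral_fst[OF chord_integrable[OF assms, of i]] by simp
  finally show ?thesis .
qed

lemma section_integrable:
  fixes f :: "real ^ 2 \<Rightarrow> real"
  assumes "tame f"
  shows "integrable lborel (\<lambda>s. indicator disc (chord i y s) * f (chord i y s))"
proof -
  obtain B where B: "B > 0" "\<And>x. x \<in> disc \<Longrightarrow> norm (f x) \<le> B"
    using assms tame_boundE by blast
  have m: "(\<lambda>s. chord i y s) \<in> borel \<rightarrow>\<^sub>M borel"
    by (intro borel_measurable_continuous_onI continuous_intros)
  show ?thesis
  proof (rule Bochner_Integration.integrable_bound)
    show "integrable lborel (\<lambda>s. indicator {-1..1::real} s *\<^sub>R B)"
      by (intro integrable_scaleR_left integrable_real_indicator) auto
    show "(\<lambda>s. indicator disc (chord i y s) * f (chord i y s)) \<in> borel_measurable lborel"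
      using measurable_compose[OF m measurable_disc_indicator[of f]] assms by (simp add: tame_def)
    have "s \<in> {-1..1}" if "chord i y s \<in> disc" for s
    proof -
      have "s\<^sup>2 \<le> 1" using that unfolding chord_in_disc by (smt (verit) zero_le_power2)
      then show ?thesis by (simp add: abs_square_le_1 abs_le_iff)
    qed
    then show "AE s in lborel. norm (indicator disc (chord i y s) * f (chord i y s)) \<le> norm (indicator {-1..1} s *\<^sub>R B)"
      using B by (intro AE_I2) (auto simp: indicator_def)
  qed
qed

text \<open>
  Zero boundary values as a limit from inside, since products with derivatives of a solution
  are meaningful only in the open disc.
\<close>
definition vanishing :: "(real ^ 2 \<Rightarrow> 'a::real_normed_vector) \<Rightarrow> bool" where
  "vanishing f \<longleftrightarrow> (\<forall>x\<in>sphere 0 1. (f \<longlongrightarrow> 0) (at x within disc))"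

lemma chord_swap: "chord (i + 1) s y = chord i y s"
  unfolding chord_def index_2_succ(2)[of i] by (rule add.commute)

lemma dist_chord: "dist (chord i y s) (chord i y c) = \<bar>s - c\<bar>"
proof -
  have "chord i y s - chord i y c = (s - c) *\<^sub>R axis i 1" by (simp add: chord_def scaleR_diff_left)
  then show ?thesis by (simp add: dist_norm)
qed

lemma chord_has_derivative:
  assumes "F differentiable (at (chord i y s))"
  shows "((\<lambda>s. F (chord i y s)) has_vector_derivative partial i F (chord i y s)) (at s)"
proof -
  have "(F has_derivative frechet_derivative F (at (chord i y s))) (at (chord i y s))"
    using assms frechet_derivative_works by blast
  moreover have "((\<lambda>s. chord i y s) has_vector_derivative axis i 1) (at s)"
    unfolding chord_def by (auto intro!: derivative_eq_intros)
  ultimately show ?thesis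
    unfolding partial_def
    using vector_derivative_diff_chain_within[of "\<lambda>s. chord i y s" "axis i 1" s UNIV F] 
    by (auto simp: o_def intro: has_derivative_at_withinI)
qed

text \<open>
  The fundamental theorem of calculus on a chord, starting at its left end on the circle. The
  extension by zero makes the formula valid up to and including the right end, where the left
  hand side is zero.
\<close>
lemma chord_integral:
  fixes F :: "real ^ 2 \<Rightarrow> real"
  assumes diff: "\<And>x. x \<in> disc \<Longrightarrow> F differentiable (at x)"
    and tame: "tame (partial i F)" and van: "vanishing F" and y: "y\<^sup>2 < 1"
  defines "\<rho> \<equiv> sqrt (1 - y\<^sup>2)"
  defines "h \<equiv> \<lambda>s. indicator disc (chord i y s) * partial i F (chord i y s)"
  assumes c: "c \<in> {-\<rho>..\<rho>}"
  shows "(if chord i y c \<in> disc then F (chord i y c) else 0) = (\<integral>s. indicator {-\<rho><..<c} s * h s \<partial>lborel)"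
proof -
  define g where "g s = (if chord i y s \<in> disc then F (chord i y s) else 0)" for s
  have "\<rho> > 0" and \<rho>2: "\<rho>\<^sup>2 = 1 - y\<^sup>2" using y by (auto simp: \<rho>_def)
  have in_disc: "chord i y s \<in> disc \<longleftrightarrow> s \<in> {-\<rho><..<\<rho>}" for s
  proof -
    have "chord i y s \<in> disc \<longleftrightarrow> s\<^sup>2 < \<rho>\<^sup>2" unfolding chord_in_disc \<rho>2 by auto
    also have "\<dots> \<longleftrightarrow> \<bar>s\<bar> < \<rho>" using \<open>\<rho> > 0\<close> abs_le_square_iff[of \<rho> s] by auto
    finally show ?thesis by auto
  qed
  have deriv: "(g has_vector_derivative partial i F (chord i y s)) (at s)" if "s \<in> {-\<rho><..<\<rho>}" for s
    using has_vector_derivative_transform_within_open[OF chord_has_derivative[OF diff] _ that, of i y g]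
      in_disc that by (auto simp: g_def)
  have cont: "continuous_on {-\<rho>..\<rho>} g"
    unfolding continuous_on_eq_continuous_within
  proof
    fix t assume t: "t \<in> {-\<rho>..\<rho>}"
    show "continuous (at t within {-\<rho>..\<rho>}) g"
    proof (cases "t \<in> {-\<rho><..<\<rho>}")
      case True
      show ?thesis
        using has_vector_derivative_continuous[OF deriv[OF True]]
        by (rule continuous_at_imp_continuous_at_within)
    next
      case False
      then have "t = \<rho> \<or> t = -\<rho>" using t by auto
      then have "t\<^sup>2 = \<rho>\<^sup>2" by auto
      have nd: "chord i y t \<notin> disc" using False in_disc by blast
      from \<open>t\<^sup>2 = \<rho>\<^sup>2\<close> have "(norm (chord i y t))\<^sup>2 = 1" using \<rho>2 by (simp add: norm_chord)
      then have "chord i y t \<in> sphere 0 1"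
        by (simp add: abs_square_eq_1)
      then have lim: "(F \<longlongrightarrow> 0) (at (chord i y t) within disc)" using van by (auto simp: vanishing_def)
      show ?thesis
        unfolding continuous_within_eps_delta
      proof (intro allI impI)
        fix e :: real assume "e > 0"
        then obtain d where d: "d > 0"
          "\<And>x. x \<in> disc \<Longrightarrow> 0 < dist x (chord i y t) \<Longrightarrow> dist x (chord i y t) < d \<Longrightarrow> \<bar>F x\<bar> < e"
          using lim unfolding Lim_within by (metis dist_0_norm dist_commute real_norm_def)
        have "dist (g s) (g t) < e" if "dist s t < d" for s
          using d(2)[of "chord i y s"] that nd \<open>e > 0\<close>
          by (auto simp: g_def dist_chord dist_real_def)
        then show "\<exists>d>0. \<forall>s\<in>{-\<rho>..\<rho>}. dist s t < d \<longrightarrow> dist (g s) (g t) < e"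
          using d(1) by blast
      qed
    qed
  qed
  have "((\<lambda>s. partial i F (chord i y s)) has_integral (g c - g (-\<rho>))) {-\<rho>..c}"
    using c by (intro fundamental_theorem_of_calculus_interior continuous_on_subset[OF cont] deriv) auto
  moreover have "g (-\<rho>) = 0" using in_disc by (simp add: g_def)
  ultimately have "((\<lambda>s. partial i F (chord i y s)) has_integral g c) {-\<rho><..<c}"
    by (simp add: has_integral_Icc_iff_Ioo)
  then have "((\<lambda>s. if s \<in> {-\<rho><..<c} then partial i F (chord i y s) else 0) has_integral g c) UNIV"
    by (subst has_integral_restrict_UNIV)
  moreover have "(\<lambda>s. if s \<in> {-\<rho><..<c} then partial i F (chord i y s) else 0) = (\<lambda>s. indicator {-\<rho><..<c} s * h s)"
    using c in_disc by (auto simp: h_def indicator_def fun_eq_iff)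
  ultimately have "((\<lambda>s. indicator {-\<rho><..<c} s * h s) has_integral g c) UNIV" by simp
  moreover have "integrable lborel (\<lambda>s. indicator {-\<rho><..<c} s * h s)"
    unfolding h_def using integrable_mult_indicator[OF _ section_integrable[OF tame, of i y], of "{-\<rho><..<c}"] by simp
  ultimately show ?thesis
    unfolding g_def[symmetric] using has_integral_integral_lborel has_integral_unique by blast
qed

lemma section_outside:
  assumes "1 \<le> y\<^sup>2" shows "indicator disc (chord i y s) = (0::real)"
proof -
  have "chord i y s \<notin> disc" using assms unfolding chord_in_disc by (smt (verit) zero_le_power2)
  then show ?thesis by (auto simp del: mem_ball)
qed

text \<open>
  The divergence theorem for one coordinate and zero boundary values: each chord contributes
  the difference of the values at its ends.
\<close>
lemma disc_integral_partial_eq_0: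
  fixes F :: "real ^ 2 \<Rightarrow> real"
  assumes diff: "\<And>x. x \<in> disc \<Longrightarrow> F differentiable (at x)"
    and tame: "tame (partial i F)" and van: "vanishing F"
  shows "disc_integral (partial i F) = 0"
proof -
  have "section_integral i (partial i F) y = 0" for y
  proof (cases "y\<^sup>2 < 1")
    case True
    let ?\<rho> = "sqrt (1 - y\<^sup>2)"
    have \<rho>: "?\<rho> > 0" "?\<rho>\<^sup>2 = 1 - y\<^sup>2" using True by auto
    have nd: "chord i y s \<notin> disc" if "s \<notin> {-?\<rho><..<?\<rho>}" for s
    proof -
      have "?\<rho> \<le> \<bar>s\<bar>" using that by auto
      then have "?\<rho>\<^sup>2 \<le> s\<^sup>2" using \<rho>(1) abs_le_square_iff[of ?\<rho> s] by linarith
      then show ?thesis unfolding chord_in_disc \<rho>(2) by linarith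
    qed
    have "0 = (\<integral>s. indicator {-?\<rho><..<?\<rho>} s * (indicator disc (chord i y s) * partial i F (chord i y s)) \<partial>lborel)"
      using chord_integral[OF diff tame van True, of ?\<rho>] nd[of ?\<rho>] \<rho>(1) by simp
    also have "\<dots> = section_integral i (partial i F) y"
      unfolding section_integral_def
    proof (rule Bochner_Integration.integral_cong[OF refl])
      fix s
      show "indicator {-?\<rho><..<?\<rho>} s * (indicator disc (chord i y s) * partial i F (chord i y s))
          = indicator disc (chord i y s) * partial i F (chord i y s)"
      proof (cases "s \<in> {-?\<rho><..<?\<rho>}")
        case False
        show ?thesis unfolding indicator_simps(2)[OF nd[OF False]] by simp
      qed simp
    qed
    finally show ?thesis by simp
  next
    case False
    then show ?thesis by (simp add: section_integral_def section_outside)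
  qed
  then show ?thesis using disc_integral_eq_section[OF tame, of i] by simp
qed

lemma abs_le_section_integral:
  fixes F :: "real ^ 2 \<Rightarrow> real"
  assumes diff: "\<And>x. x \<in> disc \<Longrightarrow> F differentiable (at x)"
    and tame: "tame (partial i F)" and van: "vanishing F" and d: "chord i y c \<in> disc"
  shows "\<bar>F (chord i y c)\<bar> \<le> section_integral i (\<lambda>x. \<bar>partial i F x\<bar>) y"
proof -
  let ?\<rho> = "sqrt (1 - y\<^sup>2)"
  let ?h = "\<lambda>s. indicator disc (chord i y s) * partial i F (chord i y s)"
  have sq: "c\<^sup>2 + y\<^sup>2 < 1" using d unfolding chord_in_disc .
  then have y: "y\<^sup>2 < 1" by (smt (verit) zero_le_power2)
  have "\<bar>c\<bar> \<le> ?\<rho>" using sq by (intro real_le_rsqrt) simp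
  then have c: "c \<in> {-?\<rho>..?\<rho>}" by auto
  have int: "integrable lborel ?h" by (rule section_integrable[OF tame])
  have int': "integrable lborel (\<lambda>s. indicator {-?\<rho><..<c} s * ?h s)"
    using integrable_mult_indicator[OF _ int, of "{-?\<rho><..<c}"] by simp
  have "\<bar>F (chord i y c)\<bar> = \<bar>\<integral>s. indicator {-?\<rho><..<c} s * ?h s \<partial>lborel\<bar>"
    using chord_integral[OF diff tame van y c] d by simp
  also have "\<dots> \<le> (\<integral>s. \<bar>indicator {-?\<rho><..<c} s * ?h s\<bar> \<partial>lborel)"
    by (rule integral_abs_bound)
  also have "\<dots> \<le> (\<integral>s. \<bar>?h s\<bar> \<partial>lborel)"
    by (intro integral_mono integrable_abs int int') (auto simp: indicator_def)
  also have "\<dots> = section_integral i (\<lambda>x. \<bar>partial i F x\<bar>) y"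
    unfolding section_integral_def by (simp add: abs_mult)
  finally show ?thesis .
qed

text \<open>
  The embedding of \<open>W\<^sup>1\<^sup>,\<^sup>1\<close> into \<open>L\<^sup>2\<close> in the plane. At the point \<open>(y, s)\<close> the function is bounded by
  the integral \<open>A(y)\<close> of \<open>|\<partial>\<^sub>1F|\<close> along one coordinate line and by the integral \<open>B(s)\<close> of \<open>|\<partial>\<^sub>2F|\<close>
  along the other, so \<open>F\<^sup>2 \<le> A(y) B(s)\<close>, a product of functions of one variable.
\<close>
lemma Gagliardo_Nirenberg_disc:
  fixes F :: "real ^ 2 \<Rightarrow> real"
  assumes diff: "\<And>x. x \<in> disc \<Longrightarrow> F differentiable (at x)"
    and tF: "tame F" and tame: "\<And>i. tame (partial i F)" and van: "vanishing F"
  shows "disc_integral (\<lambda>x. (F x)\<^sup>2)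
    \<le> disc_integral (\<lambda>x. \<bar>partial 1 F x\<bar>) * disc_integral (\<lambda>x. \<bar>partial 2 F x\<bar>)"
proof -
  define A where "A = section_integral 1 (\<lambda>x. \<bar>partial 1 F x\<bar>)"
  define B where "B = section_integral 2 (\<lambda>x. \<bar>partial 2 F x\<bar>)"
  have t: "tame (\<lambda>x. \<bar>partial i F x\<bar>)" for i using tame_norm[OF tame[of i]] by simp
  have intA: "integrable lborel A" and intB: "integrable lborel B"
    unfolding A_def B_def by (auto intro: integrable_section_integral t)
  have nonneg: "A y \<ge> 0" "B s \<ge> 0" for y s
    unfolding A_def B_def section_integral_def by (auto intro!: Bochner_Integration.integral_nonneg)
  have eq: "chord 1 y s = chord 2 s y" for y s using chord_swap[of 1 s y] by simp
  have pt: "indicator disc (chord 1 y s) * (F (chord 1 y s))\<^sup>2 \<le> A y * B s" for y s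
  proof (cases "chord 1 y s \<in> disc")
    case True
    have "\<bar>F (chord 1 y s)\<bar> \<le> A y"
      unfolding A_def using True by (intro abs_le_section_integral diff tame van)
    moreover have "\<bar>F (chord 1 y s)\<bar> \<le> B s"
      unfolding B_def eq using True eq by (intro abs_le_section_integral diff tame van) auto
    ultimately have "\<bar>F (chord 1 y s)\<bar> * \<bar>F (chord 1 y s)\<bar> \<le> A y * B s"
      by (intro mult_mono) (auto simp: nonneg)
    then show ?thesis using True by (simp add: power2_eq_square)
  qed (auto simp: nonneg simp del: mem_ball)
  have t2: "tame (\<lambda>x. (F x)\<^sup>2)" using tF by (rule tame_power)
  have sec: "section_integral 1 (\<lambda>x. (F x)\<^sup>2) y \<le> A y * (\<integral>s. B s \<partial>lborel)" for y
  proof -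
    have "section_integral 1 (\<lambda>x. (F x)\<^sup>2) y \<le> (\<integral>s. A y * B s \<partial>lborel)"
      unfolding section_integral_def
      by (intro integral_mono section_integrable t2 pt integrable_mult_right intB)
    then show ?thesis by simp
  qed
  have "disc_integral (\<lambda>x. (F x)\<^sup>2) = (\<integral>y. section_integral 1 (\<lambda>x. (F x)\<^sup>2) y \<partial>lborel)"
    by (rule disc_integral_eq_section[OF t2])
  also have "\<dots> \<le> (\<integral>y. A y * (\<integral>s. B s \<partial>lborel) \<partial>lborel)"
    by (intro integral_mono integrable_section_integral t2 sec integrable_mult_left intA)
  also have "\<dots> = (\<integral>y. A y \<partial>lborel) * (\<integral>s. B s \<partial>lborel)" by simp
  also have "\<dots> = disc_integral (\<lambda>x. \<bar>partial 1 F x\<bar>) * disc_integral (\<lambda>x. \<bar>partial 2 F x\<bar>)"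
    unfolding A_def B_def by (simp add: disc_integral_eq_section[OF t, symmetric])
  finally show ?thesis .
qed

section \<open>Partial derivatives on the disc\<close>
lemma has_derivative_partial:
  "(f has_derivative D) (at x) \<Longrightarrow> partial i f x = D (axis i 1)"
  unfolding partial_def using frechet_derivative_at by metis

text \<open>
  The disc is open, so derivatives at its points see only the values in the disc. This allows
  second derivatives to be computed from formulas for first derivatives that hold in the disc.
\<close>
lemma frechet_derivative_cong_disc:
  assumes "\<And>x. x \<in> disc \<Longrightarrow> f x = g x" "x \<in> disc"
  shows "(f has_derivative D) (at x) \<longleftrightarrow> (g has_derivative D) (at x)"
  using has_derivative_transform_within_open[of f D x UNIV disc g]
    has_derivative_transform_within_open[of g D x UNIV disc f] assms by (metis open_ball)

lemma partial_cong_disc: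
  assumes "\<And>x. x \<in> disc \<Longrightarrow> f x = g x" "x \<in> disc"
  shows "partial i f x = partial i g x"
  unfolding partial_def frechet_derivative_def using frechet_derivative_cong_disc[of f g x] assms by simp

lemma differentiable_cong_disc:
  assumes "\<And>x. x \<in> disc \<Longrightarrow> f x = g x" "x \<in> disc" "f differentiable (at x)"
  shows "g differentiable (at x)"
  using assms frechet_derivative_cong_disc[of f g x] unfolding differentiable_def by auto

lemma has_derivative_sum_partial:
  assumes "f differentiable (at x)"
  shows "(f has_derivative (\<lambda>h. \<Sum>i\<in>UNIV. h $ i *\<^sub>R partial i f x)) (at x)"
proof -
  have D: "(f has_derivative frechet_derivative f (at x)) (at x)"
    using assms frechet_derivative_works by blast
  have lin: "linear (frechet_derivative f (at x))"
    using D has_derivative_linear by blast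
  have "frechet_derivative f (at x) h = (\<Sum>i\<in>UNIV. h $ i *\<^sub>R partial i f x)" for h
  proof -
    have "h = (\<Sum>i\<in>UNIV. h $ i *\<^sub>R axis i 1)"
      using basis_expansion[of h] by (simp add: vector_scalar_mult_def vec_eq_iff axis_def if_distrib cong: if_cong)
    then have "frechet_derivative f (at x) h = frechet_derivative f (at x) (\<Sum>i\<in>UNIV. h $ i *\<^sub>R axis i 1)"
      by simp
    also have "\<dots> = (\<Sum>i\<in>UNIV. h $ i *\<^sub>R partial i f x)"
      by (simp add: linear_sum[OF lin] linear_scale[OF lin] partial_def)
    finally show ?thesis .
  qed
  then show ?thesis using D by (metis (no_types, lifting) ext)
qed

lemma partial_bilinear:
  assumes h: "bounded_bilinear h" and "f differentiable (at x)" "g differentiable (at x)"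
  shows "partial i (\<lambda>x. h (f x) (g x)) x = h (f x) (partial i g x) + h (partial i f x) (g x)"
    and "(\<lambda>x. h (f x) (g x)) differentiable (at x)"
proof -
  have "((\<lambda>x. h (f x) (g x)) has_derivative
      (\<lambda>k. h (f x) (frechet_derivative g (at x) k) + h (frechet_derivative f (at x) k) (g x))) (at x)"
    using assms by (intro bounded_bilinear.FDERIV[OF h]) (auto simp: frechet_derivative_works[symmetric])
  then show "partial i (\<lambda>x. h (f x) (g x)) x = h (f x) (partial i g x) + h (partial i f x) (g x)"
    and "(\<lambda>x. h (f x) (g x)) differentiable (at x)"
    using has_derivative_partial by (fastforce simp: partial_def differentiable_def)+
qed

lemma partial_bounded_linear:
  assumes h: "bounded_linear h" and "f differentiable (at x)"
  shows "partial i (\<lambda>x. h (f x)) x = h (partial i f x)"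
    and "(\<lambda>x. h (f x)) differentiable (at x)"
proof -
  have "((\<lambda>x. h (f x)) has_derivative (\<lambda>k. h (frechet_derivative f (at x) k))) (at x)"
    using assms by (intro bounded_linear.has_derivative[OF h]) (auto simp: frechet_derivative_works[symmetric])
  then show "partial i (\<lambda>x. h (f x)) x = h (partial i f x)" and "(\<lambda>x. h (f x)) differentiable (at x)"
    using has_derivative_partial by (fastforce simp: partial_def differentiable_def)+
qed

lemma partial_add_diff:
  assumes "f differentiable (at x)" "g differentiable (at x)"
  shows "partial i (\<lambda>x. f x + g x) x = partial i f x + partial i g x"
    and "partial i (\<lambda>x. f x - g x) x = partial i f x - partial i g x"
proof -
  have D: "(f has_derivative frechet_derivative f (at x)) (at x)" "(g has_derivative frechet_derivative g (at x)) (at x)"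
    using assms by (auto simp: frechet_derivative_works[symmetric])
  show "partial i (\<lambda>x. f x + g x) x = partial i f x + partial i g x"
    using has_derivative_partial[OF has_derivative_add[OF D]] by (simp add: partial_def)
  show "partial i (\<lambda>x. f x - g x) x = partial i f x - partial i g x"
    using has_derivative_partial[OF has_derivative_diff[OF D]] by (simp add: partial_def)
qed

text \<open>
  Bounded continuous derivatives in the open disc are what integration by parts needs of the
  regularity up to the boundary.
\<close>
definition C1_disc :: "(real ^ 2 \<Rightarrow> 'a::real_normed_vector) \<Rightarrow> bool" where
  "C1_disc f \<longleftrightarrow> tame f \<and> (\<forall>x\<in>disc. f differentiable (at x)) \<and> (\<forall>i. tame (partial i f))"

definition C2_disc :: "(real ^ 2 \<Rightarrow> 'a::real_normed_vector) \<Rightarrow> bool" where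
  "C2_disc f \<longleftrightarrow> C1_disc f \<and> (\<forall>i. C1_disc (partial i f))"

lemma C1_discD:
  assumes "C1_disc f"
  shows "tame f" "x \<in> disc \<Longrightarrow> f differentiable (at x)" "tame (partial i f)"
  using assms by (auto simp: C1_disc_def)

lemma C2_discD:
  assumes "C2_disc f"
  shows "C1_disc f" "C1_disc (partial i f)"
  using assms by (auto simp: C2_disc_def)

lemma C1_disc_cong:
  assumes "C1_disc f" "\<And>x. x \<in> disc \<Longrightarrow> f x = g x"
  shows "C1_disc g"
  unfolding C1_disc_def
proof (intro conjI ballI allI)
  show "tame g" using C1_discD(1)[OF assms(1)] assms(2) by (rule tame_cong)
  show "g differentiable (at x)" if "x \<in> disc" for x
    using differentiable_cong_disc[of f g x] C1_discD(2)[OF assms(1) that] assms(2) that by blast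
  show "tame (partial i g)" for i
    using tame_cong[of "partial i f" "partial i g"] C1_discD(3)[OF assms(1)]
      partial_cong_disc[of f g] assms(2) by blast
qed

lemma C1_disc_bilinear:
  assumes h: "bounded_bilinear h" and f: "C1_disc f" and g: "C1_disc g"
  shows "C1_disc (\<lambda>x. h (f x) (g x))"
  unfolding C1_disc_def
proof (intro conjI ballI allI)
  show "tame (\<lambda>x. h (f x) (g x))" by (intro tame_bounded_bilinear[OF h] C1_discD f g)
  show "(\<lambda>x. h (f x) (g x)) differentiable (at x)" if "x \<in> disc" for x
    by (intro partial_bilinear(2)[OF h] C1_discD(2) f g that)
  have "tame (\<lambda>x. h (f x) (partial i g x) + h (partial i f x) (g x))" for i
    by (intro tame_add tame_bounded_bilinear[OF h] C1_discD f g)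
  then show "tame (partial i (\<lambda>x. h (f x) (g x)))" for i
    by (rule tame_cong) (simp add: partial_bilinear(1)[OF h] C1_discD(2) f g del: mem_ball)
qed

lemma C1_disc_bounded_linear:
  assumes h: "bounded_linear h" and f: "C1_disc f"
  shows "C1_disc (\<lambda>x. h (f x))"
  unfolding C1_disc_def
proof (intro conjI ballI allI)
  show "tame (\<lambda>x. h (f x))" by (intro tame_bounded_linear[OF h] C1_discD f)
  show "(\<lambda>x. h (f x)) differentiable (at x)" if "x \<in> disc" for x
    by (intro partial_bounded_linear(2)[OF h] C1_discD(2) f that)
  have "tame (\<lambda>x. h (partial i f x))" for i
    by (intro tame_bounded_linear[OF h] C1_discD f)
  then show "tame (partial i (\<lambda>x. h (f x)))" for i
    by (rule tame_cong) (simp add: partial_bounded_linear(1)[OF h] C1_discD(2) f del: mem_ball)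
qed

lemma C1_disc_diff:
  assumes f: "C1_disc f" and g: "C1_disc g"
  shows "C1_disc (\<lambda>x. f x - g x)"
  unfolding C1_disc_def
proof (intro conjI ballI allI)
  show "tame (\<lambda>x. f x - g x)" by (intro tame_diff C1_discD f g)
  show "(\<lambda>x. f x - g x) differentiable (at x)" if "x \<in> disc" for x
    by (intro differentiable_diff C1_discD(2) f g that)
  have "tame (\<lambda>x. partial i f x - partial i g x)" for i
    by (intro tame_diff C1_discD f g)
  then show "tame (partial i (\<lambda>x. f x - g x))" for i
    by (rule tame_cong) (simp add: partial_add_diff C1_discD(2) f g del: mem_ball)
qed

lemma C2_disc_diff:
  assumes f: "C2_disc f" and g: "C2_disc g"
  shows "C2_disc (\<lambda>x. f x - g x)"
  unfolding C2_disc_def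
proof (intro conjI allI)
  show "C1_disc (\<lambda>x. f x - g x)" by (intro C1_disc_diff C2_discD f g)
  show "C1_disc (partial i (\<lambda>x. f x - g x))" for i
    by (rule C1_disc_cong[OF C1_disc_diff[OF C2_discD(2)[OF f] C2_discD(2)[OF g]]])
      (simp add: partial_add_diff C1_discD(2) C2_discD f g del: mem_ball)
qed

lemma laplacian_diff:
  assumes f: "C2_disc f" and g: "C2_disc g" and x: "x \<in> disc"
  shows "laplacian (\<lambda>x. f x - g x) x = laplacian f x - laplacian g x"
proof -
  have "partial i (partial i (\<lambda>x. f x - g x)) x = partial i (partial i f) x - partial i (partial i g) x" for i
  proof -
    have "partial i (partial i (\<lambda>x. f x - g x)) x = partial i (\<lambda>x. partial i f x - partial i g x) x"
      by (rule partial_cong_disc[OF _ x]) (simp add: partial_add_diff C1_discD(2) C2_discD f g del: mem_ball)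
    also have "\<dots> = partial i (partial i f) x - partial i (partial i g) x"
      by (intro partial_add_diff C1_discD(2) C2_discD f g x)
    finally show ?thesis .
  qed
  then show ?thesis by (simp add: laplacian_def sum_subtractf)
qed

text \<open>
  The regularity of the pressure is a condition on its gradient; a bounded gradient on a convex set makes it
  Lipschitz and hence bounded.
\<close>
lemma C1_disc_of_bounded_gradient:
  fixes q :: "real ^ 2 \<Rightarrow> real"
  assumes diff: "\<And>x. x \<in> disc \<Longrightarrow> q differentiable (at x)" and tame: "\<And>i. tame (partial i q)"
  shows "C1_disc q"
proof -
  obtain B where B: "\<And>i. B i > 0" "\<And>i x. x \<in> disc \<Longrightarrow> norm (partial i q x) \<le> B i"
  proof -
    have "\<forall>i. \<exists>B>0. \<forall>x\<in>disc. norm (partial i q x) \<le> B"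
      using tame_boundE[OF tame] by metis
    then show ?thesis using that by metis
  qed
  have "norm (q x - q 0) \<le> (B 1 + B 2) * norm (x - 0)" if x: "x \<in> disc" for x
  proof (rule differentiable_bound[OF convex_ball _ _ x])
    fix x assume x: "x \<in> disc"
    show "(q has_derivative (\<lambda>h. \<Sum>i\<in>UNIV. h $ i *\<^sub>R partial i q x)) (at x within disc)"
      using has_derivative_sum_partial[OF diff[OF x]] by (rule has_derivative_at_withinI)
    show "onorm (\<lambda>h. \<Sum>i\<in>UNIV. h $ i *\<^sub>R partial i q x) \<le> B 1 + B 2"
    proof (rule onorm_bound)
      show "norm (\<Sum>i\<in>UNIV. h $ i *\<^sub>R partial i q x) \<le> (B 1 + B 2) * norm h" for h
      proof -
        have "\<bar>h $ i * partial i q x\<bar> \<le> norm h * B i" for i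
          unfolding abs_mult using B(2)[OF x, of i] component_le_norm_cart[of h i] by (intro mult_mono) auto
        then have "\<bar>h $ 1 * partial 1 q x\<bar> + \<bar>h $ 2 * partial 2 q x\<bar> \<le> norm h * B 1 + norm h * B 2"
          by (meson add_mono)
        then show ?thesis by (simp add: sum_2 algebra_simps)
      qed
    qed (use B(1) in \<open>simp add: less_imp_le\<close>)
  qed auto
  then have "norm (q x) \<le> norm (q 0) + (B 1 + B 2) * 1" if "x \<in> disc" for x
    using that B(1)[of 1] B(1)[of 2] mult_left_mono[of "norm x" 1 "B 1 + B 2"]
    by (smt (verit) diff_zero dist_0_norm mem_ball norm_triangle_ineq2 that)
  moreover have "continuous_on disc q"
    using diff by (simp add: continuous_at_imp_continuous_on differentiable_imp_continuous_within del: mem_ball)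
  ultimately have "tame q" by (intro tameI) auto
  then show ?thesis
    unfolding C1_disc_def using diff tame by blast
qed

lemma vanishing_bilinear:
  assumes h: "bounded_bilinear h" and f: "vanishing f" and g: "tame g"
  shows "vanishing (\<lambda>x. h (f x) (g x))"
  unfolding vanishing_def
proof
  fix x :: "real ^ 2" assume "x \<in> sphere 0 1"
  then have lim: "(f \<longlongrightarrow> 0) (at x within disc)" using f by (auto simp: vanishing_def)
  obtain B where B: "B > 0" "\<And>x. x \<in> disc \<Longrightarrow> norm (g x) \<le> B" using g tame_boundE by blast
  have "Bfun g (at x within disc)"
    by (rule BfunI[of _ B]) (use B in \<open>auto simp: eventually_at_filter\<close>)
  then show "((\<lambda>x. h (f x) (g x)) \<longlongrightarrow> 0) (at x within disc)"
    using bounded_bilinear.Zfun_prod_Bfun[OF h] lim by (simp add: tendsto_Zfun_iff)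
qed

lemma disc_integral_partial_C1:
  "C1_disc F \<Longrightarrow> vanishing F \<Longrightarrow> disc_integral (partial i F) = 0"
  by (rule disc_integral_partial_eq_0) (auto simp: C1_disc_def)

definition gradient_sq :: "(real ^ 2 \<Rightarrow> real ^ 2) \<Rightarrow> real ^ 2 \<Rightarrow> real" where
  "gradient_sq w x = (\<Sum>i\<in>UNIV. (norm (partial i w x))\<^sup>2)"

lemma tame_gradient_sq: "C1_disc w \<Longrightarrow> tame (gradient_sq w)"
  unfolding gradient_sq_def[abs_def] by (intro tame_intros C1_discD) auto

lemma tame_laplacian: "C2_disc w \<Longrightarrow> tame (laplacian w)"
  unfolding laplacian_def[abs_def] by (intro tame_intros C1_discD C2_discD) auto

lemma tame_advect: "tame u \<Longrightarrow> C1_disc w \<Longrightarrow> tame (advect u w)"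
  unfolding advect_def[abs_def] by (intro tame_sum tame_scaleR tame_nth C1_discD(3)) auto

lemma tame_vec: "(\<And>i. tame (\<lambda>x. f x i)) \<Longrightarrow> tame (\<lambda>x. (\<chi> i. f x i) :: real ^ 2)"
  by (rule tame_cong[of "\<lambda>x. \<Sum>i\<in>UNIV. f x i *\<^sub>R axis i 1"])
    (intro tame_sum tame_scaleR tame_const, auto simp: vec_eq_iff sum_2 axis_def forall_2)

lemma tame_grad: "C1_disc q \<Longrightarrow> tame (grad q)"
  unfolding grad_def[abs_def] by (intro tame_vec C1_discD)

text \<open>
  Integrate \<open>div (w \<bullet> \<nabla>w)\<close>.
\<close>
lemma disc_integral_laplacian:
  assumes w: "C2_disc w" and van: "vanishing w"
  shows "disc_integral (\<lambda>x. w x \<bullet> laplacian w x) = - disc_integral (gradient_sq w)"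
proof -
  have "disc_integral (partial i (\<lambda>x. w x \<bullet> partial i w x)) = 0" for i
    by (intro disc_integral_partial_C1 C1_disc_bilinear[OF bounded_bilinear_inner]
        vanishing_bilinear[OF bounded_bilinear_inner] van C1_discD C2_discD w)
  then have "(\<Sum>i\<in>UNIV. disc_integral (partial i (\<lambda>x. w x \<bullet> partial i w x))) = 0" by simp
  moreover have "disc_integral (\<lambda>x. w x \<bullet> laplacian w x) + disc_integral (gradient_sq w)
      = disc_integral (\<lambda>x. w x \<bullet> laplacian w x + gradient_sq w x)"
    by (intro disc_integral_add[symmetric] tame_gradient_sq tame_inner tame_laplacian w C2_discD C1_discD)
  moreover have "\<dots> = disc_integral (\<lambda>x. \<Sum>i\<in>UNIV. partial i (\<lambda>x. w x \<bullet> partial i w x) x)"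
    by (rule disc_integral_cong)
      (simp add: partial_bilinear(1)[OF bounded_bilinear_inner] C1_discD(2) C2_discD w laplacian_def
        gradient_sq_def inner_sum_right sum.distrib power2_norm_eq_inner del: mem_ball)
  moreover have "\<dots> = (\<Sum>i\<in>UNIV. disc_integral (partial i (\<lambda>x. w x \<bullet> partial i w x)))"
    by (intro disc_integral_sum finite C1_discD(3) C1_disc_bilinear[OF bounded_bilinear_inner]
        C2_discD(1)[OF w] C2_discD(2)[OF w])
  ultimately show ?thesis by simp
qed

text \<open>
  Integrate \<open>div (|w|\<^sup>2 u) = 2 w \<bullet> (u \<bullet> \<nabla>) w\<close>, which uses \<open>div u = 0\<close>.
\<close>
lemma disc_integral_advect:
  assumes u: "C1_disc u" and div: "\<And>x. x \<in> disc \<Longrightarrow> divergence u x = 0"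
    and w: "C1_disc w" and van: "vanishing w"
  shows "disc_integral (\<lambda>x. w x \<bullet> advect u w x) = 0"
proof -
  note bl = bounded_bilinear_inner bounded_bilinear_mult bounded_linear_vec_nth
  have C: "C1_disc (\<lambda>x. (w x \<bullet> w x) * u x $ i)" for i
    by (intro C1_disc_bilinear[OF bl(1)] C1_disc_bilinear[OF bl(2)] C1_disc_bounded_linear[OF bl(3)] u w)
  have "disc_integral (partial i (\<lambda>x. (w x \<bullet> w x) * u x $ i)) = 0" for i
    by (intro disc_integral_partial_C1 C vanishing_bilinear[OF bl(2)] vanishing_bilinear[OF bl(1)] van
        C1_discD w tame_nth u)
  then have "0 = (\<Sum>i\<in>UNIV. disc_integral (partial i (\<lambda>x. (w x \<bullet> w x) * u x $ i)))" by simp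
  also have "\<dots> = disc_integral (\<lambda>x. \<Sum>i\<in>UNIV. partial i (\<lambda>x. (w x \<bullet> w x) * u x $ i) x)"
    by (intro disc_integral_sum[symmetric] finite C1_discD(3) C)
  also have "\<dots> = disc_integral (\<lambda>x. 2 * (w x \<bullet> advect u w x))"
  proof (rule disc_integral_cong)
    fix x assume x: "x \<in> disc"
    have "partial i (\<lambda>x. (w x \<bullet> w x) * u x $ i) x
        = (w x \<bullet> w x) * partial i u x $ i + 2 * (u x $ i * (w x \<bullet> partial i w x))" for i
      using C1_discD(2)[OF w x] C1_discD(2)[OF u x]
      by (simp add: partial_bilinear[OF bl(1)] partial_bilinear[OF bl(2)] partial_bounded_linear[OF bl(3)]
          inner_commute algebra_simps)
    then show "(\<Sum>i\<in>UNIV. partial i (\<lambda>x. (w x \<bullet> w x) * u x $ i) x) = 2 * (w x \<bullet> advect u w x)"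
      using div[OF x] by (simp add: divergence_def advect_def inner_sum_right sum.distrib
          sum_distrib_left[symmetric] algebra_simps)
  qed
  finally show ?thesis by simp
qed

text \<open>
  Integrate \<open>div (q w) = w \<bullet> \<nabla>q\<close>, which uses \<open>div w = 0\<close>.
\<close>
lemma disc_integral_grad:
  assumes w: "C1_disc w" and div: "\<And>x. x \<in> disc \<Longrightarrow> divergence w x = 0" and van: "vanishing w"
    and q: "C1_disc q"
  shows "disc_integral (\<lambda>x. w x \<bullet> grad q x) = 0"
proof -
  note bl = bounded_bilinear_mult bounded_linear_vec_nth
  have C: "C1_disc (\<lambda>x. w x $ i * q x)" for i
    by (intro C1_disc_bilinear[OF bl(1)] C1_disc_bounded_linear[OF bl(2)] q w)
  have "vanishing (\<lambda>x. w x $ i)" for i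
    unfolding vanishing_def using van by (auto simp: vanishing_def intro: tendsto_eq_intros tendsto_vec_nth[of w 0, simplified])
  then have "disc_integral (partial i (\<lambda>x. w x $ i * q x)) = 0" for i
    by (intro disc_integral_partial_C1 C vanishing_bilinear[OF bl(1)] C1_discD q)
  then have "0 = (\<Sum>i\<in>UNIV. disc_integral (partial i (\<lambda>x. w x $ i * q x)))" by simp
  also have "\<dots> = disc_integral (\<lambda>x. \<Sum>i\<in>UNIV. partial i (\<lambda>x. w x $ i * q x) x)"
    by (intro disc_integral_sum[symmetric] finite C1_discD(3) C)
  also have "\<dots> = disc_integral (\<lambda>x. w x \<bullet> grad q x)"
  proof (rule disc_integral_cong)
    fix x assume x: "x \<in> disc"
    have "partial i (\<lambda>x. w x $ i * q x) x = w x $ i * partial i q x + partial i w x $ i * q x" for i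
      using C1_discD(2)[OF w x] C1_discD(2)[OF q x]
      by (simp add: partial_bilinear[OF bl(1)] partial_bounded_linear[OF bl(2)])
    then show "(\<Sum>i\<in>UNIV. partial i (\<lambda>x. w x $ i * q x) x) = w x \<bullet> grad q x"
      using div[OF x] by (simp add: divergence_def grad_def inner_vec_def sum.distrib
          sum_distrib_right[symmetric])
  qed
  finally show ?thesis by simp
qed

section \<open>Differentiation under the integral sign\<close>
abbreviation "cub \<equiv> continuous_up_to_boundary"

lemma cub_bound:
  fixes f :: "real \<Rightarrow> real ^ 2 \<Rightarrow> 'a::real_normed_vector"
  assumes "cub f" "0 < a"
  obtains B where "B > 0" "\<And>t x. t \<in> {a..b} \<Longrightarrow> x \<in> disc \<Longrightarrow> norm (f t x) \<le> B"
proof -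
  obtain g where g: "continuous_on ({0<..} \<times> closed_disc) g" "\<forall>t>0. \<forall>x\<in>disc. g (t, x) = f t x"
    using assms(1) unfolding continuous_up_to_boundary_def by blast
  have "compact (g ` ({a..b} \<times> closed_disc))"
    using assms(2) by (intro compact_continuous_image compact_Times continuous_on_subset[OF g(1)]) auto
  then have "bounded (g ` ({a..b} \<times> closed_disc))" by (rule compact_imp_bounded)
  then obtain B where B: "B > 0" "\<And>z. z \<in> {a..b} \<times> closed_disc \<Longrightarrow> norm (g z) \<le> B"
    unfolding bounded_pos by blast
  show ?thesis
  proof (rule that[OF B(1)])
    fix t and x :: "real ^ 2" assume "t \<in> {a..b}" "x \<in> disc"
    then show "norm (f t x) \<le> B" using B(2)[of "(t, x)"] g(2) assms(2) by auto
  qed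
qed

lemma cub_tame:
  fixes f :: "real \<Rightarrow> real ^ 2 \<Rightarrow> 'a::real_normed_vector"
  assumes "cub f" "t > 0"
  shows "tame (f t)"
proof -
  obtain g where g: "continuous_on ({0<..} \<times> closed_disc) g" "\<forall>t>0. \<forall>x\<in>disc. g (t, x) = f t x"
    using assms(1) unfolding continuous_up_to_boundary_def by blast
  have "continuous_on closed_disc (\<lambda>x. g (t, x))"
    using assms(2) by (intro continuous_on_compose2[OF g(1)] continuous_intros) auto
  from tame_continuous[OF this] show ?thesis
    by (rule tame_cong) (use g(2) assms(2) in auto)
qed

lemma cub_cong:
  assumes "cub f" "\<And>t x. t > 0 \<Longrightarrow> x \<in> disc \<Longrightarrow> f t x = g t x" shows "cub g"
  using assms unfolding continuous_up_to_boundary_def by (metis (no_types, lifting))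

lemma cub_compose2:
  assumes "cub f" "cub g" and h: "continuous_on UNIV (\<lambda>(a, b). h a b)"
  shows "cub (\<lambda>t x. h (f t x) (g t x))"
proof -
  obtain F G where F: "continuous_on ({0<..} \<times> closed_disc) F" "\<forall>t>0. \<forall>x\<in>disc. F (t, x) = f t x"
    and G: "continuous_on ({0<..} \<times> closed_disc) G" "\<forall>t>0. \<forall>x\<in>disc. G (t, x) = g t x"
    using assms unfolding continuous_up_to_boundary_def by blast
  have "continuous_on ({0<..} \<times> closed_disc) (\<lambda>z. h (F z) (G z))"
    using continuous_on_compose2[OF h continuous_on_Pair[OF F(1) G(1)] subset_UNIV] by simp
  moreover have "\<forall>t>0. \<forall>x\<in>disc. h (F (t, x)) (G (t, x)) = h (f t x) (g t x)"
    using F(2) G(2) by simp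
  ultimately show ?thesis
    unfolding continuous_up_to_boundary_def by (intro exI[of _ "\<lambda>z. h (F z) (G z)"] conjI)
qed

lemma cub_continuous:
  "continuous_on ({0<..} \<times> closed_disc) (\<lambda>(t, x). f t x) \<Longrightarrow> cub f"
  unfolding continuous_up_to_boundary_def by (intro exI[of _ "\<lambda>(t, x). f t x"]) auto

text \<open>
  Dominated convergence for the difference quotients: on \<open>(t/2, 2t)\<close> they are bounded by the
  maximum of the continuous extension of \<open>f'\<close> to the closed disc, by the mean value theorem.
\<close>
lemma Leibniz_disc_integral:
  fixes f f' :: "real \<Rightarrow> real ^ 2 \<Rightarrow> real"
  assumes d: "\<And>t x. t > 0 \<Longrightarrow> x \<in> disc \<Longrightarrow> ((\<lambda>\<tau>. f \<tau> x) has_real_derivative f' t x) (at t)"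
    and tame: "\<And>t. t > 0 \<Longrightarrow> tame (f t)" and cub: "cub f'" and t: "t > 0"
  shows "((\<lambda>t. disc_integral (f t)) has_real_derivative disc_integral (f' t)) (at t)"
proof -
  let ?S = "{t/2<..<2*t}"
  obtain B where B: "B > 0" "\<And>s x. s \<in> {t/2..2*t} \<Longrightarrow> x \<in> disc \<Longrightarrow> norm (f' s x) \<le> B"
    using cub_bound[OF cub, of "t/2" "2*t"] t by auto
  define Q where "Q s x = (f s x - f t x) / (s - t)" for s x
  have bound: "\<bar>Q s x\<bar> \<le> B" if s: "s \<in> ?S - {t}" and x: "x \<in> disc" for s x
  proof -
    have "norm (f s x - f t x) \<le> B * norm (s - t)"
    proof (rule field_differentiable_bound[of ?S])
      show "((\<lambda>\<tau>. f \<tau> x) has_field_derivative f' z x) (at z within ?S)" if "z \<in> ?S" for z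
        using d[of z x] that t x by (intro DERIV_subset[OF d]) auto
      show "norm (f' z x) \<le> B" if "z \<in> ?S" for z using B(2)[of z x] that x by auto
    qed (use s t in auto)
    then show ?thesis using s by (simp add: Q_def field_simps)
  qed
  have tQ: "tame (Q s)" if "s \<in> ?S - {t}" for s
    unfolding Q_def[abs_def] divide_inverse using that t by (intro tame_mult tame_diff tame tame_const) auto
  have "((\<lambda>s. disc_integral (Q s)) \<longlongrightarrow> disc_integral (f' t)) (at t within ?S)"
    unfolding tendsto_at_iff_sequentially comp_def
  proof (intro allI impI)
    fix X assume X: "\<forall>i. X i \<in> ?S - {t}" "X \<longlonglongrightarrow> t"
    show "(\<lambda>i. disc_integral (Q (X i))) \<longlonglongrightarrow> disc_integral (f' t)"
      unfolding set_lebesgue_integral_def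
    proof (rule integral_dominated_convergence[where w="\<lambda>x. indicator disc x *\<^sub>R B"])
      show "(\<lambda>x. indicator disc x *\<^sub>R f' t x) \<in> borel_measurable lborel"
        using tame_set_integrable[OF cub_tame[OF cub t]] by (auto simp: set_integrable_def)
      show "(\<lambda>x. indicator disc x *\<^sub>R Q (X i) x) \<in> borel_measurable lborel" for i
        using tame_set_integrable[OF tQ] X(1) by (auto simp: set_integrable_def)
      show "integrable lborel (\<lambda>x. indicator disc x *\<^sub>R B)"
        using tame_set_integrable[OF tame_const] by (auto simp: set_integrable_def)
      have "(\<lambda>i. Q (X i) x) \<longlonglongrightarrow> f' t x" if "x \<in> disc" for x
      proof -
        have "((\<lambda>s. Q s x) \<longlongrightarrow> f' t x) (at t)"
          using d[OF t that] unfolding has_field_derivative_iff Q_def .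
        then show ?thesis
          unfolding tendsto_at_iff_sequentially comp_def using X by blast
      qed
      then show "AE x in lborel. (\<lambda>i. indicator disc x *\<^sub>R Q (X i) x) \<longlonglongrightarrow> indicator disc x *\<^sub>R f' t x"
        by (intro AE_I2) (simp add: indicator_def del: mem_ball)
      show "AE x in lborel. norm (indicator disc x *\<^sub>R Q (X i) x) \<le> indicator disc x *\<^sub>R B" for i
        using bound X(1) by (intro AE_I2) (simp add: indicator_def del: mem_ball)
    qed
  qed
  then have "((\<lambda>s. disc_integral (Q s)) \<longlongrightarrow> disc_integral (f' t)) (at t)"
    using t by (subst (asm) at_within_open) auto
  moreover have "\<forall>\<^sub>F s in at t. disc_integral (Q s) = (disc_integral (f s) - disc_integral (f t)) / (s - t)"
  proof -
    have "\<forall>\<^sub>F s in at t. s > 0"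
      using t by (intro order_tendstoD tendsto_ident_at) auto
    then show ?thesis
    proof eventually_elim
      case (elim s)
      have "disc_integral (Q s) = disc_integral (\<lambda>x. f s x - f t x) / (s - t)"
        unfolding Q_def[abs_def] set_lebesgue_integral_def by simp
      then show ?case using disc_integral_diff tame elim t by simp
    qed
  qed
  ultimately show ?thesis
    unfolding has_field_derivative_iff by (rule Lim_transform_eventually)
qed

section \<open>Energy estimates and uniqueness\<close>
lemma tame_sqrt:
  assumes "tame f" shows "tame (\<lambda>x. sqrt (f x))"
proof -
  obtain B where B: "B > 0" "\<And>x. x \<in> disc \<Longrightarrow> norm (f x) \<le> B" using assms tame_boundE by blast
  show ?thesis
  proof (rule tameI)
    show "continuous_on disc (\<lambda>x. sqrt (f x))"
      using assms by (auto simp: tame_def intro: continuous_on_real_sqrt)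
    show "norm (sqrt (f x)) \<le> sqrt B" if "x \<in> disc" for x
      using B(2)[OF that] by (simp flip: real_sqrt_abs')
  qed
qed

lemma nonpos_of_decreasing_from_0:
  fixes Z :: "real \<Rightarrow> real"
  assumes deriv: "\<And>t. t > 0 \<Longrightarrow> \<exists>D\<le>0. (Z has_real_derivative D) (at t)"
    and lim: "(Z \<longlongrightarrow> 0) (at_right 0)" and t: "t > 0"
  shows "Z t \<le> 0"
proof (rule tendsto_lowerbound[OF lim])
  have "Z t \<le> Z s" if "s > 0" "s < t" for s
  proof (rule DERIV_nonpos_imp_nonincreasing[of s t Z])
    show "\<exists>y. (Z has_real_derivative y) (at x) \<and> y \<le> 0" if "s \<le> x" "x \<le> t" for x
      using deriv[of x] that \<open>s > 0\<close> by auto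
  qed (use that in simp)
  then show "\<forall>\<^sub>F s in at_right 0. Z t \<le> Z s"
    using eventually_at_right_real[OF t] by (auto elim!: eventually_mono)
qed simp

text \<open>
  The Ladyzhenskaya estimate. The Gagliardo--Nirenberg inequality applied to \<open>h = |w|\<^sup>2\<close>, for which
  \<open>|\<partial>\<^sub>ih| \<le> 2 |w| |\<nabla>w|\<close>, gives \<open>\<parallel>h\<parallel>\<^sup>2 \<le> 4 Y N\<close> with \<open>Y = \<parallel>w\<parallel>\<^sup>2\<close> and \<open>N = \<parallel>\<nabla>w\<parallel>\<^sup>2\<close>. Hence the trilinear
  term is at most \<open>\<integral> h |\<nabla>v| \<le> 2 (Y N E)\<^sup>1\<^sup>/\<^sup>2\<close> with \<open>E = \<parallel>\<nabla>v\<parallel>\<^sup>2\<close>, and Young's inequality splits this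
  so that the part with \<open>N\<close> is absorbed by the viscosity.
\<close>
lemma advect_estimate:
  assumes w: "C1_disc w" and van: "vanishing w" and v: "C1_disc v" and \<nu>: "\<nu> > 0"
  shows "- disc_integral (\<lambda>x. w x \<bullet> advect w v x)
    \<le> \<nu> * disc_integral (gradient_sq w)
      + disc_integral (\<lambda>x. (norm (w x))\<^sup>2) * disc_integral (gradient_sq v) / \<nu>"
proof -
  define h where "h x = w x \<bullet> w x" for x
  define G where "G u x = sqrt (gradient_sq u x)" for u x
  define Y where "Y = disc_integral (\<lambda>x. (norm (w x))\<^sup>2)"
  define N where "N = disc_integral (gradient_sq w)"
  define E where "E = disc_integral (gradient_sq v)"
  have nonneg_sq: "gradient_sq u x \<ge> 0" for u x by (auto simp: gradient_sq_def intro: sum_nonneg)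
  then have G2: "(G u x)\<^sup>2 = gradient_sq u x" and G0: "G u x \<ge> 0" for u x by (auto simp: G_def)
  have nonneg: "Y \<ge> 0" "N \<ge> 0" "E \<ge> 0"
    unfolding Y_def N_def E_def by (auto intro!: disc_integral_nonneg nonneg_sq)
  have tG: "tame (G w)" "tame (G v)" unfolding G_def[abs_def] by (intro tame_sqrt tame_gradient_sq w v)+
  have tw: "tame (\<lambda>x. norm (w x))" by (intro tame_norm C1_discD w)
  have Ch: "C1_disc h" unfolding h_def by (intro C1_disc_bilinear[OF bounded_bilinear_inner] w)
  have vh: "vanishing h" unfolding h_def by (intro vanishing_bilinear[OF bounded_bilinear_inner] van C1_discD w)
  have ph: "\<bar>partial i h x\<bar> \<le> 2 * (norm (w x) * G w x)" if x: "x \<in> disc" for i x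
  proof -
    have "partial i h x = 2 * (w x \<bullet> partial i w x)"
      unfolding h_def using C1_discD(2)[OF w x]
      by (simp add: partial_bilinear[OF bounded_bilinear_inner] inner_commute)
    moreover have "\<bar>w x \<bullet> partial i w x\<bar> \<le> norm (w x) * norm (partial i w x)"
      by (rule Cauchy_Schwarz_ineq2)
    moreover have "norm (partial i w x) \<le> G w x"
      unfolding G_def gradient_sq_def by (intro real_le_rsqrt member_le_sum) auto
    ultimately show ?thesis
      by (smt (verit) mult_left_mono norm_ge_zero)
  qed
  define S where "S = disc_integral (\<lambda>x. norm (w x) * G w x)"
  have "S \<ge> 0" unfolding S_def by (intro disc_integral_nonneg mult_nonneg_nonneg G0) auto
  have S2: "S\<^sup>2 \<le> Y * N"
    using disc_integral_Cauchy_Schwarz[OF tw tG(1)] by (simp add: S_def Y_def N_def G2)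
  have Ih: "disc_integral (\<lambda>x. \<bar>partial i h x\<bar>) \<le> 2 * S" for i
  proof -
    have "disc_integral (\<lambda>x. \<bar>partial i h x\<bar>) \<le> disc_integral (\<lambda>x. 2 * (norm (w x) * G w x))"
      using tame_norm[OF C1_discD(3)[OF Ch, of i]]
      by (intro disc_integral_mono ph tame_mult tame_const tw tG) auto
    then show ?thesis by (simp add: S_def)
  qed
  have "disc_integral (\<lambda>x. (h x)\<^sup>2)
      \<le> disc_integral (\<lambda>x. \<bar>partial 1 h x\<bar>) * disc_integral (\<lambda>x. \<bar>partial 2 h x\<bar>)"
    by (intro Gagliardo_Nirenberg_disc vh C1_discD[OF Ch])
  also have "\<dots> \<le> (2 * S) * (2 * S)"
    using \<open>S \<ge> 0\<close> by (intro mult_mono Ih disc_integral_nonneg) auto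
  also have "\<dots> \<le> 4 * (Y * N)" using S2 by (simp add: power2_eq_square)
  finally have h2: "disc_integral (\<lambda>x. (h x)\<^sup>2) \<le> 4 * (Y * N)" .
  have pt: "- (w x \<bullet> advect w v x) \<le> h x * G v x" for x
  proof -
    have "norm (advect w v x) \<le> (\<Sum>i\<in>UNIV. \<bar>w x $ i\<bar> * \<bar>norm (partial i v x)\<bar>)"
      unfolding advect_def by (rule order_trans[OF norm_sum]) simp
    also have "\<dots> \<le> L2_set (\<lambda>i. w x $ i) UNIV * L2_set (\<lambda>i. norm (partial i v x)) UNIV"
      by (rule L2_set_mult_ineq)
    also have "\<dots> = norm (w x) * G v x"
      by (simp add: norm_vec_def G_def gradient_sq_def L2_set_def)
    finally have "norm (w x) * norm (advect w v x) \<le> norm (w x) * (norm (w x) * G v x)"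
      by (intro mult_left_mono) auto
    moreover have "- (w x \<bullet> advect w v x) \<le> norm (w x) * norm (advect w v x)"
      using Cauchy_Schwarz_ineq2[of "w x" "advect w v x"] by linarith
    ultimately show ?thesis by (simp add: h_def dot_square_norm power2_eq_square)
  qed
  have "- disc_integral (\<lambda>x. w x \<bullet> advect w v x) = disc_integral (\<lambda>x. - (w x \<bullet> advect w v x))"
    by (simp add: set_lebesgue_integral_def)
  also have "\<dots> \<le> disc_integral (\<lambda>x. h x * G v x)"
  proof (rule disc_integral_mono[OF _ _ pt])
    show "tame (\<lambda>x. - (w x \<bullet> advect w v x))"
      using tame_diff[OF tame_const[of 0] tame_inner[OF C1_discD(1)[OF w] tame_advect[OF C1_discD(1)[OF w] v]]]
      by simp
  qed (intro tame_mult C1_discD(1)[OF Ch] tG)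
  also have "\<dots> \<le> \<nu> * N + Y * E / \<nu>"
  proof (rule power2_le_imp_le)
    have "(disc_integral (\<lambda>x. h x * G v x))\<^sup>2 \<le> disc_integral (\<lambda>x. (h x)\<^sup>2) * E"
      using disc_integral_Cauchy_Schwarz[OF C1_discD(1)[OF Ch] tG(2)] by (simp add: E_def G2)
    also have "\<dots> \<le> 4 * (Y * N) * E" using h2 nonneg by (intro mult_right_mono) auto
    also have "\<dots> = 4 * (\<nu> * N) * (Y * E / \<nu>)" using \<nu> by simp
    also have "\<dots> \<le> (\<nu> * N + Y * E / \<nu>)\<^sup>2"
    proof -
      have "4 * a * b \<le> (a + b)\<^sup>2" for a b :: real
        using sum_squares_bound[of a b] by (simp add: power2_sum)
      then show ?thesis .
    qed
    finally show "(disc_integral (\<lambda>x. h x * G v x))\<^sup>2 \<le> (\<nu> * N + Y * E / \<nu>)\<^sup>2" .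
    show "0 \<le> \<nu> * N + Y * E / \<nu>" using nonneg \<nu> by simp
  qed
  finally show ?thesis unfolding Y_def N_def E_def .
qed

lemma energy_derivative:
  fixes w w' :: "real \<Rightarrow> real ^ 2 \<Rightarrow> real ^ 2"
  assumes w: "cub w" and w': "cub w'"
    and d: "\<And>t x. t > 0 \<Longrightarrow> x \<in> disc \<Longrightarrow> ((\<lambda>\<tau>. w \<tau> x) has_vector_derivative w' t x) (at t)"
    and t: "t > 0"
  shows "((\<lambda>t. disc_integral (\<lambda>x. (norm (w t x))\<^sup>2)) has_real_derivative
    2 * disc_integral (\<lambda>x. w t x \<bullet> w' t x)) (at t)"
proof -
  have "((\<lambda>t. disc_integral (\<lambda>x. (norm (w t x))\<^sup>2)) has_real_derivative
    disc_integral (\<lambda>x. 2 * (w t x \<bullet> w' t x))) (at t)"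
  proof (rule Leibniz_disc_integral[OF _ _ _ t])
    show "((\<lambda>\<tau>. (norm (w \<tau> x))\<^sup>2) has_real_derivative 2 * (w t x \<bullet> w' t x)) (at t)"
      if "t > 0" "x \<in> disc" for t x
      unfolding power2_norm_eq_inner has_field_derivative_def
      using has_derivative_inner[OF d[OF that, unfolded has_vector_derivative_def] d[OF that, unfolded has_vector_derivative_def]]
      by (rule has_derivative_eq_rhs) (auto simp: inner_commute algebra_simps)
    show "tame (\<lambda>x. (norm (w t x))\<^sup>2)" if "t > 0" for t
      by (intro tame_power tame_norm cub_tame[OF w that])
    show "cub (\<lambda>t x. 2 * (w t x \<bullet> w' t x))"
      by (rule cub_compose2[OF w w']) (simp add: case_prod_beta, intro continuous_intros)
  qed
  then show ?thesis by simp
qed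

context
  fixes \<nu> u0 u p
  assumes sol: "navier_stokes_solution \<nu> u0 u p"
begin

lemma ns_cub: "cub u" "cub (time_deriv u)"
  using sol cub_continuous unfolding navier_stokes_solution_def regular_velocity_def by auto

lemma ns_time_deriv:
  assumes "t > 0" "x \<in> disc"
  shows "((\<lambda>\<tau>. u \<tau> x) has_vector_derivative time_deriv u t x) (at t)"
  using sol assms unfolding navier_stokes_solution_def regular_velocity_def time_deriv_def
  by (simp add: vector_derivative_works)

lemma ns_C2:
  assumes t: "t > 0" shows "C2_disc (u t)"
proof -
  have "\<forall>x\<in>disc. u t differentiable (at x) \<and> (\<forall>i. partial i (u t) differentiable (at x))"
    and "cub (\<lambda>t. partial i (u t))" and "cub (\<lambda>t. partial j (partial i (u t)))" for i j
    using sol t unfolding navier_stokes_solution_def regular_velocity_def by auto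
  then show ?thesis
    unfolding C2_disc_def C1_disc_def
    using cub_tame[OF ns_cub(1) t] cub_tame[OF _ t] by (metis (no_types, lifting))
qed

lemma ns_pressure_C1:
  assumes t: "t > 0" shows "C1_disc (p t)"
proof (rule C1_disc_of_bounded_gradient)
  show "p t differentiable (at x)" if "x \<in> disc" for x
    using sol t that unfolding navier_stokes_solution_def regular_pressure_def by auto
  have "cub (\<lambda>t. partial i (p t))" for i
    using sol unfolding navier_stokes_solution_def regular_pressure_def by auto
  then show "tame (partial i (p t))" for i using cub_tame[OF _ t] by (metis (no_types, lifting))
qed

lemma ns_vanishing:
  assumes t: "t > 0" shows "vanishing (u t)"
  unfolding vanishing_def
proof
  fix x :: "real ^ 2" assume x: "x \<in> sphere 0 1"
  have cont: "continuous_on ({0<..} \<times> closed_disc) (\<lambda>(t, x). u t x)" and 0: "u t x = 0"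
    using sol x t unfolding navier_stokes_solution_def regular_velocity_def by auto
  have "continuous_on closed_disc (\<lambda>x. (\<lambda>(t, x). u t x) (t, x))"
    by (rule continuous_on_compose2[OF cont]) (use t in \<open>auto intro!: continuous_intros\<close>)
  then have "(u t \<longlongrightarrow> u t x) (at x within closed_disc)"
    using x by (simp add: continuous_on_def)
  then show "(u t \<longlongrightarrow> 0) (at x within disc)"
    unfolding 0 by (rule tendsto_within_subset) (rule ball_subset_cball)
qed

lemma ns_divergence: "t > 0 \<Longrightarrow> x \<in> disc \<Longrightarrow> divergence (u t) x = 0"
  using sol unfolding navier_stokes_solution_def by auto

lemma ns_momentum:
  assumes "t > 0" "x \<in> disc"
  shows "time_deriv u t x = \<nu> *\<^sub>R laplacian (u t) x - advect (u t) (u t) x - grad (p t) x"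
proof -
  have "time_deriv u t x + advect (u t) (u t) x + grad (p t) x = \<nu> *\<^sub>R laplacian (u t) x"
    using sol assms unfolding navier_stokes_solution_def by auto
  then show ?thesis by (simp add: algebra_simps)
qed

lemma ns_initial:
  assumes u0: "continuous_on closed_disc u0"
  shows "((\<lambda>t. disc_integral (\<lambda>x. (norm (u t x - u0 x))\<^sup>2)) \<longlongrightarrow> 0) (at_right 0)"
proof -
  have "((\<lambda>t. integral\<^sup>L (lebesgue_on disc) (\<lambda>x. (norm (u t x - u0 x))\<^sup>2)) \<longlongrightarrow> 0) (at_right 0)"
    using sol unfolding navier_stokes_solution_def by auto
  moreover have "\<forall>\<^sub>F t in at_right 0. integral\<^sup>L (lebesgue_on disc) (\<lambda>x. (norm (u t x - u0 x))\<^sup>2)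
      = disc_integral (\<lambda>x. (norm (u t x - u0 x))\<^sup>2)"
    using eventually_at_right_less[of 0]
  proof eventually_elim
    case (elim t)
    show ?case
      by (intro disc_integral_eq_lebesgue tame_power tame_norm tame_diff tame_continuous[OF u0]
          C1_discD(1) C2_discD(1) ns_C2 elim)
  qed
  ultimately show ?thesis by (rule Lim_transform_eventually)
qed

text \<open>
  The transport term and the pressure do no work.
\<close>
lemma ns_energy:
  assumes t: "t > 0"
  shows "((\<lambda>t. disc_integral (\<lambda>x. (norm (u t x))\<^sup>2)) has_real_derivative
    - 2 * \<nu> * disc_integral (gradient_sq (u t))) (at t)"
proof -
  note C2 = ns_C2[OF t] note C1 = C2_discD(1)[OF C2]
  have tm: "tame (\<lambda>x. \<nu> * (u t x \<bullet> laplacian (u t) x))" "tame (\<lambda>x. u t x \<bullet> advect (u t) (u t) x)"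
    "tame (\<lambda>x. u t x \<bullet> grad (p t) x)"
    by (intro tame_mult tame_const tame_inner tame_laplacian tame_advect tame_grad C1 C2
        ns_pressure_C1 t C1_discD(1))+
  have "disc_integral (\<lambda>x. u t x \<bullet> time_deriv u t x) = disc_integral (\<lambda>x. \<nu> * (u t x \<bullet> laplacian (u t) x)
      - u t x \<bullet> advect (u t) (u t) x - u t x \<bullet> grad (p t) x)"
    by (rule disc_integral_cong) (simp add: ns_momentum t inner_diff_right del: mem_ball)
  also have "\<dots> = \<nu> * disc_integral (\<lambda>x. u t x \<bullet> laplacian (u t) x)
      - disc_integral (\<lambda>x. u t x \<bullet> advect (u t) (u t) x) - disc_integral (\<lambda>x. u t x \<bullet> grad (p t) x)"
    using tm by (simp add: disc_integral_diff tame_diff)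
  also have "\<dots> = - \<nu> * disc_integral (gradient_sq (u t))"
    using disc_integral_laplacian[OF C2 ns_vanishing[OF t]]
      disc_integral_advect[OF C1 ns_divergence[OF t] C1 ns_vanishing[OF t]]
      disc_integral_grad[OF C1 ns_divergence[OF t] ns_vanishing[OF t] ns_pressure_C1[OF t]]
    by simp
  finally have eq: "disc_integral (\<lambda>x. u t x \<bullet> time_deriv u t x) = - \<nu> * disc_integral (gradient_sq (u t))" .
  show ?thesis
    using energy_derivative[OF ns_cub ns_time_deriv t] unfolding eq by (simp add: mult.assoc)
qed

end

lemma cub_diff:
  fixes f g :: "real \<Rightarrow> real ^ 2 \<Rightarrow> 'a::real_normed_vector"
  assumes "cub f" "cub g" shows "cub (\<lambda>t x. f t x - g t x)"
  by (rule cub_compose2[OF assms]) (simp add: case_prod_beta, intro continuous_intros)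

text \<open>
  From \<open>(u \<bullet> \<nabla>) u - (v \<bullet> \<nabla>) v = (u \<bullet> \<nabla>) w + (w \<bullet> \<nabla>) v\<close>, where the first term on the right does no
  work on \<open>w\<close>.
\<close>
lemma ns_difference:
  assumes u: "navier_stokes_solution \<nu> u0 u p" and v: "navier_stokes_solution \<nu> u0 v q"
    and \<nu>: "\<nu> > 0" and t: "t > 0"
  defines "w \<equiv> \<lambda>t x. u t x - v t x"
  shows "\<exists>D. ((\<lambda>t. disc_integral (\<lambda>x. (norm (w t x))\<^sup>2)) has_real_derivative D) (at t) \<and>
    D \<le> 2 / \<nu> * disc_integral (\<lambda>x. (norm (w t x))\<^sup>2) * disc_integral (gradient_sq (v t))"
proof -
  let ?w' = "\<lambda>t x. time_deriv u t x - time_deriv v t x"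
  let ?\<pi> = "\<lambda>x. p t x - q t x"
  have D: "((\<lambda>t. disc_integral (\<lambda>x. (norm (w t x))\<^sup>2)) has_real_derivative
      2 * disc_integral (\<lambda>x. w t x \<bullet> ?w' t x)) (at t)"
    unfolding w_def
    by (rule energy_derivative[OF _ _ _ t])
      (intro cub_diff ns_cub[OF u] ns_cub[OF v] has_vector_derivative_diff ns_time_deriv[OF u] ns_time_deriv[OF v]; assumption)+
  have U2: "C2_disc (u t)" and V2: "C2_disc (v t)" by (intro ns_C2[OF u t] ns_C2[OF v t])+
  note U1 = C2_discD(1)[OF U2] and V1 = C2_discD(1)[OF V2]
  have W2: "C2_disc (w t)" unfolding w_def by (intro C2_disc_diff U2 V2)
  note W1 = C2_discD(1)[OF W2]
  have P1: "C1_disc ?\<pi>" by (intro C1_disc_diff ns_pressure_C1[OF u t] ns_pressure_C1[OF v t])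
  have van: "vanishing (w t)"
    using ns_vanishing[OF u t] ns_vanishing[OF v t] unfolding vanishing_def w_def
    by (auto intro: tendsto_eq_intros)
  have pd: "partial i (w t) x = partial i (u t) x - partial i (v t) x" if "x \<in> disc" for i x
    unfolding w_def using C1_discD(2)[OF U1 that] C1_discD(2)[OF V1 that] by (rule partial_add_diff(2))
  have divw: "divergence (w t) x = 0" if x: "x \<in> disc" for x
    using ns_divergence[OF u t x] ns_divergence[OF v t x]
    by (simp add: divergence_def pd[OF x] sum_subtractf)
  have gradd: "grad ?\<pi> x = grad (p t) x - grad (q t) x" if x: "x \<in> disc" for x
    using C1_discD(2)[OF ns_pressure_C1[OF u t] x] C1_discD(2)[OF ns_pressure_C1[OF v t] x]
    by (simp add: grad_def vec_eq_iff partial_add_diff)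
  have adv: "advect (u t) (u t) x - advect (v t) (v t) x = advect (u t) (w t) x + advect (w t) (v t) x"
    if x: "x \<in> disc" for x
    unfolding advect_def sum.distrib[symmetric] sum_subtractf[symmetric] pd[OF x]
    by (rule sum.cong[OF refl]) (simp add: w_def algebra_simps)
  have eq: "?w' t x = \<nu> *\<^sub>R laplacian (w t) x - advect (u t) (w t) x - advect (w t) (v t) x - grad ?\<pi> x"
    if x: "x \<in> disc" for x
  proof -
    have "?w' t x = \<nu> *\<^sub>R (laplacian (u t) x - laplacian (v t) x)
        - (advect (u t) (u t) x - advect (v t) (v t) x) - (grad (p t) x - grad (q t) x)"
      unfolding ns_momentum[OF u t x] ns_momentum[OF v t x] by (simp add: algebra_simps)
    also have "laplacian (u t) x - laplacian (v t) x = laplacian (w t) x"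
      unfolding w_def by (rule laplacian_diff[OF U2 V2 x, symmetric])
    finally show ?thesis unfolding adv[OF x] gradd[OF x] by (simp add: algebra_simps)
  qed
  have tm: "tame (\<lambda>x. \<nu> * (w t x \<bullet> laplacian (w t) x))" "tame (\<lambda>x. w t x \<bullet> advect (u t) (w t) x)"
    "tame (\<lambda>x. w t x \<bullet> advect (w t) (v t) x)" "tame (\<lambda>x. w t x \<bullet> grad ?\<pi> x)"
    by (intro tame_mult tame_const tame_inner tame_laplacian tame_advect tame_grad U1 V1 W1 W2 P1 C1_discD(1))+
  have "disc_integral (\<lambda>x. w t x \<bullet> ?w' t x) = disc_integral (\<lambda>x. \<nu> * (w t x \<bullet> laplacian (w t) x)
      - w t x \<bullet> advect (u t) (w t) x - w t x \<bullet> advect (w t) (v t) x - w t x \<bullet> grad ?\<pi> x)"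
    by (rule disc_integral_cong) (simp add: eq inner_diff_right del: mem_ball)
  also have "\<dots> = \<nu> * disc_integral (\<lambda>x. w t x \<bullet> laplacian (w t) x) - disc_integral (\<lambda>x. w t x \<bullet> advect (u t) (w t) x)
      - disc_integral (\<lambda>x. w t x \<bullet> advect (w t) (v t) x) - disc_integral (\<lambda>x. w t x \<bullet> grad ?\<pi> x)"
    using tm by (simp add: disc_integral_diff tame_diff)
  also have "\<dots> = - \<nu> * disc_integral (gradient_sq (w t)) - disc_integral (\<lambda>x. w t x \<bullet> advect (w t) (v t) x)"
    using disc_integral_laplacian[OF W2 van] disc_integral_advect[OF U1 ns_divergence[OF u t] W1 van]
      disc_integral_grad[OF W1 divw van P1] by simp
  also have "\<dots> \<le> disc_integral (\<lambda>x. (norm (w t x))\<^sup>2) * disc_integral (gradient_sq (v t)) / \<nu>"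
    using advect_estimate[OF W1 van V1 \<nu>] by linarith
  finally have "2 * disc_integral (\<lambda>x. w t x \<bullet> ?w' t x)
      \<le> 2 / \<nu> * disc_integral (\<lambda>x. (norm (w t x))\<^sup>2) * disc_integral (gradient_sq (v t))"
    by simp
  with D show ?thesis by blast
qed

text \<open>
  Instead of integrating \<open>E = \<parallel>\<nabla>v\<parallel>\<^sup>2\<close> in time, the Gronwall factor is expressed through the energy
  \<open>e\<close> of \<open>v\<close>, whose derivative is \<open>-2 \<nu> E\<close>. It stays bounded as \<open>t \<rightarrow> 0\<close> because \<open>v(t) \<rightarrow> u\<^sub>0\<close> in \<open>L\<^sup>2\<close>.
\<close>
theorem ns_unique:
  assumes u: "navier_stokes_solution \<nu> u0 u p" and v: "navier_stokes_solution \<nu> u0 v q"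
    and \<nu>: "\<nu> > 0" and u0: "continuous_on closed_disc u0" and t: "t > 0" and x: "x \<in> disc"
  shows "u t x = v t x"
proof -
  define Y where "Y t = disc_integral (\<lambda>x. (norm (u t x - v t x))\<^sup>2)" for t
  define e where "e t = disc_integral (\<lambda>x. (norm (v t x))\<^sup>2)" for t
  define E where "E t = disc_integral (gradient_sq (v t))" for t
  define du where "du t = disc_integral (\<lambda>x. (norm (u t x - u0 x))\<^sup>2)" for t
  define dv where "dv t = disc_integral (\<lambda>x. (norm (v t x - u0 x))\<^sup>2)" for t
  define e0 where "e0 = disc_integral (\<lambda>x. (norm (u0 x))\<^sup>2)"
  have Y0: "Y t \<ge> 0" for t unfolding Y_def by (rule disc_integral_nonneg) simp
  have parallelogram: "(norm (a - b))\<^sup>2 \<le> 2 * (norm a)\<^sup>2 + 2 * (norm b)\<^sup>2" for a b :: "real ^ 2"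
  proof -
    have "(norm (a - b))\<^sup>2 + (norm (a + b))\<^sup>2 = 2 * (norm a)\<^sup>2 + 2 * (norm b)\<^sup>2"
      unfolding power2_norm_eq_inner by (simp add: inner_simps inner_commute)
    then show ?thesis by (smt (verit) zero_le_power2)
  qed
  have tu: "tame (u t)" and tv: "tame (v t)" if "t > 0" for t
    using ns_C2[OF u that] ns_C2[OF v that] C1_discD(1) C2_discD(1) by blast+
  have tu0: "tame u0" by (rule tame_continuous[OF u0])
  have Y_le: "Y t \<le> 2 * du t + 2 * dv t" if "t > 0" for t
  proof -
    have "Y t \<le> disc_integral (\<lambda>x. 2 * (norm (u t x - u0 x))\<^sup>2 + 2 * (norm (v t x - u0 x))\<^sup>2)"
      unfolding Y_def using parallelogram[of "u t x - u0 x" "v t x - u0 x" for x]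
      by (intro disc_integral_mono tame_intros tu tv tu0 that) (auto simp: algebra_simps)
    also have "\<dots> = 2 * du t + 2 * dv t"
      using tu[OF that] tv[OF that] tu0 by (simp add: du_def dv_def disc_integral_add tame_intros)
    finally show ?thesis .
  qed
  have e_le: "e t \<le> 2 * dv t + 2 * e0" if "t > 0" for t
  proof -
    have "e t \<le> disc_integral (\<lambda>x. 2 * (norm (v t x - u0 x))\<^sup>2 + 2 * (norm (u0 x))\<^sup>2)"
      unfolding e_def using parallelogram[of "v t x - u0 x" "- u0 x" for x]
      by (intro disc_integral_mono tame_intros tu tv tu0 that) (auto simp: algebra_simps)
    also have "\<dots> = 2 * dv t + 2 * e0"
      using tv[OF that] tu0 by (simp add: e0_def dv_def disc_integral_add tame_intros)
    finally show ?thesis .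
  qed
  define Z where "Z t = Y t * exp (e t / \<nu>\<^sup>2)" for t
  have lims: "(du \<longlongrightarrow> 0) (at_right 0)" "(dv \<longlongrightarrow> 0) (at_right 0)"
    unfolding du_def dv_def using ns_initial[OF u u0] ns_initial[OF v u0] .
  have "(Z \<longlongrightarrow> 0) (at_right 0)"
  proof (rule tendsto_sandwich[OF _ _ tendsto_const])
    show "\<forall>\<^sub>F t in at_right 0. 0 \<le> Z t" using Y0 by (simp add: Z_def)
    have "\<forall>\<^sub>F t in at_right 0. dv t < 1" using lims(2) by (rule order_tendstoD) simp
    then show "\<forall>\<^sub>F t in at_right 0. Z t \<le> (2 * du t + 2 * dv t) * exp ((2 + 2 * e0) / \<nu>\<^sup>2)"
      using eventually_at_right_less[of 0]
    proof eventually_elim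
      case (elim t)
      have "exp (e t / \<nu>\<^sup>2) \<le> exp ((2 + 2 * e0) / \<nu>\<^sup>2)"
        using e_le[OF elim(2)] elim(1) by (simp add: divide_right_mono)
      then show ?case
        unfolding Z_def using Y_le[OF elim(2)] Y0[of t] by (intro mult_mono) auto
    qed
    show "((\<lambda>t. (2 * du t + 2 * dv t) * exp ((2 + 2 * e0) / \<nu>\<^sup>2)) \<longlongrightarrow> 0) (at_right 0)"
      using lims by (auto intro!: tendsto_eq_intros)
  qed
  moreover have "\<exists>D\<le>0. (Z has_real_derivative D) (at t)" if t: "t > 0" for t
  proof -
    obtain D where D: "(Y has_real_derivative D) (at t)" "D \<le> 2 / \<nu> * Y t * E t"
      using ns_difference[OF u v \<nu> t] unfolding Y_def E_def by blast
    have e: "(e has_real_derivative - 2 * \<nu> * E t) (at t)"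
      unfolding e_def E_def by (rule ns_energy[OF v t])
    have "(Z has_real_derivative
        (D * exp (e t / \<nu>\<^sup>2) + exp (e t / \<nu>\<^sup>2) * (- 2 * \<nu> * E t / \<nu>\<^sup>2) * Y t)) (at t)"
      unfolding Z_def by (rule DERIV_mult[OF D(1) DERIV_chain2[OF DERIV_exp DERIV_cdivide[OF e]]])
    moreover have "D * exp (e t / \<nu>\<^sup>2) + exp (e t / \<nu>\<^sup>2) * (- 2 * \<nu> * E t / \<nu>\<^sup>2) * Y t
        = (D - 2 / \<nu> * Y t * E t) * exp (e t / \<nu>\<^sup>2)"
      using \<nu> by (simp add: field_simps power2_eq_square)
    ultimately have "(Z has_real_derivative ((D - 2 / \<nu> * Y t * E t) * exp (e t / \<nu>\<^sup>2))) (at t)"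
      by simp
    moreover have "(D - 2 / \<nu> * Y t * E t) * exp (e t / \<nu>\<^sup>2) \<le> 0"
      using D(2) by (intro mult_nonpos_nonneg) auto
    ultimately show ?thesis by blast
  qed
  ultimately have "Z t \<le> 0" using t by (intro nonpos_of_decreasing_from_0[of Z]) auto
  then have "Y t \<le> 0" by (simp add: Z_def mult_le_0_iff)
  moreover have "tame (\<lambda>x. (norm (u t x - v t x))\<^sup>2)" by (intro tame_intros tu tv t)
  ultimately have "(norm (u t x - v t x))\<^sup>2 = 0"
    unfolding Y_def by (intro disc_integral_eq_0D[OF _ _ _ x]) auto
  then show ?thesis by simp
qed

section \<open>Rotations\<close>
definition rot :: "real \<Rightarrow> real ^ 2 \<Rightarrow> real ^ 2" where
  "rot \<theta> x = cos \<theta> *\<^sub>R x + sin \<theta> *\<^sub>R perp x"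

lemma perp_nth: "perp x $ 1 = - (x $ 2)" "perp x $ 2 = x $ 1"
  by (auto simp: perp_def)

lemma inner_2: "x \<bullet> y = x $ 1 * y $ 1 + x $ 2 * y $ 2" for x y :: "real ^ 2"
  by (simp add: inner_vec_def sum_2)

lemma vec_eq_2: "x = y \<longleftrightarrow> x $ 1 = y $ 1 \<and> x $ 2 = y $ 2" for x y :: "'a ^ 2"
  by (simp add: vec_eq_iff forall_2)

lemma rot_nth:
  "rot \<theta> x $ 1 = cos \<theta> * x $ 1 - sin \<theta> * x $ 2" "rot \<theta> x $ 2 = cos \<theta> * x $ 2 + sin \<theta> * x $ 1"
  by (auto simp: rot_def perp_nth)

lemma linear_perp: "linear perp"
  by (rule linearI) (auto simp: vec_eq_2 perp_nth)

lemma linear_rot: "linear (rot \<theta>)"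
  by (rule linearI) (auto simp: vec_eq_2 rot_nth algebra_simps)

lemma bounded_linear_rot: "bounded_linear (rot \<theta>)"
  using linear_rot by (rule linear_conv_bounded_linear[THEN iffD1])

lemma rot_add: "rot \<alpha> (rot \<beta> x) = rot (\<alpha> + \<beta>) x"
  by (auto simp: vec_eq_2 rot_nth cos_add sin_add algebra_simps)

lemma rot_0 [simp]: "rot 0 x = x"
  by (simp add: rot_def)

lemma rot_cancel [simp]: "rot (- \<theta>) (rot \<theta> x) = x" "rot \<theta> (rot (- \<theta>) x) = x"
  by (simp_all add: rot_add)

lemma perp_rot: "perp (rot \<theta> x) = rot \<theta> (perp x)"
  by (auto simp: vec_eq_2 rot_nth perp_nth)

lemma rot_inner [simp]: "rot \<theta> x \<bullet> rot \<theta> y = x \<bullet> y"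
proof -
  have "rot \<theta> x \<bullet> rot \<theta> y = ((sin \<theta>)\<^sup>2 + (cos \<theta>)\<^sup>2) * (x \<bullet> y)"
    unfolding inner_2 rot_nth by algebra
  then show ?thesis by simp
qed

lemma norm_rot [simp]: "norm (rot \<theta> x) = norm x"
  by (simp add: norm_eq_sqrt_inner)

lemma orthogonal_rot: "orthogonal_transformation (rot \<theta>)"
  by (simp add: orthogonal_transformation_def linear_rot)

lemma distr_rot: "distr lborel borel (rot \<theta>) = lborel"
proof (rule lborel_eqI[symmetric])
  have m: "rot \<theta> \<in> borel \<rightarrow>\<^sub>M borel"
    by (intro borel_measurable_continuous_onI linear_continuous_on bounded_linear_rot)
  fix l u :: "real ^ 2" assume le: "\<And>b. b \<in> Basis \<Longrightarrow> l \<bullet> b \<le> u \<bullet> b"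
  have vim: "rot \<theta> -` box l u = rot (- \<theta>) ` box l u"
    by (auto simp: image_iff) (metis rot_cancel(1))
  have op: "open (rot \<theta> -` box l u)"
    by (intro open_vimage open_box linear_continuous_on bounded_linear_rot)
  have lm: "rot (-\<theta>) ` box l u \<in> lmeasurable"
    by (intro measurable_orthogonal_image orthogonal_rot lmeasurable_box)
  have "emeasure (distr lborel borel (rot \<theta>)) (box l u) = emeasure lborel (rot \<theta> -` box l u)"
    using m by (subst emeasure_distr) auto
  also have "\<dots> = emeasure lebesgue (rot \<theta> -` box l u)"
    using op by (simp add: emeasure_completion borel_open)
  also have "\<dots> = emeasure lebesgue (box l u)"
    unfolding vim emeasure_eq_measure2[OF lm] emeasure_eq_measure2[OF lmeasurable_box]
      measure_orthogonal_image[OF orthogonal_rot lmeasurable_box] ..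
  also have "\<dots> = emeasure lborel (box l u)" by (simp add: emeasure_completion)
  also have "\<dots> = (\<Prod>b\<in>Basis. (u - l) \<bullet> b)" using le by simp
  finally show "emeasure (distr lborel borel (rot \<theta>)) (box l u) = (\<Prod>b\<in>Basis. (u - l) \<bullet> b)" .
qed simp

lemma disc_integral_rot:
  assumes "tame f" shows "disc_integral (\<lambda>x. f (rot \<theta> x)) = disc_integral f"
proof -
  have m: "rot \<theta> \<in> borel \<rightarrow>\<^sub>M borel"
    by (intro borel_measurable_continuous_onI linear_continuous_on bounded_linear_rot)
  have "disc_integral f = (\<integral>x. indicator disc x * f x \<partial>distr lborel borel (rot \<theta>))"
    by (simp add: distr_rot set_lebesgue_integral_def)
  also have "\<dots> = (\<integral>x. indicator disc (rot \<theta> x) * f (rot \<theta> x) \<partial>lborel)"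
    using m measurable_disc_indicator[of f] assms by (subst integral_distr) (auto simp: tame_def)
  also have "\<dots> = disc_integral (\<lambda>x. f (rot \<theta> x))"
    unfolding set_lebesgue_integral_def by (rule Bochner_Integration.integral_cong) (auto simp: indicator_def)
  finally show ?thesis by simp
qed

lemma partial_rot:
  assumes "f differentiable (at (rot \<theta> x))"
  shows "partial i (\<lambda>x. f (rot \<theta> x)) x = (\<Sum>j\<in>UNIV. rot \<theta> (axis i 1) $ j *\<^sub>R partial j f (rot \<theta> x))"
    and "(\<lambda>x. f (rot \<theta> x)) differentiable (at x)"
proof -
  have D: "((\<lambda>x. f (rot \<theta> x)) has_derivative (\<lambda>h. \<Sum>j\<in>UNIV. rot \<theta> h $ j *\<^sub>R partial j f (rot \<theta> x))) (at x)"
    using has_derivative_compose[OF bounded_linear_imp_has_derivative[OF bounded_linear_rot]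
        has_derivative_sum_partial[OF assms]] .
  show "partial i (\<lambda>x. f (rot \<theta> x)) x = (\<Sum>j\<in>UNIV. rot \<theta> (axis i 1) $ j *\<^sub>R partial j f (rot \<theta> x))"
    by (rule has_derivative_partial[OF D])
  show "(\<lambda>x. f (rot \<theta> x)) differentiable (at x)"
    using D unfolding differentiable_def by blast
qed

text \<open>
  Conjugation by a rotation, the action on vector fields under which the equations are
  invariant.
\<close>
definition conj_rot :: "real \<Rightarrow> (real ^ 2 \<Rightarrow> real ^ 2) \<Rightarrow> real ^ 2 \<Rightarrow> real ^ 2" where
  "conj_rot \<theta> v x = rot (- \<theta>) (v (rot \<theta> x))"

lemma rot_disc: "rot \<theta> x \<in> disc \<longleftrightarrow> x \<in> disc"
  by simp

lemma partial_conj_rot: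
  assumes "v differentiable (at (rot \<theta> x))"
  shows "partial i (conj_rot \<theta> v) x = rot (- \<theta>) (\<Sum>j\<in>UNIV. rot \<theta> (axis i 1) $ j *\<^sub>R partial j v (rot \<theta> x))"
    and "conj_rot \<theta> v differentiable (at x)"
  unfolding conj_rot_def[abs_def]
  using partial_bounded_linear[OF bounded_linear_rot partial_rot(2)[OF assms]] by (simp_all add: partial_rot(1)[OF assms])

lemma differentiable_lincomb_partial:
  assumes "\<And>j. partial j v differentiable (at y)"
  shows "(\<lambda>z. \<Sum>j\<in>UNIV. c j *\<^sub>R partial j v z) differentiable (at y)"
  using partial_bounded_linear(2)[OF bounded_linear_scaleR_right assms] by (intro differentiable_sum) auto

lemma partial_lincomb:
  assumes "\<And>j. f j differentiable (at y)"
  shows "partial k (\<lambda>z. \<Sum>j\<in>(UNIV :: 2 set). c j *\<^sub>R f j z) y = (\<Sum>j\<in>UNIV. c j *\<^sub>R partial k (f j) y)"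
proof -
  have "partial k (\<lambda>z. c j *\<^sub>R f j z) y = c j *\<^sub>R partial k (f j) y" "(\<lambda>z. c j *\<^sub>R f j z) differentiable (at y)" for j
    using partial_bounded_linear[OF bounded_linear_scaleR_right assms] by auto
  then show ?thesis by (simp add: sum_2 partial_add_diff(1))
qed

lemma partial2_conj_rot:
  assumes v: "\<And>y. y \<in> disc \<Longrightarrow> v differentiable (at y)"
    and v2: "\<And>j y. y \<in> disc \<Longrightarrow> partial j v differentiable (at y)" and x: "x \<in> disc"
  shows "partial k (partial i (conj_rot \<theta> v)) x = rot (- \<theta>) (\<Sum>l\<in>UNIV. rot \<theta> (axis k 1) $ l *\<^sub>R
      (\<Sum>j\<in>UNIV. rot \<theta> (axis i 1) $ j *\<^sub>R partial l (partial j v) (rot \<theta> x)))"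
    and "partial i (conj_rot \<theta> v) differentiable (at x)"
proof -
  define g where "g z = (\<Sum>j\<in>UNIV. rot \<theta> (axis i 1) $ j *\<^sub>R partial j v z)" for z
  have eq: "conj_rot \<theta> g z = partial i (conj_rot \<theta> v) z" if "z \<in> disc" for z
    using partial_conj_rot(1)[OF v, of \<theta> z i] that unfolding g_def conj_rot_def rot_disc by simp
  have rx: "rot \<theta> x \<in> disc" using x rot_disc by blast
  have dg: "g differentiable (at (rot \<theta> x))"
    unfolding g_def[abs_def] by (intro differentiable_lincomb_partial v2 rx)
  show "partial i (conj_rot \<theta> v) differentiable (at x)"
    using differentiable_cong_disc[OF eq x partial_conj_rot(2)[OF dg]] .
  have "partial k (partial i (conj_rot \<theta> v)) x = partial k (conj_rot \<theta> g) x"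
    using partial_cong_disc[OF eq x] by simp
  also have "\<dots> = rot (- \<theta>) (\<Sum>l\<in>UNIV. rot \<theta> (axis k 1) $ l *\<^sub>R partial l g (rot \<theta> x))"
    by (rule partial_conj_rot(1)[OF dg])
  also have "\<dots> = rot (- \<theta>) (\<Sum>l\<in>UNIV. rot \<theta> (axis k 1) $ l *\<^sub>R
      (\<Sum>j\<in>UNIV. rot \<theta> (axis i 1) $ j *\<^sub>R partial l (partial j v) (rot \<theta> x)))"
    unfolding g_def[abs_def] partial_lincomb[of "\<lambda>j. partial j v", OF v2[OF rx]] ..
  finally show "partial k (partial i (conj_rot \<theta> v)) x = rot (- \<theta>) (\<Sum>l\<in>UNIV. rot \<theta> (axis k 1) $ l *\<^sub>R
      (\<Sum>j\<in>UNIV. rot \<theta> (axis i 1) $ j *\<^sub>R partial l (partial j v) (rot \<theta> x)))" .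
qed

lemma rot_axis:
  "rot \<theta> (axis 1 1) $ 1 = cos \<theta>" "rot \<theta> (axis 1 1) $ 2 = sin \<theta>"
  "rot \<theta> (axis 2 1) $ 1 = - sin \<theta>" "rot \<theta> (axis 2 1) $ 2 = cos \<theta>"
  by (auto simp: rot_nth axis_def)

text \<open>
  The Laplacian is the trace of the second derivative, which an orthogonal change of
  coordinates preserves.
\<close>
lemma laplacian_conj_rot:
  assumes v: "\<And>y. y \<in> disc \<Longrightarrow> v differentiable (at y)"
    and v2: "\<And>j y. y \<in> disc \<Longrightarrow> partial j v differentiable (at y)" and x: "x \<in> disc"
  shows "laplacian (conj_rot \<theta> v) x = conj_rot \<theta> (laplacian v) x"
proof -
  have cs: "(cos \<theta> * cos \<theta>) *\<^sub>R a + (sin \<theta> * sin \<theta>) *\<^sub>R a = a" for a :: "real ^ 2"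
    unfolding scaleR_add_left[symmetric] using sin_cos_squared_add3[of \<theta>] by (simp add: add.commute)
  have p2: "partial i (partial i (conj_rot \<theta> v)) x = rot (- \<theta>) (\<Sum>l\<in>UNIV. rot \<theta> (axis i 1) $ l *\<^sub>R
      (\<Sum>j\<in>UNIV. rot \<theta> (axis i 1) $ j *\<^sub>R partial l (partial j v) (rot \<theta> x)))" for i
    by (rule partial2_conj_rot(1)[OF _ _ x]) (fact v v2)+
  have "laplacian (conj_rot \<theta> v) x = rot (- \<theta>) (\<Sum>i\<in>UNIV. \<Sum>l\<in>UNIV. rot \<theta> (axis i 1) $ l *\<^sub>R
      (\<Sum>j\<in>UNIV. rot \<theta> (axis i 1) $ j *\<^sub>R partial l (partial j v) (rot \<theta> x)))"
    unfolding laplacian_def p2 linear_sum[OF linear_rot] ..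
  also have "(\<Sum>i\<in>UNIV. \<Sum>l\<in>UNIV. rot \<theta> (axis i 1) $ l *\<^sub>R
      (\<Sum>j\<in>UNIV. rot \<theta> (axis i 1) $ j *\<^sub>R partial l (partial j v) (rot \<theta> x))) = laplacian v (rot \<theta> x)"
    using cs[of "partial 1 (partial 1 v) (rot \<theta> x)"] cs[of "partial 2 (partial 2 v) (rot \<theta> x)"]
    by (simp add: laplacian_def sum_2 rot_axis algebra_simps)
  finally show ?thesis by (simp only: conj_rot_def[of \<theta> "laplacian v"])
qed

lemma divergence_conj_rot:
  assumes "v differentiable (at (rot \<theta> x))"
  shows "divergence (conj_rot \<theta> v) x = divergence v (rot \<theta> x)"
proof -
  let ?c = "cos \<theta>" and ?s = "sin \<theta>"
  let ?a = "partial 1 v (rot \<theta> x)" and ?b = "partial 2 v (rot \<theta> x)"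
  have "divergence (conj_rot \<theta> v) x = (?s\<^sup>2 + ?c\<^sup>2) * (?a $ 1 + ?b $ 2)"
    unfolding divergence_def sum_2 partial_conj_rot(1)[OF assms] rot_axis
    unfolding rot_nth
      vector_add_component vector_scaleR_component cos_minus sin_minus real_scaleR_def
    by algebra
  then show ?thesis by (simp add: divergence_def sum_2)
qed

lemma grad_rot:
  assumes "q differentiable (at (rot \<theta> x))"
  shows "grad (\<lambda>x. q (rot \<theta> x)) x = conj_rot \<theta> (grad q) x"
  by (simp add: vec_eq_2 conj_rot_def grad_def partial_rot(1)[OF assms] rot_nth sum_2 axis_def)

lemma advect_conj_rot:
  assumes "v differentiable (at (rot \<theta> x))"
  shows "advect (conj_rot \<theta> v) (conj_rot \<theta> v) x = conj_rot \<theta> (advect v v) x"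
proof -
  let ?w = "conj_rot \<theta> v x"
  have w: "v (rot \<theta> x) = rot \<theta> ?w" by (simp add: conj_rot_def)
  have "advect (conj_rot \<theta> v) (conj_rot \<theta> v) x = rot (- \<theta>) (\<Sum>i\<in>UNIV. ?w $ i *\<^sub>R
      (\<Sum>j\<in>UNIV. rot \<theta> (axis i 1) $ j *\<^sub>R partial j v (rot \<theta> x)))"
    unfolding advect_def partial_conj_rot(1)[OF assms] by (simp add: linear_sum[OF linear_rot] linear_scale[OF linear_rot])
  also have "(\<Sum>i\<in>UNIV. ?w $ i *\<^sub>R (\<Sum>j\<in>UNIV. rot \<theta> (axis i 1) $ j *\<^sub>R partial j v (rot \<theta> x)))
      = advect v v (rot \<theta> x)"
    unfolding advect_def w sum_2 rot_axis unfolding rot_nth by (simp add: algebra_simps)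
  finally show ?thesis by (simp only: conj_rot_def[of \<theta> "advect v v"])
qed

lemma cub_rot:
  assumes "cub f" shows "cub (\<lambda>t x. f t (rot \<theta> x))"
proof -
  obtain g where g: "continuous_on ({0<..} \<times> closed_disc) g" "\<forall>t>0. \<forall>x\<in>disc. g (t, x) = f t x"
    using assms unfolding continuous_up_to_boundary_def by blast
  have "continuous_on ({0<..} \<times> closed_disc) (\<lambda>z. g (fst z, rot \<theta> (snd z)))"
    by (rule continuous_on_compose2[OF g(1)])
      (auto intro!: continuous_intros bounded_linear.continuous_on[OF bounded_linear_rot])
  then show ?thesis
    unfolding continuous_up_to_boundary_def using g(2)
    by (intro exI[of _ "\<lambda>z. g (fst z, rot \<theta> (snd z))"]) auto
qed

lemma cub_compose:
  assumes "cub f" and "continuous_on UNIV h" shows "cub (\<lambda>t x. h (f t x))"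
proof -
  obtain g where g: "continuous_on ({0<..} \<times> closed_disc) g" "\<forall>t>0. \<forall>x\<in>disc. g (t, x) = f t x"
    using assms unfolding continuous_up_to_boundary_def by blast
  then show ?thesis
    unfolding continuous_up_to_boundary_def using continuous_on_compose2[OF assms(2) g(1) subset_UNIV]
    by (intro exI[of _ "\<lambda>z. h (g z)"]) auto
qed

lemma cub_lincomb:
  fixes f :: "2 \<Rightarrow> real \<Rightarrow> real ^ 2 \<Rightarrow> 'a::real_normed_vector"
  assumes "\<And>j. cub (f j)" shows "cub (\<lambda>t x. \<Sum>j\<in>UNIV. c j *\<^sub>R f j t x)"
  unfolding sum_2
  by (rule cub_compose2[of "f 1" "f 2" "\<lambda>a b. c 1 *\<^sub>R a + c 2 *\<^sub>R b"])
    (use assms in \<open>auto simp: case_prod_beta intro!: continuous_intros\<close>)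

lemma circularly_symmetric_rot:
  assumes "circularly_symmetric v" "x \<in> closed_disc"
  shows "v (rot \<theta> x) = rot \<theta> (v x)"
proof -
  obtain s where s: "\<forall>x\<in>closed_disc. v x = s (norm x) *\<^sub>R perp x"
    using assms(1) unfolding circularly_symmetric_def by blast
  have "rot \<theta> x \<in> closed_disc" using assms(2) by simp
  then show ?thesis
    using s assms(2) by (simp add: perp_rot linear_scale[OF linear_rot])
qed

text \<open>
  Circular symmetry of \<open>u0\<close> enters only through the initial condition: conjugation by a rotation
  does not change \<open>u0\<close>.
\<close>
lemma ns_rotate:
  assumes sol: "navier_stokes_solution \<nu> u0 u p" and u0: "continuous_on closed_disc u0"
    and sym: "circularly_symmetric u0"
  shows "navier_stokes_solution \<nu> u0 (\<lambda>t. conj_rot \<theta> (u t)) (\<lambda>t x. p t (rot \<theta> x))"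
proof -
  let ?u = "\<lambda>t. conj_rot \<theta> (u t)" and ?p = "\<lambda>t x. p t (rot \<theta> x)"
  have contA: "continuous_on UNIV (rot \<alpha>)" for \<alpha> by (intro linear_continuous_on bounded_linear_rot)
  have cub_conj: "cub (\<lambda>t. conj_rot \<theta> (f t))" if "cub f" for f
    unfolding conj_rot_def[abs_def] by (intro cub_compose[OF cub_rot[OF that]] contA)
  have d0: "u t differentiable (at y)" "partial j (u t) differentiable (at y)" if "t > 0" "y \<in> disc" for t y j
    using ns_C2[OF sol that(1)] that(2) by (auto simp: C2_disc_def C1_disc_def simp del: mem_ball)
  have dp: "p t differentiable (at y)" if "t > 0" "y \<in> disc" for t y
    using C1_discD(2)[OF ns_pressure_C1[OF sol]] that by blast
  have td0: "((\<lambda>\<tau>. ?u \<tau> x) has_vector_derivative rot (- \<theta>) (time_deriv u t (rot \<theta> x))) (at t)"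
    if "t > 0" "x \<in> disc" for t x
    unfolding conj_rot_def
    by (rule bounded_linear.has_vector_derivative[OF bounded_linear_rot])
      (use ns_time_deriv[OF sol that(1)] that(2) rot_disc in blast)
  have td: "time_deriv ?u t x = conj_rot \<theta> (time_deriv u t) x" if "t > 0" "x \<in> disc" for t x
    using vector_derivative_at[OF td0[OF that]]
    unfolding time_deriv_def[of ?u] by (simp only: conj_rot_def[of \<theta> "time_deriv u t"])
  have cub1: "cub (\<lambda>t. partial i (u t))" and cub2: "cub (\<lambda>t. partial j (partial i (u t)))" for i j
    using sol unfolding navier_stokes_solution_def regular_velocity_def by auto
  have cubp: "cub (\<lambda>t. partial i (p t))" for i
    using sol unfolding navier_stokes_solution_def regular_pressure_def by auto
  have contu: "continuous_on ({0<..} \<times> closed_disc) (\<lambda>(t, x). u t x)"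
    using sol unfolding navier_stokes_solution_def regular_velocity_def by auto
  have p1: "partial i (?u t) x = conj_rot \<theta> (\<lambda>y. \<Sum>j\<in>UNIV. rot \<theta> (axis i 1) $ j *\<^sub>R partial j (u t) y) x"
    if "t > 0" "x \<in> disc" for t x i
    using partial_conj_rot(1)[OF d0(1), of t \<theta> x i] that by (simp add: conj_rot_def)
  have p2: "partial k (partial i (?u t)) x = conj_rot \<theta> (\<lambda>y. \<Sum>l\<in>UNIV. rot \<theta> (axis k 1) $ l *\<^sub>R
      (\<Sum>j\<in>UNIV. rot \<theta> (axis i 1) $ j *\<^sub>R partial l (partial j (u t)) y)) x"
    and p2d: "partial i (?u t) differentiable (at x)"
    if "t > 0" "x \<in> disc" for t x i k
    using partial2_conj_rot[OF d0, of t x] that by (simp_all add: conj_rot_def)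
  have "continuous_on ({0<..} \<times> closed_disc) (\<lambda>z. rot (- \<theta>) ((\<lambda>(t, x). u t x) (fst z, rot \<theta> (snd z))))"
    by (intro continuous_on_compose2[OF contA _ subset_UNIV] continuous_on_compose2[OF contu]
        continuous_on_Pair continuous_intros) auto
  then have cu: "continuous_on ({0<..} \<times> closed_disc) (\<lambda>(t, x). ?u t x)"
    by (simp add: conj_rot_def case_prod_beta)
  have regv: "regular_velocity ?u"
    unfolding regular_velocity_def
  proof (intro conjI allI impI ballI cu)
    fix t :: real and x :: "real ^ 2" and i assume t: "t > 0" and x: "x \<in> disc"
    show "(\<lambda>\<tau>. ?u \<tau> x) differentiable (at t)"
      using td0[OF t x] by (rule differentiableI_vector)
    show "?u t differentiable (at x)"
      using partial_conj_rot(2)[OF d0(1)[OF t], of \<theta> x] x rot_disc by blast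
    show "partial i (?u t) differentiable (at x)" by (rule p2d[OF t x])
  next
    show "cub (time_deriv ?u)"
      by (rule cub_cong[OF cub_conj[OF ns_cub(2)[OF sol]]]) (simp add: td del: mem_ball)
    show "cub (\<lambda>t. partial i (?u t))" for i
      by (rule cub_cong[OF cub_conj[OF cub_lincomb[OF cub1, of "\<lambda>j. rot \<theta> (axis i 1) $ j"]]])
        (simp add: p1 del: mem_ball)
    show "cub (\<lambda>t. partial k (partial i (?u t)))" for i k
      by (rule cub_cong[OF cub_conj[OF cub_lincomb[OF cub_lincomb[OF cub2, of "\<lambda>j. rot \<theta> (axis i 1) $ j"], of "\<lambda>l. rot \<theta> (axis k 1) $ l"]]])
        (simp add: p2 del: mem_ball)
  qed
  have regp: "regular_pressure ?p"
    unfolding regular_pressure_def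
  proof (intro conjI allI impI ballI)
    fix t :: real and x :: "real ^ 2" assume t: "t > 0" and x: "x \<in> disc"
    show "?p t differentiable (at x)"
      using partial_rot(2)[OF dp[OF t], of \<theta> x] x rot_disc by blast
  next
    show "cub (\<lambda>t. partial i (?p t))" for i
      by (rule cub_cong[OF cub_rot[OF cub_lincomb[OF cubp, of "\<lambda>j. rot \<theta> (axis i 1) $ j"], where \<theta> = \<theta>]])
        (use partial_rot(1)[OF dp] rot_disc in simp)
  qed
  have eqs: "time_deriv ?u t x + advect (?u t) (?u t) x + grad (?p t) x = \<nu> *\<^sub>R laplacian (?u t) x"
    "divergence (?u t) x = 0" if t: "t > 0" and x: "x \<in> disc" for t x
  proof -
    have rx: "rot \<theta> x \<in> disc" using x rot_disc by blast
    have "time_deriv u t (rot \<theta> x) + advect (u t) (u t) (rot \<theta> x) + grad (p t) (rot \<theta> x) = \<nu> *\<^sub>R laplacian (u t) (rot \<theta> x)"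
      and div: "divergence (u t) (rot \<theta> x) = 0"
      using sol t rx unfolding navier_stokes_solution_def by blast+
    note eq = this(1)
    have lap: "laplacian (?u t) x = conj_rot \<theta> (laplacian (u t)) x"
      by (rule laplacian_conj_rot[OF _ _ x]) (fact d0(1)[OF t] d0(2)[OF t])+
    have "rot (- \<theta>) (time_deriv u t (rot \<theta> x) + advect (u t) (u t) (rot \<theta> x) + grad (p t) (rot \<theta> x))
        = rot (- \<theta>) (\<nu> *\<^sub>R laplacian (u t) (rot \<theta> x))" unfolding eq ..
    then show "time_deriv ?u t x + advect (?u t) (?u t) x + grad (?p t) x = \<nu> *\<^sub>R laplacian (?u t) x"
      unfolding td[OF t x] advect_conj_rot[OF d0(1)[OF t rx]] grad_rot[OF dp[OF t rx]]
        lap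
      by (simp add: conj_rot_def linear_add[OF linear_rot] linear_scale[OF linear_rot])
    show "divergence (?u t) x = 0" using div divergence_conj_rot[OF d0(1)[OF t rx]] by simp
  qed
  have u0r: "u0 x = rot (- \<theta>) (u0 (rot \<theta> x))" if "x \<in> closed_disc" for x
    using circularly_symmetric_rot[OF sym that] by simp
  have bc: "?u t x = 0" if "t > 0" "norm x = 1" for t x
    using sol that unfolding navier_stokes_solution_def by (simp add: conj_rot_def linear_0[OF linear_rot])
  have ic: "?u 0 x = u0 x" if "x \<in> closed_disc" for x
    using sol that u0r[OF that] unfolding navier_stokes_solution_def by (simp add: conj_rot_def)
  have "((\<lambda>t. integral\<^sup>L (lebesgue_on disc) (\<lambda>x. (norm (?u t x - u0 x))\<^sup>2)) \<longlongrightarrow> 0) (at_right 0)"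
  proof (rule Lim_transform_eventually[OF ns_initial[OF sol u0]])
    show "\<forall>\<^sub>F t in at_right 0. disc_integral (\<lambda>x. (norm (u t x - u0 x))\<^sup>2)
        = integral\<^sup>L (lebesgue_on disc) (\<lambda>x. (norm (?u t x - u0 x))\<^sup>2)"
      using eventually_at_right_less[of 0]
    proof eventually_elim
      case (elim t)
      have tm: "tame (\<lambda>x. (norm (u t x - u0 x))\<^sup>2)"
        by (intro tame_power tame_norm tame_diff tame_continuous[OF u0] cub_tame[OF ns_cub(1)[OF sol] elim])
      have tm': "tame (\<lambda>x. (norm (?u t x - u0 x))\<^sup>2)"
        by (intro tame_power tame_norm tame_diff tame_continuous[OF u0]
            cub_tame[OF cub_conj[OF ns_cub(1)[OF sol]] elim])
      have "disc_integral (\<lambda>x. (norm (u t x - u0 x))\<^sup>2)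
          = disc_integral (\<lambda>x. (norm (u t (rot \<theta> x) - u0 (rot \<theta> x)))\<^sup>2)"
        by (rule disc_integral_rot[OF tm, symmetric])
      also have "\<dots> = disc_integral (\<lambda>x. (norm (?u t x - u0 x))\<^sup>2)"
      proof (rule disc_integral_cong)
        fix x assume x: "x \<in> disc"
        have "?u t x - u0 x = rot (- \<theta>) (u t (rot \<theta> x) - u0 (rot \<theta> x))"
          using u0r[of x] x by (simp add: conj_rot_def linear_diff[OF linear_rot])
        then show "(norm (u t (rot \<theta> x) - u0 (rot \<theta> x)))\<^sup>2 = (norm (?u t x - u0 x))\<^sup>2" by simp
      qed
      also have "\<dots> = integral\<^sup>L (lebesgue_on disc) (\<lambda>x. (norm (?u t x - u0 x))\<^sup>2)"
        by (rule disc_integral_eq_lebesgue[OF tm', symmetric])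
      finally show ?case .
    qed
  qed
  then show ?thesis
    unfolding navier_stokes_solution_def using regv regp eqs bc ic by blast
qed

lemma ns_equivariant:
  assumes sol: "navier_stokes_solution \<nu> u0 u p" and u0: "continuous_on closed_disc u0"
    and sym: "circularly_symmetric u0" and \<nu>: "\<nu> > 0" and t: "t > 0" and x: "x \<in> disc"
  shows "u t (rot \<theta> x) = rot \<theta> (u t x)"
proof -
  have "conj_rot \<theta> (u t) x = u t x"
    by (rule ns_unique[OF ns_rotate[OF sol u0 sym] sol \<nu> u0 t x])
  then show ?thesis unfolding conj_rot_def by (metis rot_cancel(2))
qed

section \<open>Circular symmetry and the heat equation\<close>
lemma rot_vector_derivative:
  "((\<lambda>\<theta>. rot \<theta> x) has_vector_derivative perp (rot \<theta> x)) (at \<theta>)"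
proof -
  have "((\<lambda>\<theta>. rot \<theta> x) has_vector_derivative ((- sin \<theta>) *\<^sub>R x + cos \<theta> *\<^sub>R perp x)) (at \<theta>)"
    unfolding rot_def has_vector_derivative_def
    by (auto intro!: derivative_eq_intros simp: algebra_simps)
  also have "(- sin \<theta>) *\<^sub>R x + cos \<theta> *\<^sub>R perp x = perp (rot \<theta> x)"
    by (auto simp: vec_eq_2 perp_nth rot_nth)
  finally show ?thesis .
qed

lemma inner_perp [simp]: "x \<bullet> perp x = 0" "perp (perp x) = - x"
  by (auto simp: inner_2 perp_nth vec_eq_2)

lemma derivative_along_rotation:
  assumes "f differentiable (at (rot \<theta> x))"
  shows "((\<lambda>\<theta>. f (rot \<theta> x)) has_vector_derivative
    (\<Sum>j\<in>UNIV. perp (rot \<theta> x) $ j *\<^sub>R partial j f (rot \<theta> x))) (at \<theta>)"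
  using vector_derivative_diff_chain_within[OF rot_vector_derivative[of x \<theta>]
      has_derivative_at_withinI[OF has_derivative_sum_partial[OF assms]]]
  by (simp add: o_def)

text \<open>
  Differentiating \<open>v(R\<^sub>\<theta> x) = R\<^sub>\<theta> v(x)\<close> at \<open>\<theta> = 0\<close> determines \<open>Dv(x)\<close> on \<open>perp x\<close>. Its trace is zero, so
  \<open>Dv(x) x \<bullet> x = - Dv(x)(perp x) \<bullet> perp x = - v(x) \<bullet> x\<close>. Thus the derivative of \<open>v \<bullet> x\<close> along a ray,
  which is \<open>Dv(x) x \<bullet> x + v(x) \<bullet> x\<close> up to a factor, is zero, and at the centre \<open>v \<bullet> x = 0\<close>.
\<close>
lemma equivariant_div_free_tangential:
  fixes v :: "real ^ 2 \<Rightarrow> real ^ 2"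
  assumes v: "C1_disc v" and div: "\<And>x. x \<in> disc \<Longrightarrow> divergence v x = 0"
    and eqv: "\<And>\<theta> x. x \<in> disc \<Longrightarrow> v (rot \<theta> x) = rot \<theta> (v x)" and x: "x \<in> disc"
  shows "(\<Sum>j\<in>UNIV. perp x $ j *\<^sub>R partial j v x) = perp (v x)" and "v x \<bullet> x = 0"
proof -
  have perpD: "(\<Sum>j\<in>UNIV. perp y $ j *\<^sub>R partial j v y) = perp (v y)" if y: "y \<in> disc" for y
  proof -
    have "((\<lambda>\<theta>. v (rot \<theta> y)) has_vector_derivative (\<Sum>j\<in>UNIV. perp y $ j *\<^sub>R partial j v y)) (at 0)"
      using derivative_along_rotation[of v 0 y] C1_discD(2)[OF v y] by simp
    moreover have "((\<lambda>\<theta>. v (rot \<theta> y)) has_vector_derivative perp (v y)) (at 0)"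
      unfolding eqv[OF y] using rot_vector_derivative[of "v y" 0] by simp
    ultimately show ?thesis by (rule vector_derivative_unique_at)
  qed
  show "(\<Sum>j\<in>UNIV. perp x $ j *\<^sub>R partial j v x) = perp (v x)" by (rule perpD[OF x])
  define a where "a y = v y \<bullet> y" for y
  have radial: "(\<Sum>j\<in>UNIV. y $ j *\<^sub>R partial j v y) \<bullet> y + v y \<bullet> y = 0" if y: "y \<in> disc" for y
  proof -
    have e: "- (y $ 2) * partial 1 v y $ k + y $ 1 * partial 2 v y $ k = perp (v y) $ k" for k
      using arg_cong[OF perpD[OF y], of "\<lambda>z. z $ k"] by (simp add: sum_2 perp_nth)
    have d: "partial 2 v y $ 2 = - partial 1 v y $ 1"
      using div[OF y] by (simp add: divergence_def sum_2)
    have v1: "v y $ 1 = - (y $ 2) * partial 1 v y $ 2 + y $ 1 * partial 2 v y $ 2"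
      and v2: "v y $ 2 = y $ 2 * partial 1 v y $ 1 - y $ 1 * partial 2 v y $ 1"
      using e[of 1] e[of 2] by (auto simp: perp_nth)
    show ?thesis
      unfolding inner_2 sum_2 v1 v2 vector_add_component vector_scaleR_component real_scaleR_def d
      by (simp add: algebra_simps)
  qed
  have in_disc: "r *\<^sub>R x \<in> disc" if "0 \<le> r" "r \<le> 1" for r
    using that x mult_right_le_one_le[of "norm x" r] by (simp add: mult.commute)
  have deriv: "((\<lambda>r. a (r *\<^sub>R x)) has_real_derivative
      ((\<Sum>j\<in>UNIV. x $ j *\<^sub>R partial j v (r *\<^sub>R x)) \<bullet> (r *\<^sub>R x) + v (r *\<^sub>R x) \<bullet> x)) (at r)"
    if "0 \<le> r" "r \<le> 1" for r
  proof -
    have ray: "((\<lambda>r. r *\<^sub>R x) has_vector_derivative x) (at r)"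
      by (auto intro!: derivative_eq_intros)
    from vector_derivative_diff_chain_within[OF ray
        has_derivative_at_withinI[OF has_derivative_sum_partial[OF C1_discD(2)[OF v in_disc[OF that]]]]]
    have "((\<lambda>r. v (r *\<^sub>R x)) has_vector_derivative (\<Sum>j\<in>UNIV. x $ j *\<^sub>R partial j v (r *\<^sub>R x))) (at r)"
      by (simp add: o_def)
    from has_derivative_inner[OF this[unfolded has_vector_derivative_def] ray[unfolded has_vector_derivative_def]]
    show ?thesis
      unfolding a_def has_field_derivative_def
      by (rule has_derivative_eq_rhs) (auto simp: algebra_simps)
  qed
  have "a (1 *\<^sub>R x) = a (0 *\<^sub>R x)"
  proof (rule DERIV_isconst_end[of 0 1 "\<lambda>r. a (r *\<^sub>R x)"])
    show "continuous_on {0..1} (\<lambda>r. a (r *\<^sub>R x))"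
      by (intro continuous_at_imp_continuous_on ballI) (use deriv DERIV_isCont in force)
    show "((\<lambda>r. a (r *\<^sub>R x)) has_real_derivative 0) (at r)" if r: "0 < r" "r < 1" for r
    proof -
      have "r * ((\<Sum>j\<in>UNIV. x $ j *\<^sub>R partial j v (r *\<^sub>R x)) \<bullet> (r *\<^sub>R x) + v (r *\<^sub>R x) \<bullet> x) = 0"
        using radial[OF in_disc[of r]] r
        by (simp add: inner_sum_left sum_distrib_left algebra_simps)
      then show ?thesis using deriv[of r] r by simp
    qed
  qed simp
  then show "v x \<bullet> x = 0" by (simp add: a_def)
qed

lemma orthogonal_frame_zero:
  fixes h :: "real ^ 2"
  assumes "h \<bullet> x = 0" "h \<bullet> perp x = 0" "x \<noteq> 0"
  shows "h = 0"
proof -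
  have "(x \<bullet> x) * h $ 1 = (h \<bullet> x) * x $ 1 - (h \<bullet> perp x) * x $ 2"
    and "(x \<bullet> x) * h $ 2 = (h \<bullet> x) * x $ 2 + (h \<bullet> perp x) * x $ 1"
    unfolding inner_2 perp_nth by algebra+
  then show ?thesis using assms by (auto simp: vec_eq_2)
qed

lemma tangential_eq_scaled_perp:
  fixes h :: "real ^ 2"
  assumes "h \<bullet> x = 0" "x \<noteq> 0"
  shows "h = ((h \<bullet> perp x) / (x \<bullet> x)) *\<^sub>R perp x"
proof -
  have pp: "perp x \<bullet> perp x = x \<bullet> x" by (simp add: inner_2 perp_nth)
  have "h - ((h \<bullet> perp x) / (x \<bullet> x)) *\<^sub>R perp x = 0"
    by (rule orthogonal_frame_zero[OF _ _ assms(2)])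
      (use assms inner_perp(1)[of x] inner_commute[of "perp x" x] in \<open>simp_all add: inner_diff_left pp\<close>)
  then show ?thesis by simp
qed

text \<open>
  Apply the Laplacian to \<open>v \<bullet> x = 0\<close>: it equals \<open>\<Delta>v \<bullet> x + 2 div v\<close>.
\<close>
lemma laplacian_tangential:
  fixes v :: "real ^ 2 \<Rightarrow> real ^ 2"
  assumes v: "C2_disc v" and div: "\<And>x. x \<in> disc \<Longrightarrow> divergence v x = 0"
    and tan: "\<And>x. x \<in> disc \<Longrightarrow> v x \<bullet> x = 0" and x: "x \<in> disc"
  shows "laplacian v x \<bullet> x = 0"
proof -
  note d1 = C1_discD(2)[OF C2_discD(1)[OF v]] and d2 = C1_discD(2)[OF C2_discD(2)[OF v]]
  have idd: "(\<lambda>x::real^2. x) differentiable (at y)" and idp: "partial i (\<lambda>x::real^2. x) y = axis i 1" for i y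
    using has_derivative_partial[OF has_derivative_ident] by auto
  have const0: "partial i (\<lambda>_. 0 :: real) y = 0" for i y
    using has_derivative_partial[OF has_derivative_const] .
  have g: "partial i v y \<bullet> y + v y $ i = 0" if y: "y \<in> disc" for i y
  proof -
    have "partial i (\<lambda>z. v z \<bullet> z) y = v y \<bullet> axis i 1 + partial i v y \<bullet> y"
      using partial_bilinear(1)[OF bounded_bilinear_inner d1[OF y] idd, of i] by (simp add: idp)
    moreover have "partial i (\<lambda>z. v z \<bullet> z) y = 0"
      using partial_cong_disc[of "\<lambda>z. v z \<bullet> z" "\<lambda>_. 0" y i] tan y const0 by simp
    ultimately show ?thesis by (simp add: inner_axis)
  qed
  have "partial i (partial i v) x \<bullet> x + 2 * partial i v x $ i = 0" for i
  proof -
    have "partial i (\<lambda>z. partial i v z \<bullet> z + v z $ i) x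
        = (partial i v x \<bullet> axis i 1 + partial i (partial i v) x \<bullet> x) + partial i v x $ i"
      using d1[OF x] d2[OF x, of i] idd
      by (simp add: partial_add_diff(1) partial_bilinear[OF bounded_bilinear_inner]
          partial_bounded_linear[OF bounded_linear_vec_nth] idp)
    moreover have "partial i (\<lambda>z. partial i v z \<bullet> z + v z $ i) x = 0"
      using partial_cong_disc[of "\<lambda>z. partial i v z \<bullet> z + v z $ i" "\<lambda>_. 0" x i] g x const0 by simp
    ultimately show ?thesis by (simp add: inner_axis)
  qed
  then have "(\<Sum>i\<in>UNIV. partial i (partial i v) x \<bullet> x + 2 * partial i v x $ i) = 0" by simp
  then show ?thesis
    using div[OF x] by (simp add: laplacian_def divergence_def inner_sum_left sum.distrib sum_distrib_left[symmetric])
qed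

text \<open>
  The residual \<open>H = \<partial>\<^sub>tu - \<nu> \<Delta>u\<close> is tangential, and it commutes with rotations, so its angular
  component is constant on circles. That component is also the angular component of \<open>-\<nabla>p\<close>, whose
  integral over a full circle is zero.
\<close>
theorem ns_heat_equation:
  assumes sol: "navier_stokes_solution \<nu> u0 u p" and u0: "continuous_on closed_disc u0"
    and sym: "circularly_symmetric u0" and \<nu>: "\<nu> > 0" and t: "t > 0" and x: "x \<in> disc"
  shows "time_deriv u t x = \<nu> *\<^sub>R laplacian (u t) x"
proof -
  define H where "H y = time_deriv u t y - \<nu> *\<^sub>R laplacian (u t) y" for y
  note C2 = ns_C2[OF sol] note C1 = C2_discD(1)[OF C2]
  have eqv: "u s (rot \<theta> y) = rot \<theta> (u s y)" if "s > 0" "y \<in> disc" for s \<theta> y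
    using ns_equivariant[OF sol u0 sym \<nu> that] .
  have tan: "u s y \<bullet> y = 0" if "s > 0" "y \<in> disc" for s y
    by (rule equivariant_div_free_tangential(2)[OF C1[OF that(1)] ns_divergence[OF sol that(1)] eqv[OF that(1)] that(2)])
  have along: "(\<Sum>j\<in>UNIV. perp y $ j *\<^sub>R partial j (u t) y) = perp (u t y)" if "y \<in> disc" for y
    by (rule equivariant_div_free_tangential(1)[OF C1[OF t] ns_divergence[OF sol t] eqv[OF t] that])
  have H_tan: "H y \<bullet> y = 0" if y: "y \<in> disc" for y
  proof -
    have "((\<lambda>\<tau>. u \<tau> y \<bullet> y) has_vector_derivative time_deriv u t y \<bullet> y) (at t)"
      by (rule bounded_linear.has_vector_derivative[OF bounded_linear_inner_left ns_time_deriv[OF sol t y]])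
    moreover have "((\<lambda>\<tau>. u \<tau> y \<bullet> y) has_vector_derivative 0) (at t)"
      by (rule has_vector_derivative_transform_within_open[of "\<lambda>_. 0" _ _ "{0<..}"])
        (use t tan y in auto)
    ultimately have "time_deriv u t y \<bullet> y = 0" by (rule vector_derivative_unique_at)
    moreover have "laplacian (u t) y \<bullet> y = 0"
      by (rule laplacian_tangential[OF C2[OF t] ns_divergence[OF sol t] tan[OF t] y])
    ultimately show ?thesis by (simp add: H_def inner_diff_left)
  qed
  have H_eqv: "H (rot \<theta> y) = rot \<theta> (H y)" if y: "y \<in> disc" for \<theta> y
  proof -
    have ry: "rot \<theta> y \<in> disc" using y rot_disc by blast
    have "((\<lambda>\<tau>. rot \<theta> (u \<tau> y)) has_vector_derivative rot \<theta> (time_deriv u t y)) (at t)"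
      by (rule bounded_linear.has_vector_derivative[OF bounded_linear_rot ns_time_deriv[OF sol t y]])
    then have "((\<lambda>\<tau>. u \<tau> (rot \<theta> y)) has_vector_derivative rot \<theta> (time_deriv u t y)) (at t)"
      by (rule has_vector_derivative_transform_within_open[of _ _ _ "{0<..}"]) (use t eqv y in auto)
    then have td: "time_deriv u t (rot \<theta> y) = rot \<theta> (time_deriv u t y)"
      using ns_time_deriv[OF sol t ry] vector_derivative_unique_at by blast
    have "conj_rot \<theta> (laplacian (u t)) y = laplacian (conj_rot \<theta> (u t)) y"
      by (rule laplacian_conj_rot[OF _ _ y, symmetric])
        (fact C1_discD(2)[OF C1[OF t]] C1_discD(2)[OF C2_discD(2)[OF C2[OF t]]])+
    also have "\<dots> = laplacian (u t) y"
    proof -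
      have c: "conj_rot \<theta> (u t) z = u t z" if "z \<in> disc" for z
        using eqv[OF t that] by (simp add: conj_rot_def)
      have "partial i (conj_rot \<theta> (u t)) z = partial i (u t) z" if "z \<in> disc" for i z
        by (rule partial_cong_disc[OF c that])
      then have "partial i (partial i (conj_rot \<theta> (u t))) y = partial i (partial i (u t)) y" for i
        by (rule partial_cong_disc[OF _ y])
      then show ?thesis by (simp add: laplacian_def)
    qed
    finally have "laplacian (u t) (rot \<theta> y) = rot \<theta> (laplacian (u t) y)"
      unfolding conj_rot_def by (metis rot_cancel(2))
    then show ?thesis
      unfolding H_def td by (simp add: linear_diff[OF linear_rot] linear_scale[OF linear_rot])
  qed
  have H_perp: "H y \<bullet> perp y = - (grad (p t) y \<bullet> perp y)" if y: "y \<in> disc" for y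
  proof (cases "y = 0")
    case True
    then show ?thesis by (simp add: linear_0[OF linear_perp])
  next
    case False
    define c where "c = (u t y \<bullet> perp y) / (y \<bullet> y)"
    have uy: "u t y = c *\<^sub>R perp y" unfolding c_def by (rule tangential_eq_scaled_perp[OF tan[OF t y] False])
    have "advect (u t) (u t) y = c *\<^sub>R (\<Sum>j\<in>UNIV. perp y $ j *\<^sub>R partial j (u t) y)"
      unfolding advect_def uy by (simp add: scaleR_sum_right)
    also have "\<dots> = - (c * c) *\<^sub>R y"
      unfolding along[OF y] uy by (simp add: linear_scale[OF linear_perp])
    finally have "advect (u t) (u t) y \<bullet> perp y = 0" by simp
    then show ?thesis
      unfolding H_def ns_momentum[OF sol t y] by (simp add: inner_diff_left)
  qed
  have H_perp0: "H x \<bullet> perp x = 0"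
  proof -
    have rx: "rot \<theta> x \<in> disc" for \<theta> using x rot_disc by blast
    have D: "((\<lambda>\<theta>. p t (rot \<theta> x)) has_real_derivative - (H x \<bullet> perp x)) (at \<theta>)" for \<theta>
    proof -
      have "((\<lambda>\<theta>. p t (rot \<theta> x)) has_real_derivative
          (\<Sum>j\<in>UNIV. perp (rot \<theta> x) $ j *\<^sub>R partial j (p t) (rot \<theta> x))) (at \<theta>)"
        using derivative_along_rotation[OF C1_discD(2)[OF ns_pressure_C1[OF sol t] rx]]
        by (simp add: has_real_derivative_iff_has_vector_derivative)
      also have "(\<Sum>j\<in>UNIV. perp (rot \<theta> x) $ j *\<^sub>R partial j (p t) (rot \<theta> x))
          = grad (p t) (rot \<theta> x) \<bullet> perp (rot \<theta> x)"
        by (simp add: inner_2 sum_2 grad_def)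
      also have "\<dots> = - (H (rot \<theta> x) \<bullet> perp (rot \<theta> x))" using H_perp[OF rx] by simp
      also have "\<dots> = - (H x \<bullet> perp x)" unfolding H_eqv[OF x] perp_rot by simp
      finally show ?thesis .
    qed
    obtain z where "p t (rot (2 * pi) x) - p t (rot 0 x) = (2 * pi - 0) * - (H x \<bullet> perp x)"
      using MVT2[of 0 "2 * pi" "\<lambda>\<theta>. p t (rot \<theta> x)" "\<lambda>_. - (H x \<bullet> perp x)"] D by auto
    moreover have "rot (2 * pi) x = x" by (simp add: rot_def)
    ultimately show ?thesis by simp
  qed
  have "H x = 0"
  proof (cases "x = 0")
    case True
    \<comment> \<open>\<open>H\<close> commutes with the half turn, which is \<open>-1\<close>\<close>
    have "rot pi (0 :: real ^ 2) = 0" by (rule linear_0[OF linear_rot])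
    then have "H 0 = rot pi (H 0)" using H_eqv[of 0 pi] by simp
    then have "H 0 = - H 0" by (simp add: rot_def)
    then have "H 0 = 0" by (simp add: vec_eq_2)
    then show ?thesis using True by simp
  next
    case False
    then show ?thesis using orthogonal_frame_zero H_tan[OF x] H_perp0 by blast
  qed
  then show ?thesis by (simp add: H_def)
qed

section \<open>Comparison with quadratic barriers\<close>
text \<open>
  The penalty is \<open>q\<^sup>2 / (1 + q)\<close> with \<open>q = (max 0 z)\<^sup>2\<close>. It is twice differentiable, which the
  integration by parts in the comparison principle requires, and it is bounded by \<open>q\<close>, so that
  convergence to the datum in \<open>L\<^sup>2\<close> controls its integral as \<open>t \<rightarrow> 0\<close>. The functions
  \<open>penalty'\<close> and \<open>penalty''\<close> are its first and second derivatives.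
\<close>
definition pos_sq :: "real \<Rightarrow> real" where
  "pos_sq z = (max 0 z)\<^sup>2"

definition penalty :: "real \<Rightarrow> real" where
  "penalty z = pos_sq z - 1 + inverse (1 + pos_sq z)"

definition penalty' :: "real \<Rightarrow> real" where
  "penalty' z = 2 * z * (1 - (inverse (1 + pos_sq z))\<^sup>2)"

definition penalty'' :: "real \<Rightarrow> real" where
  "penalty'' z = 2 * (1 - (inverse (1 + pos_sq z))\<^sup>2) + 8 * pos_sq z * (inverse (1 + pos_sq z)) ^ 3"

lemma pos_sq_nonneg [simp]: "0 \<le> pos_sq z"
  by (simp add: pos_sq_def)

lemma pos_sq_pos [simp]: "1 + pos_sq z \<noteq> 0" "0 < 1 + pos_sq z"
  using pos_sq_nonneg[of z] by linarith+

lemma pos_sq_derivative: "(pos_sq has_real_derivative 2 * max 0 z) (at z)"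
proof -
  consider "z < 0" | "z = 0" | "z > 0" by linarith
  then show ?thesis
  proof cases
    case 1
    have "((\<lambda>_. 0) has_real_derivative 2 * max 0 z) (at z)" using 1 by simp
    then show ?thesis
      by (rule has_field_derivative_transform_within_open[of _ _ _ "{..<0}"]) (use 1 in \<open>auto simp: pos_sq_def\<close>)
  next
    case 3
    have "((\<lambda>z. z\<^sup>2) has_real_derivative 2 * max 0 z) (at z)"
      using 3 by (auto intro!: derivative_eq_intros)
    then show ?thesis
      by (rule has_field_derivative_transform_within_open[of _ _ _ "{0<..}"]) (use 3 in \<open>auto simp: pos_sq_def\<close>)
  next
    case 2
    have "((\<lambda>h. max 0 h) \<longlongrightarrow> 0) (at (0::real))"
      using tendsto_max[OF tendsto_const tendsto_ident_at, of "0::real" 0 UNIV] by simp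
    moreover have "max 0 h = (pos_sq h - pos_sq 0) / h" if "h \<noteq> 0" for h :: real
      using that by (auto simp: pos_sq_def max_def power2_eq_square)
    then have "\<forall>\<^sub>F h in at 0. max 0 h = (pos_sq h - pos_sq 0) / h"
      unfolding eventually_at_filter by (intro always_eventually) blast
    ultimately have "((\<lambda>h. (pos_sq h - pos_sq 0) / h) \<longlongrightarrow> 0) (at 0)"
      by (rule Lim_transform_eventually)
    then show ?thesis using 2 by (simp add: has_field_derivative_iff)
  qed
qed

lemma max_pos_sq: "max 0 z * pos_sq z = z * pos_sq z" "z * max 0 z = pos_sq z"
  by (auto simp: pos_sq_def max_def power2_eq_square)

lemma inverse_pos_sq:
  "1 - inverse (1 + pos_sq z) = pos_sq z * inverse (1 + pos_sq z)"
  "0 < inverse (1 + pos_sq z)" "inverse (1 + pos_sq z) \<le> 1"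
  by (auto simp: field_simps)

lemma penalty_derivative: "(penalty has_real_derivative penalty' z) (at z)"
proof -
  let ?w = "inverse (1 + pos_sq z)"
  have "(penalty has_real_derivative 2 * max 0 z - ?w * (2 * max 0 z) * ?w) (at z)"
    unfolding penalty_def[abs_def] by (auto intro!: derivative_eq_intros pos_sq_derivative)
  also have "2 * max 0 z - ?w * (2 * max 0 z) * ?w = 2 * max 0 z * (1 - ?w) * (1 + ?w)"
    by (simp add: algebra_simps)
  also have "\<dots> = 2 * (max 0 z * pos_sq z) * ?w * (1 + ?w)"
    unfolding inverse_pos_sq(1) by simp
  also have "\<dots> = 2 * z * (pos_sq z * ?w) * (1 + ?w)"
    unfolding max_pos_sq by simp
  also have "\<dots> = penalty' z"
    unfolding inverse_pos_sq(1)[symmetric] penalty'_def by (simp add: algebra_simps power2_eq_square)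
  finally show ?thesis .
qed

lemma penalty'_derivative: "(penalty' has_real_derivative penalty'' z) (at z)"
proof -
  let ?w = "inverse (1 + pos_sq z)"
  have W: "((\<lambda>z. inverse (1 + pos_sq z)) has_real_derivative - (?w * (2 * max 0 z) * ?w)) (at z)"
    by (auto intro!: derivative_eq_intros pos_sq_derivative)
  have "(penalty' has_real_derivative
      2 * (1 - ?w\<^sup>2) + 2 * z * (2 * ?w * (?w * (2 * max 0 z) * ?w))) (at z)"
    unfolding penalty'_def[abs_def]
    by (rule DERIV_cong[OF DERIV_mult[OF DERIV_cmult[OF DERIV_ident] DERIV_diff[OF DERIV_const DERIV_power[OF W]]]])
      (simp add: algebra_simps)
  also have "2 * z * (2 * ?w * (?w * (2 * max 0 z) * ?w)) = 8 * (z * max 0 z) * ?w ^ 3"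
    by (simp add: power3_eq_cube)
  finally show ?thesis unfolding max_pos_sq penalty''_def .
qed

lemma penalty_nonneg: "0 \<le> penalty z"
  and penalty_le: "penalty z \<le> pos_sq z"
  and penalty_eq_0D: "penalty z = 0 \<Longrightarrow> z \<le> 0"
proof -
  have "penalty z = pos_sq z * (1 - inverse (1 + pos_sq z))"
    unfolding inverse_pos_sq(1) penalty_def by (simp add: field_simps)
  then have eq: "penalty z = (pos_sq z)\<^sup>2 * inverse (1 + pos_sq z)"
    unfolding inverse_pos_sq(1) by (simp add: power2_eq_square)
  show "0 \<le> penalty z" unfolding eq using inverse_pos_sq(2)[of z] by simp
  show "penalty z \<le> pos_sq z" unfolding penalty_def using inverse_pos_sq(3)[of z] by simp
  show "z \<le> 0" if "penalty z = 0"
    using that inverse_pos_sq(2)[of z] unfolding eq by (auto simp: pos_sq_def max_def split: if_splits)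
qed

lemma penalty''_nonneg: "0 \<le> penalty'' z"
proof -
  have "(inverse (1 + pos_sq z))\<^sup>2 \<le> 1"
    using inverse_pos_sq(2,3)[of z] by (intro power_le_one) auto
  then show ?thesis
    unfolding penalty''_def using inverse_pos_sq(2)[of z] by (intro add_nonneg_nonneg mult_nonneg_nonneg) auto
qed

lemma penalty'_nonpos_eq_0: "z \<le> 0 \<Longrightarrow> penalty' z = 0"
  by (simp add: penalty'_def pos_sq_def max_def)

lemma continuous_penalty:
  "continuous_on UNIV penalty" "continuous_on UNIV penalty'" "continuous_on UNIV penalty''"
proof -
  show "continuous_on UNIV penalty" "continuous_on UNIV penalty'"
    by (intro continuous_at_imp_continuous_on ballI DERIV_isCont[OF penalty_derivative]
        DERIV_isCont[OF penalty'_derivative])+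
  have "continuous_on UNIV pos_sq"
    by (intro continuous_at_imp_continuous_on ballI DERIV_isCont[OF pos_sq_derivative])
  then show "continuous_on UNIV penalty''"
    unfolding penalty''_def[abs_def] by (intro continuous_intros) auto
qed

lemma tame_compose:
  fixes f :: "real ^ 2 \<Rightarrow> real" and h :: "real \<Rightarrow> real"
  assumes f: "tame f" and h: "continuous_on UNIV h"
  shows "tame (\<lambda>x. h (f x))"
proof -
  obtain B where B: "B > 0" "\<And>x. x \<in> disc \<Longrightarrow> norm (f x) \<le> B" using f tame_boundE by blast
  have "bounded (h ` {-B..B})"
    by (intro compact_imp_bounded compact_continuous_image continuous_on_subset[OF h]) auto
  then have "bounded ((\<lambda>x. h (f x)) ` disc)"
    by (rule bounded_subset) (use B in \<open>force simp: abs_le_iff\<close>)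
  moreover have "continuous_on disc (\<lambda>x. h (f x))"
    using f by (intro continuous_on_compose2[OF h]) (auto simp: tame_def)
  ultimately show ?thesis by (simp add: tame_def)
qed

lemma C1_disc_compose:
  fixes f :: "real ^ 2 \<Rightarrow> real" and h h' :: "real \<Rightarrow> real"
  assumes f: "C1_disc f" and h: "\<And>z. (h has_real_derivative h' z) (at z)" and h': "continuous_on UNIV h'"
  shows "C1_disc (\<lambda>x. h (f x))"
    and "x \<in> disc \<Longrightarrow> partial i (\<lambda>x. h (f x)) x = h' (f x) * partial i f x"
proof -
  have D: "((\<lambda>x. h (f x)) has_derivative (\<lambda>k. frechet_derivative f (at x) k * h' (f x))) (at x)"
    if "x \<in> disc" for x
    using DERIV_compose_FDERIV[OF h] C1_discD(2)[OF f that] frechet_derivative_works by blast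
  have p: "partial i (\<lambda>x. h (f x)) x = h' (f x) * partial i f x" if "x \<in> disc" for i x
    using has_derivative_partial[OF D[OF that], of i] by (simp add: partial_def)
  have ch: "continuous_on UNIV h"
    by (intro continuous_at_imp_continuous_on ballI DERIV_isCont[OF h])
  show "C1_disc (\<lambda>x. h (f x))"
    unfolding C1_disc_def
  proof (intro conjI ballI allI)
    show "tame (\<lambda>x. h (f x))" by (rule tame_compose[OF C1_discD(1)[OF f] ch])
    show "(\<lambda>x. h (f x)) differentiable (at x)" if "x \<in> disc" for x
      using D[OF that] unfolding differentiable_def by blast
    show "tame (partial i (\<lambda>x. h (f x)))" for i
      by (rule tame_cong[OF tame_mult[OF tame_compose[OF C1_discD(1)[OF f] h'] C1_discD(3)[OF f, of i]]])
        (rule p[symmetric])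
  qed
  show "x \<in> disc \<Longrightarrow> partial i (\<lambda>x. h (f x)) x = h' (f x) * partial i f x" by (rule p)
qed

lemma partial_ident: "partial i (\<lambda>x. x) x = axis i 1"
  using has_derivative_partial[OF has_derivative_ident] .

lemma partial_const: "partial i (\<lambda>_. c) x = 0"
  using has_derivative_partial[OF has_derivative_const] .

lemma C1_disc_const: "C1_disc (\<lambda>_. c)"
  unfolding C1_disc_def by (auto simp: partial_const[abs_def] intro!: tame_const)

lemma C1_disc_ident: "C1_disc (\<lambda>x. x)"
proof -
  have "partial i (\<lambda>x. x) = (\<lambda>_. axis i 1)" for i by (rule ext) (rule partial_ident)
  then show ?thesis
    unfolding C1_disc_def by (auto intro!: tame_const tame_continuous[OF continuous_on_id])
qed

text \<open>
  Let \<open>z\<close> be the excess of \<open>u \<bullet> e\<close> over the barrier. Then \<open>\<partial>\<^sub>tz = \<nu> \<Delta>z\<close> and \<open>penalty' z\<close> vanishes at the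
  circle, so \<open>\<integral> penalty z\<close> has the derivative \<open>- \<nu> \<integral> penalty''(z) |\<nabla>z|\<^sup>2 \<le> 0\<close>. It tends to \<open>0\<close> as
  \<open>t \<rightarrow> 0\<close> because \<open>z \<le> (u - u\<^sub>0) \<bullet> e\<close>. Hence it is zero and \<open>z \<le> 0\<close>.
\<close>
lemma ns_comparison:
  assumes sol: "navier_stokes_solution \<nu> u0 u p" and u0: "continuous_on closed_disc u0"
    and sym: "circularly_symmetric u0" and \<nu>: "\<nu> > 0"
    and e: "norm e \<le> 1" and b: "0 \<le> b"
    and boundary: "\<And>x. norm x = 1 \<Longrightarrow> 0 \<le> a + b * (norm (x - x0))\<^sup>2"
    and initial: "\<And>x. x \<in> disc \<Longrightarrow> u0 x \<bullet> e \<le> a + b * (norm (x - x0))\<^sup>2"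
    and t: "t > 0" and x: "x \<in> disc"
  shows "u t x \<bullet> e \<le> a + b * ((norm (x - x0))\<^sup>2 + 4 * \<nu> * t)"
proof -
  define z where "z t x = u t x \<bullet> e - (a + b * ((x - x0) \<bullet> (x - x0) + 4 * \<nu> * t))" for t x
  define g where "g t i x = partial i (u t) x \<bullet> e - 2 * b * (x - x0) $ i" for t i x
  define y where "y t = disc_integral (\<lambda>x. penalty (z t x))" for t
  note C2 = ns_C2[OF sol] note C1 = C2_discD(1)[OF C2]
  note bl = bounded_bilinear_inner bounded_linear_inner_left bounded_bilinear_mult bounded_linear_vec_nth bounded_linear_mult_right
  have Cq: "C1_disc (\<lambda>x. (x - x0) \<bullet> (x - x0))"
    by (intro C1_disc_bilinear[OF bl(1)] C1_disc_diff C1_disc_ident C1_disc_const)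
  have Cz: "C1_disc (z t)" if "t > 0" for t
  proof -
    have "C1_disc (\<lambda>x. (u t x \<bullet> e - b * ((x - x0) \<bullet> (x - x0))) - (a + b * (4 * \<nu> * t)))"
      by (intro C1_disc_diff C1_disc_const C1_disc_bounded_linear[OF bl(2)] C1_disc_bounded_linear[OF bl(5)] Cq C1[OF that])
    then show ?thesis by (rule C1_disc_cong) (simp add: z_def algebra_simps)
  qed
  have Cg: "C1_disc (g t i)" if "t > 0" for t i
    unfolding g_def by (intro C1_disc_diff C1_disc_const C1_disc_bounded_linear[OF bl(2)] C1_disc_ident
        C1_disc_bounded_linear[OF bl(5)] C1_disc_bounded_linear[OF bl(4)] C2_discD(2)[OF C2[OF that]])
  have pz: "partial i (z t) x = g t i x" if t: "t > 0" and x: "x \<in> disc" for t i x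
  proof -
    have 1: "((\<lambda>x. (x - x0) \<bullet> (x - x0)) has_derivative (\<lambda>k. (x - x0) \<bullet> k + k \<bullet> (x - x0))) (at x)"
      by (auto intro!: derivative_eq_intros)
    have 2: "((\<lambda>x. u t x \<bullet> e) has_derivative (\<lambda>k. frechet_derivative (u t) (at x) k \<bullet> e)) (at x)"
      using C1_discD(2)[OF C1[OF t] x] unfolding frechet_derivative_works
      by (rule bounded_linear.has_derivative[OF bl(2)])
    have "(z t has_derivative (\<lambda>k. frechet_derivative (u t) (at x) k \<bullet> e - b * ((x - x0) \<bullet> k + k \<bullet> (x - x0)))) (at x)"
      unfolding z_def
      by (rule has_derivative_eq_rhs[OF has_derivative_diff[OF 2 has_derivative_add[OF has_derivative_const
            has_derivative_mult_right[OF has_derivative_add[OF 1 has_derivative_const]]]]]) simp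
    from has_derivative_partial[OF this, of i] show ?thesis
      by (simp add: g_def partial_def inner_axis inner_axis' algebra_simps)
  qed
  have pg: "partial j (g t i) x = partial j (partial i (u t)) x \<bullet> e - 2 * b * (if i = j then 1 else 0)"
    if t: "t > 0" and x: "x \<in> disc" for t i j x
  proof -
    have 1: "((\<lambda>x. partial i (u t) x \<bullet> e) has_derivative (\<lambda>k. frechet_derivative (partial i (u t)) (at x) k \<bullet> e)) (at x)"
      using C1_discD(2)[OF C2_discD(2)[OF C2[OF t]] x] unfolding frechet_derivative_works
      by (rule bounded_linear.has_derivative[OF bl(2)])
    have 2: "((\<lambda>x. (x - x0) $ i) has_derivative (\<lambda>k. k $ i)) (at x)"
      by (auto intro!: derivative_eq_intros bounded_linear.has_derivative[OF bl(4)])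
    have "(g t i has_derivative (\<lambda>k. frechet_derivative (partial i (u t)) (at x) k \<bullet> e - 2 * b * k $ i)) (at x)"
      unfolding g_def by (intro has_derivative_diff 1 has_derivative_mult_right 2)
    from has_derivative_partial[OF this, of j] show ?thesis
      by (simp add: partial_def axis_def)
  qed
  define h where "h t x = penalty' (z t x)" for t x
  have Ch: "C1_disc (h t)" and ph: "x \<in> disc \<Longrightarrow> partial i (h t) x = penalty'' (z t x) * g t i x"
    if t: "t > 0" for t i x
    unfolding h_def using C1_disc_compose[OF Cz[OF t] penalty'_derivative continuous_penalty(3)] pz[OF t]
    by auto
  have van: "vanishing (h t)" if t: "t > 0" for t
    unfolding vanishing_def
  proof
    fix y :: "real ^ 2" assume y: "y \<in> sphere 0 1"
    have "(u t \<longlongrightarrow> 0) (at y within disc)" using ns_vanishing[OF sol t] y by (auto simp: vanishing_def)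
    then have "(z t \<longlongrightarrow> 0 \<bullet> e - (a + b * ((y - x0) \<bullet> (y - x0) + 4 * \<nu> * t))) (at y within disc)"
      unfolding z_def by (intro tendsto_intros)
    moreover have "isCont penalty' (0 \<bullet> e - (a + b * ((y - x0) \<bullet> (y - x0) + 4 * \<nu> * t)))"
      by (rule DERIV_isCont[OF penalty'_derivative])
    ultimately have "(h t \<longlongrightarrow> penalty' (0 \<bullet> e - (a + b * ((y - x0) \<bullet> (y - x0) + 4 * \<nu> * t)))) (at y within disc)"
      unfolding h_def using isCont_tendsto_compose by blast
    moreover have "0 \<le> b * (4 * \<nu> * t)" using b \<nu> t by simp
    then have "0 \<le> a + b * ((y - x0) \<bullet> (y - x0) + 4 * \<nu> * t)"
      using boundary[of y] y by (simp add: power2_norm_eq_inner algebra_simps)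
    then have "penalty' (0 \<bullet> e - (a + b * ((y - x0) \<bullet> (y - x0) + 4 * \<nu> * t))) = 0"
      by (intro penalty'_nonpos_eq_0) simp
    ultimately show "(h t \<longlongrightarrow> 0) (at y within disc)" by simp
  qed
  define z' where "z' t x = time_deriv u t x \<bullet> e - 4 * \<nu> * b" for t x
  have z'_eq: "z' t x = \<nu> * (\<Sum>i\<in>UNIV. partial i (g t i) x)" if "t > 0" "x \<in> disc" for t x
    using ns_heat_equation[OF sol u0 sym \<nu> that]
    by (simp add: z'_def pg[OF that] laplacian_def sum_2 inner_add_left algebra_simps)
  have decreasing: "\<exists>D\<le>0. (y has_real_derivative D) (at t)" if t: "t > 0" for t
  proof -
    have "(y has_real_derivative disc_integral (\<lambda>x. h t x * z' t x)) (at t)"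
      unfolding y_def
    proof (rule Leibniz_disc_integral[OF _ _ _ t])
      show "((\<lambda>\<tau>. penalty (z \<tau> x)) has_real_derivative h t x * z' t x) (at t)" if tx: "t > 0" "x \<in> disc" for t x
      proof -
        have "((\<lambda>\<tau>. u \<tau> x \<bullet> e) has_real_derivative time_deriv u t x \<bullet> e) (at t)"
          unfolding has_real_derivative_iff_has_vector_derivative
          by (rule bounded_linear.has_vector_derivative[OF bl(2) ns_time_deriv[OF sol tx]])
        moreover have "((\<lambda>\<tau>. a + b * ((x - x0) \<bullet> (x - x0) + 4 * \<nu> * \<tau>)) has_real_derivative 4 * \<nu> * b) (at t)"
          by (auto intro!: derivative_eq_intros)
        ultimately have "((\<lambda>\<tau>. z \<tau> x) has_real_derivative z' t x) (at t)"
          unfolding z_def z'_def by (rule DERIV_diff)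
        from DERIV_chain2[OF penalty_derivative this] show ?thesis unfolding h_def .
      qed
      show "tame (\<lambda>x. penalty (z t x))" if "t > 0" for t
        by (rule tame_compose[OF C1_discD(1)[OF Cz[OF that]] continuous_penalty(1)])
      have "cub (\<lambda>t x. a + b * ((x - x0) \<bullet> (x - x0) + 4 * \<nu> * t))"
        by (rule cub_continuous) (simp add: case_prod_beta, intro continuous_intros)
      then have "cub z"
        unfolding z_def[abs_def]
        by (rule cub_compose2[OF ns_cub(1)[OF sol], of _ "\<lambda>v c. v \<bullet> e - c"]) (simp add: case_prod_beta, intro continuous_intros)
      moreover have "cub z'"
        unfolding z'_def[abs_def] by (rule cub_compose[OF ns_cub(2)[OF sol]]) (intro continuous_intros)
      ultimately show "cub (\<lambda>t x. h t x * z' t x)"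
        unfolding h_def
        by (rule cub_compose2[of z z' "\<lambda>a b. penalty' a * b"])
          (auto simp: case_prod_beta intro!: continuous_intros continuous_on_compose2[OF continuous_penalty(2)])
    qed
    moreover have "disc_integral (\<lambda>x. h t x * z' t x) \<le> 0"
    proof -
      have CF: "C1_disc (\<lambda>x. h t x * g t i x)" for i by (intro C1_disc_bilinear[OF bl(3)] Ch Cg t)
      have "0 = (\<Sum>i\<in>UNIV. disc_integral (partial i (\<lambda>x. h t x * g t i x)))"
        using disc_integral_partial_C1[OF CF vanishing_bilinear[OF bl(3) van[OF t] C1_discD(1)[OF Cg[OF t]]]] by simp
      also have "\<dots> = disc_integral (\<lambda>x. \<Sum>i\<in>UNIV. partial i (\<lambda>x. h t x * g t i x) x)"
        by (intro disc_integral_sum[symmetric] finite C1_discD(3) CF)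
      finally have 0: "disc_integral (\<lambda>x. \<Sum>i\<in>UNIV. partial i (\<lambda>x. h t x * g t i x) x) = 0" ..
      have "disc_integral (\<lambda>x. h t x * z' t x)
          \<le> disc_integral (\<lambda>x. \<nu> * (\<Sum>i\<in>UNIV. partial i (\<lambda>x. h t x * g t i x) x))"
      proof (rule disc_integral_mono)
        have "tame (\<lambda>x. h t x * (\<nu> * (\<Sum>i\<in>UNIV. partial i (g t i) x)))"
          by (intro tame_mult tame_const tame_sum C1_discD(3)[OF Cg[OF t]] C1_discD(1)[OF Ch[OF t]]) auto
        then show "tame (\<lambda>x. h t x * z' t x)"
          by (rule tame_cong) (simp add: z'_eq[OF t] del: mem_ball)
        show "tame (\<lambda>x. \<nu> * (\<Sum>i\<in>UNIV. partial i (\<lambda>x. h t x * g t i x) x))"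
          by (intro tame_mult tame_const tame_sum C1_discD(3)[OF CF]) auto
        fix x assume x: "x \<in> disc"
        have "partial i (\<lambda>x. h t x * g t i x) x
            = h t x * partial i (g t i) x + penalty'' (z t x) * (g t i x)\<^sup>2" for i
          using partial_bilinear(1)[OF bl(3) C1_discD(2)[OF Ch[OF t] x] C1_discD(2)[OF Cg[OF t] x]] ph[OF t x]
          by (simp add: power2_eq_square)
        then have "h t x * partial i (g t i) x \<le> partial i (\<lambda>x. h t x * g t i x) x" for i
          using penalty''_nonneg[of "z t x"] by simp
        then have "(\<Sum>i\<in>UNIV. h t x * partial i (g t i) x) \<le> (\<Sum>i\<in>UNIV. partial i (\<lambda>x. h t x * g t i x) x)"
          by (intro sum_mono)
        then have "\<nu> * (\<Sum>i\<in>UNIV. h t x * partial i (g t i) x) \<le> \<nu> * (\<Sum>i\<in>UNIV. partial i (\<lambda>x. h t x * g t i x) x)"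
          using \<nu> by (intro mult_left_mono) auto
        then show "h t x * z' t x \<le> \<nu> * (\<Sum>i\<in>UNIV. partial i (\<lambda>x. h t x * g t i x) x)"
          unfolding z'_eq[OF t x] sum_distrib_left[symmetric] by (simp add: mult.left_commute)
      qed
      also have "\<dots> = 0" using 0 by simp
      finally show ?thesis .
    qed
    ultimately show ?thesis by blast
  qed
  have lim: "(y \<longlongrightarrow> 0) (at_right 0)"
  proof (rule tendsto_sandwich[OF _ _ tendsto_const ns_initial[OF sol u0]])
    show "\<forall>\<^sub>F t in at_right 0. 0 \<le> y t"
      unfolding y_def by (intro always_eventually allI disc_integral_nonneg penalty_nonneg)
    show "\<forall>\<^sub>F t in at_right 0. y t \<le> disc_integral (\<lambda>x. (norm (u t x - u0 x))\<^sup>2)"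
      using eventually_at_right_less[of 0]
    proof eventually_elim
      case (elim t)
      show ?case
        unfolding y_def
      proof (rule disc_integral_mono)
        show "tame (\<lambda>x. penalty (z t x))"
          by (rule tame_compose[OF C1_discD(1)[OF Cz[OF elim]] continuous_penalty(1)])
        show "tame (\<lambda>x. (norm (u t x - u0 x))\<^sup>2)"
          by (intro tame_power tame_norm tame_diff tame_continuous[OF u0] C1_discD(1)[OF C1[OF elim]])
        fix x assume x: "x \<in> disc"
        have "0 \<le> b * (4 * \<nu> * t)" using b \<nu> elim by simp
        then have "z t x \<le> (u t x - u0 x) \<bullet> e"
          using initial[OF x] by (simp add: z_def power2_norm_eq_inner inner_diff_left algebra_simps)
        also have "\<dots> \<le> norm (u t x - u0 x) * norm e"
          using Cauchy_Schwarz_ineq2[of "u t x - u0 x" e] by linarith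
        also have "\<dots> \<le> norm (u t x - u0 x)" using e by (simp add: mult_left_le)
        finally have "max 0 (z t x) \<le> norm (u t x - u0 x)" by simp
        then have "pos_sq (z t x) \<le> (norm (u t x - u0 x))\<^sup>2"
          unfolding pos_sq_def by (intro power_mono) auto
        then show "penalty (z t x) \<le> (norm (u t x - u0 x))\<^sup>2"
          using penalty_le[of "z t x"] by linarith
      qed
    qed
  qed
  have "y t \<le> 0" by (rule nonpos_of_decreasing_from_0[OF decreasing lim t])
  then have "penalty (z t x) = 0"
    unfolding y_def
    by (intro disc_integral_eq_0D[OF _ _ _ x] tame_compose[OF C1_discD(1)[OF Cz[OF t]] continuous_penalty(1)] penalty_nonneg)
  then have "z t x \<le> 0" by (rule penalty_eq_0D)
  then show ?thesis by (simp add: z_def power2_norm_eq_inner)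
qed

section \<open>The vanishing viscosity limit\<close>
text \<open>
  For a continuous field the essential supremum is a supremum: the points where a bound fails
  form an open set.
\<close>
lemma le_esssup_disc:
  fixes v :: "real ^ 2 \<Rightarrow> real ^ 2"
  assumes v: "continuous_on disc v" and x: "x \<in> disc"
  shows "ereal (norm (v x)) \<le> Linf_norm v"
proof (rule ccontr)
  assume gt: "\<not> ereal (norm (v x)) \<le> Linf_norm v"
  let ?U = "{y \<in> disc. Linf_norm v < ereal (norm (v y))}"
  have op: "open ?U"
  proof -
    have "open (disc \<inter> (\<lambda>y. ereal (norm (v y))) -` {Linf_norm v<..})"
      by (intro continuous_open_preimage continuous_intros v) auto
    also have "disc \<inter> (\<lambda>y. ereal (norm (v y))) -` {Linf_norm v<..} = ?U" by auto
    finally show ?thesis .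
  qed
  have "AE y in lebesgue_on disc. ereal (norm (v y)) \<le> Linf_norm v"
    unfolding Linf_norm_def by (rule esssup_AE)
  then have "AE y in lebesgue. y \<in> disc \<longrightarrow> ereal (norm (v y)) \<le> Linf_norm v"
    by (subst (asm) AE_restrict_space_iff) auto
  moreover have "{y \<in> space lebesgue. \<not> (y \<in> disc \<longrightarrow> ereal (norm (v y)) \<le> Linf_norm v)} = ?U"
    by (auto simp: not_le)
  moreover have "?U \<in> sets lebesgue" using op by (simp add: lborelD borel_open)
  ultimately have "negligible ?U"
    using AE_iff_null[of lebesgue "\<lambda>y. y \<in> disc \<longrightarrow> ereal (norm (v y)) \<le> Linf_norm v"]
    by (simp add: negligible_iff_null_sets)
  then have "?U = {}" using open_not_negligible[OF op] by argo
  then show False using gt x by auto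
qed

lemma Linf_norm_le:
  fixes v :: "real ^ 2 \<Rightarrow> real ^ 2"
  assumes v: "continuous_on disc v" and le: "\<And>x. x \<in> disc \<Longrightarrow> ereal (norm (v x)) \<le> c"
  shows "Linf_norm v \<le> c"
  unfolding Linf_norm_def
proof (rule esssup_I)
  have "(\<lambda>x. norm (v x)) \<in> borel_measurable (lebesgue_on disc)"
    by (intro continuous_imp_measurable_on_sets_lebesgue continuous_intros v) auto
  then show "(\<lambda>x. ereal (norm (v x))) \<in> borel_measurable (lebesgue_on disc)"
    by (rule borel_measurable_ereal)
  show "AE x in lebesgue_on disc. ereal (norm (v x)) \<le> c"
    using le by (intro AE_I2) (auto simp: space_restrict_space)
qed

lemma inner_sgn_le: "v \<bullet> sgn w \<le> norm v" for v w :: "real ^ 2"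
proof -
  have "v \<bullet> sgn w \<le> norm v * norm (sgn w)" using Cauchy_Schwarz_ineq2[of v "sgn w"] by linarith
  also have "\<dots> \<le> norm v" by (simp add: mult_left_le norm_sgn)
  finally show ?thesis .
qed

lemma inner_sgn: "v \<bullet> sgn v = norm v" for v :: "real ^ 2"
  by (cases "v = 0") (simp_all add: sgn_div_norm dot_square_norm power2_eq_square)

lemma ns_maximum_principle:
  assumes sol: "navier_stokes_solution \<nu> u0 u p" and u0: "continuous_on closed_disc u0"
    and sym: "circularly_symmetric u0" and \<nu>: "\<nu> > 0"
    and M: "\<And>x. x \<in> disc \<Longrightarrow> norm (u0 x) \<le> M" and t: "t > 0" and x: "x \<in> disc"
  shows "norm (u t x) \<le> M"
proof -
  define e where "e = sgn (u t x)"
  have e: "norm e \<le> 1" by (simp add: e_def norm_sgn)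
  have "0 \<le> M" using M[of 0] norm_ge_zero[of "u0 0"] by (meson centre_in_ball order_trans zero_less_one)
  have "u t x \<bullet> e \<le> M + 0 * ((norm (x - 0))\<^sup>2 + 4 * \<nu> * t)"
  proof (rule ns_comparison[OF sol u0 sym \<nu> e order_refl _ _ t x])
    show "u0 y \<bullet> e \<le> M + 0 * (norm (y - 0))\<^sup>2" if "y \<in> disc" for y
      using inner_sgn_le[of "u0 y" "u t x"] M[OF that] by (simp add: e_def)
  qed (use \<open>0 \<le> M\<close> in simp)
  moreover have "u t x \<bullet> e = norm (u t x)"
    unfolding e_def by (rule inner_sgn)
  ultimately show ?thesis by simp
qed

lemma ns_initial_value: "navier_stokes_solution \<nu> u0 u p \<Longrightarrow> x \<in> closed_disc \<Longrightarrow> u 0 x = u0 x"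
  unfolding navier_stokes_solution_def by blast

lemma ns_Linf_le:
  assumes sol: "navier_stokes_solution \<nu> u0 u p" and u0: "continuous_on closed_disc u0"
    and sym: "circularly_symmetric u0" and \<nu>: "\<nu> > 0" and t: "t \<ge> 0"
  shows "Linf_norm (u t) \<le> Linf_norm u0"
proof -
  have u0d: "continuous_on disc u0" using u0 by (rule continuous_on_subset) auto
  note le0 = le_esssup_disc[OF u0d]
  show ?thesis
  proof (cases "t = 0")
    case True
    have eq: "u t x = u0 x" if "x \<in> disc" for x
      using ns_initial_value[OF sol, of x] that True by simp
    have "continuous_on disc (u t)"
      using u0d by (rule continuous_on_eq) (rule eq[symmetric])
    then show ?thesis by (rule Linf_norm_le) (use eq le0 in simp)
  next
    case False
    then have t: "t > 0" using t by simp
    have ct: "continuous_on disc (u t)"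
      using C1_discD(1)[OF C2_discD(1)[OF ns_C2[OF sol t]]] by (simp add: tame_def)
    show ?thesis
    proof (cases "Linf_norm u0")
      case (real M)
      have "norm (u0 x) \<le> M" if "x \<in> disc" for x using le0[OF that] real by simp
      then have "norm (u t x) \<le> M" if "x \<in> disc" for x
        using ns_maximum_principle[OF sol u0 sym \<nu> _ t that] by blast
      then show ?thesis by (intro Linf_norm_le[OF ct]) (simp add: real del: mem_ball)
    next
      case MInf
      then show ?thesis using le0[of 0] by simp
    qed simp
  qed
qed

text \<open>
  The barrier starts \<open>\<epsilon>\<close> above \<open>u\<^sub>0(x) \<bullet> e\<close> at \<open>x\<close> and has risen by \<open>2 M\<close> at distance \<open>\<delta>\<close>. So within
  distance \<open>\<delta>\<close> it dominates by the choice of \<open>\<delta>\<close>, and beyond that distance, in particular on the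
  circle, it is at least \<open>M\<close>. Its value at \<open>x\<close> grows at the rate \<open>4 \<nu> b = 8 M \<nu> / \<delta>\<^sup>2\<close>.
\<close>
lemma ns_local_estimate:
  assumes sol: "navier_stokes_solution \<nu> u0 u p" and u0: "continuous_on closed_disc u0"
    and sym: "circularly_symmetric u0" and \<nu>: "\<nu> > 0"
    and M: "\<And>y. y \<in> closed_disc \<Longrightarrow> norm (u0 y) \<le> M"
    and \<delta>: "\<delta> > 0" "\<And>y. y \<in> closed_disc \<Longrightarrow> norm (y - x) < \<delta> \<Longrightarrow> norm (u0 y - u0 x) \<le> \<epsilon>"
    and x: "norm x + \<delta> \<le> 1" and t: "t > 0"
  shows "norm (u t x - u0 x) \<le> \<epsilon> + 8 * M * \<nu> * t / \<delta>\<^sup>2"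
proof -
  define e where "e = sgn (u t x - u0 x)"
  define b where "b = 2 * M / \<delta>\<^sup>2"
  have e: "norm e \<le> 1" by (simp add: e_def norm_sgn)
  have inner_le: "v \<bullet> e \<le> norm v" for v
    unfolding e_def by (rule inner_sgn_le)
  have xd: "x \<in> disc" "x \<in> closed_disc" using x \<delta>(1) by auto
  have M0: "0 \<le> M" using M[OF xd(2)] norm_ge_zero[of "u0 x"] by linarith
  have \<epsilon>0: "0 \<le> \<epsilon>" using \<delta>(2)[OF xd(2)] \<delta>(1) by simp
  have b0: "0 \<le> b" using M0 by (simp add: b_def)
  have ge: "- M \<le> u0 x \<bullet> e" using inner_le[of "- u0 x"] M[OF xd(2)] by simp
  have far: "M \<le> (u0 x \<bullet> e + \<epsilon>) + b * (norm (y - x))\<^sup>2" if "\<delta> \<le> norm (y - x)" for y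
  proof -
    have "2 * M = b * \<delta>\<^sup>2" using \<delta>(1) by (simp add: b_def)
    also have "\<dots> \<le> b * (norm (y - x))\<^sup>2"
      using that \<delta>(1) b0 by (intro mult_left_mono power_mono) auto
    finally show ?thesis using ge \<epsilon>0 by linarith
  qed
  have "u t x \<bullet> e \<le> (u0 x \<bullet> e + \<epsilon>) + b * ((norm (x - x))\<^sup>2 + 4 * \<nu> * t)"
  proof (rule ns_comparison[OF sol u0 sym \<nu> e b0 _ _ t xd(1)])
    show "0 \<le> (u0 x \<bullet> e + \<epsilon>) + b * (norm (y - x))\<^sup>2" if "norm y = 1" for y
      using far[of y] norm_triangle_ineq2[of y x] that x M0 by linarith
    show "u0 y \<bullet> e \<le> (u0 x \<bullet> e + \<epsilon>) + b * (norm (y - x))\<^sup>2" if y: "y \<in> disc" for y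
    proof (cases "norm (y - x) < \<delta>")
      case True
      have "(u0 y - u0 x) \<bullet> e \<le> \<epsilon>" using inner_le[of "u0 y - u0 x"] \<delta>(2)[of y] True y by simp
      moreover have "0 \<le> b * (norm (y - x))\<^sup>2" using b0 by simp
      ultimately show ?thesis by (simp add: inner_diff_left)
    next
      case False
      then show ?thesis using far[of y] inner_le[of "u0 y"] M[of y] y by simp
    qed
  qed
  moreover have "(u t x - u0 x) \<bullet> e = norm (u t x - u0 x)"
    unfolding e_def by (rule inner_sgn)
  ultimately show ?thesis by (simp add: inner_diff_left b_def algebra_simps)
qed

lemma locally_uniform_limit:
  fixes u0 :: "real ^ 2 \<Rightarrow> real ^ 2"
  assumes u0: "continuous_on closed_disc u0" and sym: "circularly_symmetric u0"
    and sol: "\<And>\<nu>. \<nu> > 0 \<Longrightarrow> navier_stokes_solution \<nu> u0 (u \<nu>) (p \<nu>)"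
    and K: "compact K" "K \<subseteq> disc"
  shows "uniform_limit ({0..T} \<times> K) (\<lambda>\<nu> (t, x). u \<nu> t x) (\<lambda>(t, x). u0 x) (at_right 0)"
  unfolding uniform_limit_iff
proof (intro allI impI)
  fix \<epsilon> :: real assume \<epsilon>: "\<epsilon> > 0"
  have comp: "compact (u0 ` closed_disc)" by (intro compact_continuous_image u0 compact_cball)
  then obtain M where M: "M > 0" "\<And>y. y \<in> closed_disc \<Longrightarrow> norm (u0 y) \<le> M"
    using compact_imp_bounded[OF comp] unfolding bounded_pos by blast
  have "uniformly_continuous_on closed_disc u0"
    by (rule compact_uniformly_continuous[OF u0 compact_cball])
  moreover have "\<epsilon> / 2 > 0" using \<epsilon> by simp
  ultimately obtain \<delta>1 where \<delta>1: "\<delta>1 > 0"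
    "\<And>x y. x \<in> closed_disc \<Longrightarrow> y \<in> closed_disc \<Longrightarrow> dist y x < \<delta>1 \<Longrightarrow> dist (u0 y) (u0 x) < \<epsilon> / 2"
    unfolding uniformly_continuous_on_def by metis
  obtain r where r: "r < 1" "\<And>x. x \<in> K \<Longrightarrow> norm x \<le> r"
  proof (cases "K = {}")
    case True
    then show ?thesis using that[of 0] by simp
  next
    case False
    then obtain z where "z \<in> K" "\<forall>x\<in>K. norm x \<le> norm z"
      using continuous_attains_sup[OF K(1) False, of norm] continuous_on_norm_id by blast
    then show ?thesis using that[of "norm z"] K(2) by auto
  qed
  define \<delta> where "\<delta> = min \<delta>1 (1 - r)"
  have \<delta>: "\<delta> > 0" "\<delta> \<le> \<delta>1" "\<delta> \<le> 1 - r" using \<delta>1(1) r(1) by (auto simp: \<delta>_def)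
  define S where "S = \<bar>T\<bar> + 1"
  have S: "S > 0" "T \<le> S" by (auto simp: S_def)
  \<comment> \<open>chosen so that the viscous term of the local estimate is at most \<open>\<epsilon> / 4\<close> up to time \<open>S\<close>\<close>
  define \<nu>0 where "\<nu>0 = \<epsilon> * \<delta>\<^sup>2 / (32 * M * S)"
  have "\<nu>0 > 0" using \<epsilon> \<delta>(1) M(1) S(1) by (simp add: \<nu>0_def)
  then have "\<forall>\<^sub>F \<nu> in at_right 0. \<nu> \<in> {0<..<\<nu>0}" by (rule eventually_at_right_real)
  then show "\<forall>\<^sub>F \<nu> in at_right 0. \<forall>z\<in>{0..T} \<times> K.
      dist (case z of (t, x) \<Rightarrow> u \<nu> t x) (case z of (t, x) \<Rightarrow> u0 x) < \<epsilon>"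
  proof eventually_elim
    case (elim \<nu>)
    then have \<nu>: "\<nu> > 0" "\<nu> < \<nu>0" by auto
    have "dist (u \<nu> t x) (u0 x) < \<epsilon>" if tT: "t \<in> {0..T}" and x: "x \<in> K" for t x
    proof (cases "t = 0")
      case True
      have "x \<in> closed_disc" using x K(2) by force
      then show ?thesis using ns_initial_value[OF sol[OF \<nu>(1)]] True \<epsilon> by simp
    next
      case False
      then have t: "t > 0" using tT by simp
      have xd: "x \<in> closed_disc" using r x by force
      have "norm (u \<nu> t x - u0 x) \<le> \<epsilon> / 2 + 8 * M * \<nu> * t / \<delta>\<^sup>2"
      proof (rule ns_local_estimate[OF sol[OF \<nu>(1)] u0 sym \<nu>(1) M(2) \<delta>(1) _ _ t])
        show "norm (u0 y - u0 x) \<le> \<epsilon> / 2" if "y \<in> closed_disc" "norm (y - x) < \<delta>" for y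
          using \<delta>1(2)[OF xd that(1)] that(2) \<delta>(2) by (simp add: dist_norm)
        show "norm x + \<delta> \<le> 1" using r(2)[OF x] \<delta>(3) by linarith
      qed
      also have "8 * M * \<nu> * t / \<delta>\<^sup>2 \<le> 8 * M * \<nu>0 * S / \<delta>\<^sup>2"
        using \<nu> t tT M(1) S \<open>\<nu>0 > 0\<close> by (intro divide_right_mono mult_mono) auto
      also have "\<dots> = \<epsilon> / 4" using \<delta>(1) M(1) S(1) by (simp add: \<nu>0_def)
      finally show ?thesis using \<epsilon> by (simp add: dist_norm)
    qed
    then show ?case by auto
  qed
qed

theorem proposition10p2:
  fixes u0 :: "real ^ 2 \<Rightarrow> real ^ 2"
    and u :: "real \<Rightarrow> real \<Rightarrow> real ^ 2 \<Rightarrow> real ^ 2"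
    and p :: "real \<Rightarrow> real \<Rightarrow> real ^ 2 \<Rightarrow> real"
    and T0 :: real
  assumes "continuous_on closed_disc u0"
    and "circularly_symmetric u0"
    and "\<And>\<nu>. \<nu> > 0 \<Longrightarrow> navier_stokes_solution \<nu> u0 (u \<nu>) (p \<nu>)"
    and "T0 > 0"
  shows "(\<forall>K. compact K \<and> K \<subseteq> disc \<longrightarrow>
            uniform_limit ({0..T0} \<times> K) (\<lambda>\<nu> (t, x). u \<nu> t x) (\<lambda>(t, x). u0 x) (at_right 0)) \<and>
         (\<forall>\<nu>>0. \<forall>t\<in>{0..T0}. Linf_norm (u \<nu> t) \<le> Linf_norm u0)"
proof (intro conjI allI impI ballI)
  fix K :: "(real ^ 2) set" assume "compact K \<and> K \<subseteq> disc"
  then show "uniform_limit ({0..T0} \<times> K) (\<lambda>\<nu> (t, x). u \<nu> t x) (\<lambda>(t, x). u0 x) (at_right 0)"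
    using locally_uniform_limit[OF assms(1,2,3)] by blast
next
  fix \<nu> t :: real assume "\<nu> > 0" "t \<in> {0..T0}"
  then show "Linf_norm (u \<nu> t) \<le> Linf_norm u0"
    using ns_Linf_le[OF assms(3) assms(1,2)] by simp
qed

end
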